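(* Let $\overline M=M\cup\partial M$ be a smooth manifold with boundary and let $g$ be a pseudo-Riemannian metric on $M$ such that locally around each $x\in\partial M$ there is a local defining function $\rho:U\to\mathbb R$ for $\partial M$ and a nowhere vanishing smooth function $C:U\to\mathbb R$ such that the section $$h:=\rho^2\Big(g-\frac{C}{\rho^4}d\rho^2\Big)$$ of $S^2T^*M|_{U\cap M}$ admits a smooth extension to the boundary, whose boundary value is non-degenerate on $T\partial M\times T\partial M$. Suppose further that the function $C$ has the property that for each vector field $\zeta$ that is smooth up to the boundary and such that $d\rho(\zeta)\equiv0$, we have $\zeta\cdot C=\mathcal O(\rho)$. Then $g$ is projectively pre-compact with totally geodesic boundary. If we even have $\zeta\cdot C=\mathcal O(\rho^2)$ for any vector field $\zeta$ that is smooth up to the boundary and such that $d\rho(\zeta)\equiv0$, then $g$ is projectively compact (of order $1$).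
   Context: Setting. $\overline M$ is a smooth manifold with boundary $\partial M$ and interior $M$, $\dim\overline M=n+1$. An object on $U\cap M$ ($U\subset\overline M$ open) "admits a smooth extension to the boundary" (is "smooth up to the boundary") if it is the restriction of a smooth object on $U$. A local defining function for $\partial M$ is a smooth $\rho:U\to\mathbb R$, $U\subset\overline M$ open, with $\rho^{-1}(0)=U\cap\partial M$ and $d\rho$ nowhere zero on $U\cap\partial M$. $f=\mathcal O(\rho^k)$, $k\ge1$, means $f=\rho^kf_1$ with $f_1$ smooth on $U$. $\mathfrak X_\partial(U)\subset\mathfrak X(U)$ is the space of vector fields tangent to $\partial M$ along $U\cap\partial M$. Connections. A torsion-free linear connection on $TM$ is special if it preserves a (nowhere vanishing) volume density. For a local defining function $\rho:U\to\mathbb R$ put $\nabla^\rho_\xi\eta:=\nabla_\xi\eta+\frac{d\rho(\xi)}{\rho}\eta+\frac{d\rho(\eta)}{\rho}\xi$ on $U\cap M$. A special $\nabla$ is projectively pre-compact (of order $1$) if for each $U$ and each local defining function $\rho:U\to\mathbb R$: (i) $d\rho(\nabla^\rho_\xi\eta)$ is smooth up to the boundary for all $\xi,\eta\in\mathfrak X(U)$; (ii) $\rho\nabla^\rho_\xi\eta$ is smooth up to the boundary for all $\xi,\eta\in\mathfrak X(U)$; (iii) $\nabla^\rho_\xi\eta$ is smooth up to the boundary if at least one of $\xi,\eta\in\mathfrak X(U)$ lies in $\mathfrak X_\partial(U)$. It is projectively compact (of order $1$) if $\nabla^\rho_\xi\eta$ is smooth up to the boundary for all $\xi,\eta\in\mathfrak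 X(U)$. A pseudo-Riemannian metric on $M$ has one of these properties if its Levi-Civita connection does. A projectively pre-compact $\nabla$ has totally geodesic boundary if its canonical weighted second fundamental form on $T\partial M\times T\partial M$ vanishes; equivalently, for every local defining function $\rho$ and all $\xi,\eta\in\mathfrak X_\partial(U)$, $d\rho(\nabla^\rho_\xi\eta)$ vanishes along $U\cap\partial M$. *)

theory Defs
  imports "HOL-Analysis.Analysis"
begin

section \<open>Smooth functions on subsets of Euclidean space\<close>

text \<open>\<open>Ck_on\<close> is meant for open \<open>S\<close>.\<close>

primrec Ck_on :: "nat \<Rightarrow> 'x::real_normed_vector set \<Rightarrow> ('x \<Rightarrow> 'b::real_normed_vector) \<Rightarrow> bool" where
  "Ck_on 0 S f \<longleftrightarrow> continuous_on S f"
| "Ck_on (Suc k) S f \<longleftrightarrow> (\<forall>x\<in>S. f differentiable (at x)) \<and>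
     (\<forall>v. Ck_on k S (\<lambda>x. frechet_derivative f (at x) v))"

text \<open>On a set that need not be open, smooth means: locally the restriction of a smooth
  function defined on an open set.\<close>

definition smooth_on :: "'x::real_normed_vector set \<Rightarrow> ('x \<Rightarrow> 'b::real_normed_vector) \<Rightarrow> bool" where
  "smooth_on S f \<longleftrightarrow> (\<forall>x\<in>S. \<exists>W F. open W \<and> x \<in> W \<and> (\<forall>k. Ck_on k W F) \<and> (\<forall>y\<in>W \<inter> S. F y = f y))"

section \<open>Smooth manifolds with boundary\<close>

text \<open>The manifold with boundary is the whole type \<open>'a\<close>, of dimension \<open>CARD('n)\<close>. The model
  is the closed half-space on which one arbitrarily fixed coordinate is nonnegative.\<close>

definition bidx :: "'n::finite" where
  "bidx = (SOME i. True)"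

definition halfspace :: "(real^'n) set" where
  "halfspace = {x. 0 \<le> x $ bidx}"

type_synonym ('a, 'n) chart = "'a set \<times> ('a \<Rightarrow> real^'n)"

definition is_chart :: "('a::topological_space, 'n::finite) chart \<Rightarrow> bool" where
  "is_chart c \<longleftrightarrow> (case c of (V, \<phi>) \<Rightarrow> open V \<and>
     openin (top_of_set halfspace) (\<phi> ` V) \<and> homeomorphism V (\<phi> ` V) \<phi> (inv_into V \<phi>))"

definition smooth_manifold_with_boundary ::
  "('a::{t2_space,second_countable_topology}, 'n::finite) chart set \<Rightarrow> bool" where
  "smooth_manifold_with_boundary A \<longleftrightarrow>
     (\<forall>c\<in>A. is_chart c) \<and> (\<Union>(V, \<phi>)\<in>A. V) = UNIV \<and>
     (\<forall>(V, \<phi>)\<in>A. \<forall>(W, \<psi>)\<in>A. smooth_on (\<phi> ` (V \<inter> W)) (\<psi> \<circ> inv_into V \<phi>))"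

definition bdry :: "('a, 'n::finite) chart set \<Rightarrow> 'a set" where
  "bdry A = {p. \<exists>(V, \<phi>)\<in>A. p \<in> V \<and> \<phi> p $ bidx = 0}"

text \<open>Smoothness of a function on an open subset \<open>U\<close> of the manifold with boundary; values
  outside \<open>U\<close> are irrelevant.\<close>

definition smooth_fun ::
  "('a, 'n::finite) chart set \<Rightarrow> 'a set \<Rightarrow> ('a \<Rightarrow> 'b::real_normed_vector) \<Rightarrow> bool" where
  "smooth_fun A U f \<longleftrightarrow> (\<forall>(V, \<phi>)\<in>A. smooth_on (\<phi> ` (U \<inter> V)) (f \<circ> inv_into V \<phi>))"

section \<open>Tangent vectors, vector fields, tensor fields\<close>

text \<open>The tangent space at \<open>p\<close> is represented by \<open>real^'n\<close>: a vector \<open>v\<close> stands for the tangent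
  vector whose components in the selected chart \<open>chart_at A p\<close> are the components of \<open>v\<close>. The
  selected chart may jump from point to point, so a vector field \<open>'a \<Rightarrow> real^'n\<close> being smooth
  is not smoothness of this function, but of its components in each fixed chart.\<close>

definition chart_at :: "('a, 'n::finite) chart set \<Rightarrow> 'a \<Rightarrow> ('a, 'n) chart" where
  "chart_at A p = (SOME c. c \<in> A \<and> p \<in> fst c)"

text \<open>\<open>dd A f p v\<close> is the differential of \<open>f\<close> at \<open>p\<close> applied to the tangent vector \<open>v\<close>, so
  \<open>\<lambda>p. dd A f p (\<xi> p)\<close> is the derivative of \<open>f\<close> along the vector field \<open>\<xi>\<close>. At boundary points
  the derivative within the half-space is still uniquely determined.\<close>

definition dd :: "('a, 'n::finite) chart set \<Rightarrow> ('a \<Rightarrow> 'b::real_normed_vector) \<Rightarrow> 'a \<Rightarrow> real^'n \<Rightarrow> 'b" where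
  "dd A f p v = (case chart_at A p of (V, \<phi>) \<Rightarrow>
     frechet_derivative (f \<circ> inv_into V \<phi>) (at (\<phi> p) within halfspace) v)"

text \<open>For a chart \<open>(V, \<phi>)\<close>, \<open>dd A \<phi> p (\<xi> p)\<close> is the vector of components of \<open>\<xi>\<close> in that chart.\<close>

definition vector_fields ::
  "('a::topological_space, 'n::finite) chart set \<Rightarrow> 'a set \<Rightarrow> ('a \<Rightarrow> real^'n) set" where
  "vector_fields A U = {\<xi>. \<forall>(V, \<phi>)\<in>A. smooth_fun A (U \<inter> V) (\<lambda>p. dd A \<phi> p (\<xi> p))}"

text \<open>The tangent space of the boundary at a boundary point \<open>p\<close>: the chart \<open>chart_at A p\<close> maps the
  boundary into the hyperplane bounding the half-space.\<close>

definition tangent_bdry :: "('a, 'n::finite) chart set \<Rightarrow> 'a \<Rightarrow> (real^'n) set" where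
  "tangent_bdry A p = {v. v $ bidx = 0}"

definition vector_fields_bdry ::
  "('a::topological_space, 'n::finite) chart set \<Rightarrow> 'a set \<Rightarrow> ('a \<Rightarrow> real^'n) set" where
  "vector_fields_bdry A U = {\<xi> \<in> vector_fields A U. \<forall>p \<in> U \<inter> bdry A. \<xi> p \<in> tangent_bdry A p}"

definition smooth_sym_tensor ::
  "('a::topological_space, 'n::finite) chart set \<Rightarrow> 'a set \<Rightarrow> ('a \<Rightarrow> real^'n \<Rightarrow> real^'n \<Rightarrow> real) \<Rightarrow> bool" where
  "smooth_sym_tensor A U h \<longleftrightarrow>
     (\<forall>p\<in>U. bilinear (h p) \<and> (\<forall>v w. h p v w = h p w v)) \<and>
     (\<forall>V \<xi> \<eta>. open V \<and> V \<subseteq> U \<and> \<xi> \<in> vector_fields A V \<and> \<eta> \<in> vector_fields A V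
        \<longrightarrow> smooth_fun A V (\<lambda>p. h p (\<xi> p) (\<eta> p)))"

definition nondegenerate_on :: "'v::real_vector set \<Rightarrow> ('v \<Rightarrow> 'v \<Rightarrow> real) \<Rightarrow> bool" where
  "nondegenerate_on T b \<longleftrightarrow> (\<forall>v\<in>T. (\<forall>w\<in>T. b v w = 0) \<longrightarrow> v = 0)"

definition pseudo_riemannian_metric ::
  "('a::topological_space, 'n::finite) chart set \<Rightarrow> 'a set \<Rightarrow> ('a \<Rightarrow> real^'n \<Rightarrow> real^'n \<Rightarrow> real) \<Rightarrow> bool" where
  "pseudo_riemannian_metric A M g \<longleftrightarrow> smooth_sym_tensor A M g \<and> (\<forall>p\<in>M. nondegenerate_on UNIV (g p))"

definition smooth_fun_extends ::
  "('a::topological_space, 'n::finite) chart set \<Rightarrow> 'a set \<Rightarrow> ('a \<Rightarrow> real) \<Rightarrow> bool" where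
  "smooth_fun_extends A U f \<longleftrightarrow> (\<exists>F. smooth_fun A U F \<and> (\<forall>p\<in>U - bdry A. F p = f p))"

definition vector_field_extends ::
  "('a::topological_space, 'n::finite) chart set \<Rightarrow> 'a set \<Rightarrow> ('a \<Rightarrow> real^'n) \<Rightarrow> bool" where
  "vector_field_extends A U \<xi> \<longleftrightarrow> (\<exists>\<zeta>\<in>vector_fields A U. \<forall>p\<in>U - bdry A. \<zeta> p = \<xi> p)"

definition local_defining_function ::
  "('a::topological_space, 'n::finite) chart set \<Rightarrow> 'a set \<Rightarrow> ('a \<Rightarrow> real) \<Rightarrow> bool" where
  "local_defining_function A U \<rho> \<longleftrightarrow> open U \<and> smooth_fun A U \<rho> \<and>
     {p \<in> U. \<rho> p = 0} = U \<inter> bdry A \<and> (\<forall>p \<in> U \<inter> bdry A. \<exists>v. dd A \<rho> p v \<noteq> 0)"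

text \<open>\<open>f = O(\<rho>^k)\<close> in the sense of divisibility by \<open>\<rho>^k\<close> among smooth functions on \<open>U\<close>.\<close>

definition bigO_pow ::
  "('a, 'n::finite) chart set \<Rightarrow> 'a set \<Rightarrow> ('a \<Rightarrow> real) \<Rightarrow> nat \<Rightarrow> ('a \<Rightarrow> real) \<Rightarrow> bool" where
  "bigO_pow A U \<rho> k f \<longleftrightarrow> (\<exists>f1. smooth_fun A U f1 \<and> (\<forall>p\<in>U. f p = \<rho> p ^ k * f1 p))"

section \<open>Linear connections\<close>

type_synonym ('a, 'n) connection = "('a \<Rightarrow> real^'n) \<Rightarrow> ('a \<Rightarrow> real^'n) \<Rightarrow> 'a \<Rightarrow> real^'n"

text \<open>A connection on the tangent bundle of the open set \<open>M\<close> acts on vector fields over every open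
  subset \<open>V\<close> of \<open>M\<close>, compatibly with restrictions. It is unconstrained on functions that are not
  smooth vector fields on \<open>V\<close>.\<close>

definition linear_connection ::
  "('a::topological_space, 'n::finite) chart set \<Rightarrow> 'a set \<Rightarrow> ('a, 'n) connection \<Rightarrow> bool" where
  "linear_connection A M D \<longleftrightarrow> (\<forall>V. open V \<and> V \<subseteq> M \<longrightarrow>
     (\<forall>\<xi>\<in>vector_fields A V. \<forall>\<eta>\<in>vector_fields A V. D \<xi> \<eta> \<in> vector_fields A V) \<and>
     (\<forall>\<xi>\<in>vector_fields A V. \<forall>\<xi>'\<in>vector_fields A V.
      \<forall>\<eta>\<in>vector_fields A V. \<forall>\<eta>'\<in>vector_fields A V.
        (\<forall>p\<in>V. \<xi> p = \<xi>' p \<and> \<eta> p = \<eta>' p) \<longrightarrow> (\<forall>p\<in>V. D \<xi> \<eta> p = D \<xi>' \<eta>' p)) \<and>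
     (\<forall>\<xi>\<in>vector_fields A V. \<forall>\<xi>'\<in>vector_fields A V. \<forall>\<eta>\<in>vector_fields A V. \<forall>p\<in>V.
        D (\<lambda>q. \<xi> q + \<xi>' q) \<eta> p = D \<xi> \<eta> p + D \<xi>' \<eta> p) \<and>
     (\<forall>\<xi>\<in>vector_fields A V. \<forall>\<eta>\<in>vector_fields A V. \<forall>\<eta>'\<in>vector_fields A V. \<forall>p\<in>V.
        D \<xi> (\<lambda>q. \<eta> q + \<eta>' q) p = D \<xi> \<eta> p + D \<xi> \<eta>' p) \<and>
     (\<forall>f. smooth_fun A V f \<longrightarrow>
       (\<forall>\<xi>\<in>vector_fields A V. \<forall>\<eta>\<in>vector_fields A V. \<forall>p\<in>V.
          D (\<lambda>q. f q *\<^sub>R \<xi> q) \<eta> p = f p *\<^sub>R D \<xi> \<eta> p \<and>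
          D \<xi> (\<lambda>q. f q *\<^sub>R \<eta> q) p = f p *\<^sub>R D \<xi> \<eta> p + dd A f p (\<xi> p) *\<^sub>R \<eta> p)))"

text \<open>The Lie bracket \<open>[\<xi>, \<eta>]\<close> is the vector field acting on smooth functions \<open>f\<close> by
  \<open>\<xi>(\<eta> f) - \<eta>(\<xi> f)\<close>; vanishing torsion says that \<open>D \<xi> \<eta> - D \<eta> \<xi>\<close> acts in this way.\<close>

definition torsion_free ::
  "('a::topological_space, 'n::finite) chart set \<Rightarrow> 'a set \<Rightarrow> ('a, 'n) connection \<Rightarrow> bool" where
  "torsion_free A M D \<longleftrightarrow> (\<forall>V. open V \<and> V \<subseteq> M \<longrightarrow>
     (\<forall>\<xi>\<in>vector_fields A V. \<forall>\<eta>\<in>vector_fields A V.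
      \<forall>f::'a \<Rightarrow> real. smooth_fun A V f \<longrightarrow> (\<forall>p\<in>V.
        dd A f p (D \<xi> \<eta> p - D \<eta> \<xi> p) =
        dd A (\<lambda>q. dd A f q (\<eta> q)) p (\<xi> p) - dd A (\<lambda>q. dd A f q (\<xi> q)) p (\<eta> p))))"

definition levi_civita ::
  "('a::topological_space, 'n::finite) chart set \<Rightarrow> 'a set \<Rightarrow>
   ('a \<Rightarrow> real^'n \<Rightarrow> real^'n \<Rightarrow> real) \<Rightarrow> ('a, 'n) connection \<Rightarrow> bool" where
  "levi_civita A M g D \<longleftrightarrow> linear_connection A M D \<and> torsion_free A M D \<and>
     (\<forall>V. open V \<and> V \<subseteq> M \<longrightarrow>
       (\<forall>\<xi>\<in>vector_fields A V. \<forall>\<eta>\<in>vector_fields A V. \<forall>\<zeta>\<in>vector_fields A V. \<forall>p\<in>V.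
          dd A (\<lambda>q. g q (\<eta> q) (\<zeta> q)) p (\<xi> p) = g p (D \<xi> \<eta> p) (\<zeta> p) + g p (\<eta> p) (D \<xi> \<zeta> p)))"

text \<open>Volume densities are functions of frames with \<open>\<mu>(a v) = \<bar>det a\<bar> \<mu>(v)\<close>. A family of
  \<open>CARD('n)\<close> vectors spanning \<open>real^'n\<close> is a basis.\<close>

definition is_frame :: "('n::finite \<Rightarrow> real^'n) \<Rightarrow> bool" where
  "is_frame v \<longleftrightarrow> span (range v) = UNIV"

definition frame_fields ::
  "('a::topological_space, 'n::finite) chart set \<Rightarrow> 'a set \<Rightarrow> ('n \<Rightarrow> 'a \<Rightarrow> real^'n) set" where
  "frame_fields A V = {X. (\<forall>i. X i \<in> vector_fields A V) \<and> (\<forall>p\<in>V. is_frame (\<lambda>i. X i p))}"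

definition volume_density ::
  "('a::topological_space, 'n::finite) chart set \<Rightarrow> 'a set \<Rightarrow> ('a \<Rightarrow> ('n \<Rightarrow> real^'n) \<Rightarrow> real) \<Rightarrow> bool" where
  "volume_density A M \<mu> \<longleftrightarrow>
     (\<forall>p\<in>M. \<forall>v (a::real^'n^'n). \<mu> p (\<lambda>i. \<Sum>j\<in>UNIV. a $ i $ j *\<^sub>R v j) = \<bar>det a\<bar> * \<mu> p v) \<and>
     (\<forall>p\<in>M. \<forall>v. is_frame v \<longrightarrow> \<mu> p v \<noteq> 0) \<and>
     (\<forall>V X. open V \<and> V \<subseteq> M \<and> X \<in> frame_fields A V \<longrightarrow> smooth_fun A V (\<lambda>p. \<mu> p (\<lambda>i. X i p)))"

text \<open>\<open>\<mu>\<close> is parallel: if \<open>D \<xi> (X i) = (\<Sum>j. a i j X j)\<close> for a local frame \<open>X\<close>, then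
  \<open>(D \<xi> \<mu>)(X) = \<xi>(\<mu>(X)) - trace a * \<mu>(X)\<close> vanishes.\<close>

definition preserves_density ::
  "('a::topological_space, 'n::finite) chart set \<Rightarrow> 'a set \<Rightarrow>
   ('a, 'n) connection \<Rightarrow> ('a \<Rightarrow> ('n \<Rightarrow> real^'n) \<Rightarrow> real) \<Rightarrow> bool" where
  "preserves_density A M D \<mu> \<longleftrightarrow>
     (\<forall>V X \<xi>. open V \<and> V \<subseteq> M \<and> X \<in> frame_fields A V \<and> \<xi> \<in> vector_fields A V \<longrightarrow>
       (\<forall>p\<in>V. \<forall>a::real^'n^'n. (\<forall>i. D \<xi> (X i) p = (\<Sum>j\<in>UNIV. a $ i $ j *\<^sub>R X j p)) \<longrightarrow>
          dd A (\<lambda>q. \<mu> q (\<lambda>i. X i q)) p (\<xi> p) = trace a * \<mu> p (\<lambda>i. X i p)))"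

definition special_connection ::
  "('a::topological_space, 'n::finite) chart set \<Rightarrow> 'a set \<Rightarrow> ('a, 'n) connection \<Rightarrow> bool" where
  "special_connection A M D \<longleftrightarrow> linear_connection A M D \<and> torsion_free A M D \<and>
     (\<exists>\<mu>. volume_density A M \<mu> \<and> preserves_density A M D \<mu>)"

section \<open>Projective compactness of order one\<close>

text \<open>Below, \<open>D\<close> is a connection on the interior \<open>- bdry A\<close>.\<close>

definition nabla_rho ::
  "('a, 'n::finite) chart set \<Rightarrow> ('a, 'n) connection \<Rightarrow> ('a \<Rightarrow> real) \<Rightarrow> ('a, 'n) connection" where
  "nabla_rho A D \<rho> \<xi> \<eta> p =
     D \<xi> \<eta> p + (dd A \<rho> p (\<xi> p) / \<rho> p) *\<^sub>R \<eta> p + (dd A \<rho> p (\<eta> p) / \<rho> p) *\<^sub>R \<xi> p"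

definition projectively_precompact ::
  "('a::topological_space, 'n::finite) chart set \<Rightarrow> ('a, 'n) connection \<Rightarrow> bool" where
  "projectively_precompact A D \<longleftrightarrow> special_connection A (- bdry A) D \<and>
     (\<forall>U \<rho>. local_defining_function A U \<rho> \<longrightarrow>
       (\<forall>\<xi>\<in>vector_fields A U. \<forall>\<eta>\<in>vector_fields A U.
          smooth_fun_extends A U (\<lambda>p. dd A \<rho> p (nabla_rho A D \<rho> \<xi> \<eta> p)) \<and>
          vector_field_extends A U (\<lambda>p. \<rho> p *\<^sub>R nabla_rho A D \<rho> \<xi> \<eta> p) \<and>
          (\<xi> \<in> vector_fields_bdry A U \<or> \<eta> \<in> vector_fields_bdry A U \<longrightarrow>
             vector_field_extends A U (nabla_rho A D \<rho> \<xi> \<eta>))))"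

definition projectively_compact ::
  "('a::topological_space, 'n::finite) chart set \<Rightarrow> ('a, 'n) connection \<Rightarrow> bool" where
  "projectively_compact A D \<longleftrightarrow> special_connection A (- bdry A) D \<and>
     (\<forall>U \<rho>. local_defining_function A U \<rho> \<longrightarrow>
       (\<forall>\<xi>\<in>vector_fields A U. \<forall>\<eta>\<in>vector_fields A U.
          vector_field_extends A U (nabla_rho A D \<rho> \<xi> \<eta>)))"

text \<open>The smooth extension \<open>F\<close> is unique because the interior is dense.\<close>

definition totally_geodesic_bdry ::
  "('a::topological_space, 'n::finite) chart set \<Rightarrow> ('a, 'n) connection \<Rightarrow> bool" where
  "totally_geodesic_bdry A D \<longleftrightarrow>
     (\<forall>U \<rho>. local_defining_function A U \<rho> \<longrightarrow>
       (\<forall>\<xi>\<in>vector_fields_bdry A U. \<forall>\<eta>\<in>vector_fields_bdry A U.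
          \<exists>F. smooth_fun A U F \<and>
              (\<forall>p\<in>U - bdry A. F p = dd A \<rho> p (nabla_rho A D \<rho> \<xi> \<eta> p)) \<and>
              (\<forall>p\<in>U \<inter> bdry A. F p = 0)))"

section \<open>The asymptotic form of the metric\<close>

definition asymptotic_form ::
  "('a::topological_space, 'n::finite) chart set \<Rightarrow> ('a \<Rightarrow> real^'n \<Rightarrow> real^'n \<Rightarrow> real) \<Rightarrow>
   'a set \<Rightarrow> ('a \<Rightarrow> real) \<Rightarrow> ('a \<Rightarrow> real) \<Rightarrow> bool" where
  "asymptotic_form A g U \<rho> C \<longleftrightarrow>
     local_defining_function A U \<rho> \<and> smooth_fun A U C \<and> (\<forall>p\<in>U. C p \<noteq> 0) \<and>
     (\<exists>h. smooth_sym_tensor A U h \<and>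
        (\<forall>p\<in>U - bdry A. \<forall>v w.
           h p v w = \<rho> p ^ 2 * (g p v w - C p / \<rho> p ^ 4 * (dd A \<rho> p v * dd A \<rho> p w))) \<and>
        (\<forall>p\<in>U \<inter> bdry A. nondegenerate_on (tangent_bdry A p) (h p)))"

definition tangential_decay ::
  "('a::topological_space, 'n::finite) chart set \<Rightarrow> 'a set \<Rightarrow> ('a \<Rightarrow> real) \<Rightarrow> ('a \<Rightarrow> real) \<Rightarrow> nat \<Rightarrow> bool" where
  "tangential_decay A U \<rho> C k \<longleftrightarrow>
     (\<forall>\<zeta>\<in>vector_fields A U. (\<forall>p\<in>U. dd A \<rho> p (\<zeta> p) = 0) \<longrightarrow>
        bigO_pow A U \<rho> k (\<lambda>p. dd A C p (\<zeta> p)))"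

end

theory Submission
  imports Defs
begin

text \<open>Write \<open>r\<close> for \<open>d\<rho>\<close> and, in coordinates near a boundary point,
  \<open>N(u, v) = \<Gamma>(u, v) + (r(u) v + r(v) u) / \<rho>\<close> for the Christoffel symbols of \<open>g\<close> with the correction
  terms of \<open>\<nabla>\<^sup>\<rho>\<close>. The metric has the form \<open>\<rho>\<^sup>4 g = \<rho>\<^sup>2 h + C r r\<close>. When this is inserted into the
  Koszul formula, the correction terms cancel everything singular, and what remains is the
  identity \<open>\<rho>\<^sup>2 h(N, w) + C r(N) r(w) = R(u, v, w)\<close> with \<open>R\<close> smooth up to the boundary
  (\<open>asymptotic_identity\<close>).

  Let \<open>e\<close> be transversal to the boundary. Testing the identity against \<open>e\<close> controls \<open>r(N)\<close>. For
  \<open>w\<close> in the kernel of \<open>r\<close> only \<open>\<rho>\<^sup>2 h(N, w)\<close> is left of the left-hand side, while the right-hand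
  side is a smooth multiple of \<open>\<rho>\<^sup>2\<close> minus \<open>dC(w) r(u) r(v) / 2\<close>. After division by \<open>\<rho>\<^sup>2\<close> the two
  tests form a linear system for \<open>N\<close> whose matrix is invertible at the boundary, because \<open>h\<close> is
  non-degenerate on the kernel of \<open>r\<close>, which is the tangent space of the boundary (\<open>det_Q\<close>). By
  Cramer's rule \<open>N\<close> is as smooth as \<open>dC(w) r(u) r(v) / \<rho>\<^sup>2\<close> (\<open>scaled_extension\<close>). If
  \<open>dC(w) = O(\<rho>\<^sup>2)\<close>, this is smooth, so \<open>g\<close> is projectively compact. If \<open>dC(w) = O(\<rho>)\<close>, then
  \<open>\<rho> N\<close> is smooth, and so is \<open>N\<close> itself when \<open>u\<close> or \<open>v\<close> is tangential, since then
  \<open>r(u) r(v)\<close> supplies the missing factor \<open>\<rho>\<close>. Smoothness of \<open>\<rho> N\<close> already makes \<open>r(N)\<close> smooth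
  by the test against \<open>e\<close>. For tangential \<open>u\<close> and \<open>v\<close> the boundary value of \<open>r(N)\<close> is the second
  derivative of \<open>\<rho>\<close>, so \<open>d\<rho>(\<nabla>\<^sup>\<rho>\<^bsub>\<xi>\<^esub>\<eta>)\<close> restricts to the derivative of \<open>d\<rho>(\<eta>)\<close> along \<open>\<xi>\<close>, which is
  zero: the boundary is totally geodesic.

  Three ingredients connect this computation with the manifold. Any other defining function is
  a non-vanishing smooth multiple of the given one, by Hadamard's lemma, and changing \<open>\<rho>\<close> in this
  way changes \<open>\<nabla>\<^sup>\<rho>\<close> by smooth terms only. The decay of \<open>C\<close> is a statement about vector fields on
  the whole domain of \<open>\<rho>\<close>, so coordinate fields are first cut off by bump functions. Extensions
  to the boundary are unique because the interior is dense, hence local extensions can be glued.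

  The Levi-Civita connection is given by Christoffel symbols in each chart. Two torsion-free
  metric connections differ by a tensor that is symmetric in one pair of arguments and skew in
  another, hence zero, so the chart connections agree on overlaps (\<open>conn_independent\<close>). It is special
  because the Riemannian density is parallel.\<close>

section \<open>Smooth functions on open sets\<close>

abbreviation fd :: "('x::real_normed_vector \<Rightarrow> 'b::real_normed_vector) \<Rightarrow> 'x \<Rightarrow> 'x \<Rightarrow> 'b" where
  "fd f x \<equiv> frechet_derivative f (at x)"

lemma fd_eq: "(f has_derivative D) (at x) \<Longrightarrow> fd f x = D"
  using frechet_derivative_at by metis

lemma Ck_on_continuous: "Ck_on k S f \<Longrightarrow> continuous_on S f"
  by (cases k) (auto intro!: continuous_at_imp_continuous_on differentiable_imp_continuous_within)

lemma Ck_on_subset: "Ck_on k S f \<Longrightarrow> T \<subseteq> S \<Longrightarrow> Ck_on k T f"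
  by (induction k arbitrary: f) (auto intro: continuous_on_subset)

lemma Ck_on_SucD: "Ck_on (Suc k) S f \<Longrightarrow> Ck_on k S f"
proof (induction k arbitrary: f)
  case 0
  then show ?case using Ck_on_continuous by fastforce
next
  case (Suc k)
  have "Ck_on k S (\<lambda>x. fd f x v)" for v
    by (rule Suc.IH) (use Suc.prems in \<open>simp only: Ck_on.simps(2)[of "Suc k"]\<close>)
  with Suc.prems show ?case
    by (simp only: Ck_on.simps(2)[of "Suc k"] Ck_on.simps(2)[of k]) simp
qed

lemma Ck_on_cong:
  assumes "open S" "\<And>x. x \<in> S \<Longrightarrow> f x = g x" "Ck_on k S f"
  shows "Ck_on k S g"
  using assms(2,3)
proof (induction k arbitrary: f g)
  case 0
  then show ?case using continuous_on_cong by fastforce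
next
  case (Suc k)
  have *: "(g has_derivative fd f x) (at x)" if "x \<in> S" for x
    using Suc.prems \<open>open S\<close> that
    by (metis Ck_on.simps(2) frechet_derivative_works has_derivative_transform_within_open)
  then have "fd g x = fd f x" if "x \<in> S" for x using fd_eq that by blast
  moreover have "Ck_on k S (\<lambda>x. fd g x v)" for v
    by (rule Suc.IH[of "\<lambda>x. fd f x v"]) (use Suc.prems calculation in auto)
  ultimately show ?case using * by (auto simp: differentiable_def)
qed

lemma Ck_on_SucI:
  assumes "open S" "\<And>x. x \<in> S \<Longrightarrow> (f has_derivative f' x) (at x)" "\<And>v. Ck_on k S (\<lambda>x. f' x v)"
  shows "Ck_on (Suc k) S f"
  unfolding Ck_on.simps
proof (intro conjI ballI allI)
  show "f differentiable at x" if "x \<in> S" for x using assms(2) that differentiable_def by blast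
  show "Ck_on k S (\<lambda>x. fd f x v)" for v
    by (rule Ck_on_cong[OF assms(1) _ assms(3)[of v]]) (simp add: fd_eq[OF assms(2)])
qed

lemma Ck_on_SucE:
  assumes "Ck_on (Suc k) S f"
  shows "\<And>x. x \<in> S \<Longrightarrow> (f has_derivative fd f x) (at x)" "\<And>v. Ck_on k S (\<lambda>x. fd f x v)"
  using assms frechet_derivative_works by auto

lemma Ck_on_local:
  assumes "\<And>x. x \<in> S \<Longrightarrow> \<exists>T. open T \<and> x \<in> T \<and> Ck_on k T f"
  shows "Ck_on k S f"
  using assms
proof (induction k arbitrary: f)
  case 0
  then show ?case by (metis Ck_on.simps(1) continuous_at_imp_continuous_on continuous_on_eq_continuous_at)
next
  case (Suc k)
  have "f differentiable at x" if "x \<in> S" for x using Suc.prems[OF that] by auto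
  moreover have "Ck_on k S (\<lambda>x. fd f x v)" for v
    by (rule Suc.IH) (use Suc.prems in fastforce)
  ultimately show ?case by simp
qed

lemma Ck_on_const: "open S \<Longrightarrow> Ck_on k S (\<lambda>x. c)"
  by (induction k arbitrary: c) (auto intro!: Ck_on_SucI[where f'="\<lambda>_ _. 0"])

lemma Ck_on_add:
  "open S \<Longrightarrow> Ck_on k S f \<Longrightarrow> Ck_on k S g \<Longrightarrow> Ck_on k S (\<lambda>x. f x + g x)"
proof (induction k arbitrary: f g)
  case 0
  then show ?case by (simp add: continuous_on_add)
next
  case (Suc k)
  show ?case
    by (rule Ck_on_SucI[OF Suc.prems(1) has_derivative_add[OF Ck_on_SucE(1)[OF Suc.prems(2)] Ck_on_SucE(1)[OF Suc.prems(3)]]])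
      (auto intro!: Suc.IH Ck_on_SucE[OF Suc.prems(2)] Ck_on_SucE[OF Suc.prems(3)] simp: Suc.prems(1) simp del: Ck_on.simps)
qed

lemma Ck_on_bounded_bilinear:
  assumes "bounded_bilinear b" "open S"
  shows "Ck_on k S f \<Longrightarrow> Ck_on k S g \<Longrightarrow> Ck_on k S (\<lambda>x. b (f x) (g x))"
proof (induction k arbitrary: f g)
  case 0
  then show ?case using assms(1) by (simp add: bounded_bilinear.continuous_on)
next
  case (Suc k)
  show ?case
    by (rule Ck_on_SucI[OF assms(2) bounded_bilinear.FDERIV[OF assms(1) Ck_on_SucE(1)[OF Suc.prems(1)] Ck_on_SucE(1)[OF Suc.prems(2)]]])
      (auto intro!: Suc.IH Ck_on_add Ck_on_SucE[OF Suc.prems(1)] Ck_on_SucE[OF Suc.prems(2)]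
          Ck_on_SucD[OF Suc.prems(1)] Ck_on_SucD[OF Suc.prems(2)] simp: assms(2) simp del: Ck_on.simps)
qed

lemma Ck_on_bounded_linear:
  assumes "bounded_linear L" "open S" "Ck_on k S f"
  shows "Ck_on k S (\<lambda>x. L (f x))"
  using assms(3)
proof (induction k arbitrary: f)
  case 0
  then show ?case using assms(1) by (simp add: bounded_linear.continuous_on)
next
  case (Suc k)
  show ?case
    by (rule Ck_on_SucI[OF assms(2) bounded_linear.has_derivative[OF assms(1) Ck_on_SucE(1)[OF Suc.prems]]])
      (auto intro!: Suc.IH Ck_on_SucE[OF Suc.prems] simp: assms(2) simp del: Ck_on.simps)
qed

lemma Ck_on_ident: "open S \<Longrightarrow> Ck_on k S (\<lambda>x. x)"
  by (cases k) (auto intro!: Ck_on_SucI[where f'="\<lambda>_ v. v"] Ck_on_const has_derivative_ident simp del: Ck_on.simps simp: Ck_on.simps(1))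

lemma Ck_on_sum:
  "finite I \<Longrightarrow> open S \<Longrightarrow> (\<And>i. i \<in> I \<Longrightarrow> Ck_on k S (f i)) \<Longrightarrow> Ck_on k S (\<lambda>x. \<Sum>i\<in>I. f i x)"
  by (induction I rule: finite_induct) (auto intro!: Ck_on_const Ck_on_add simp del: Ck_on.simps)

lemma linear_Basis_expansion:
  fixes L :: "'y::euclidean_space \<Rightarrow> 'b::real_normed_vector"
  assumes "linear L"
  shows "L v = (\<Sum>b\<in>Basis. (v \<bullet> b) *\<^sub>R L b)"
proof -
  have "L v = L (\<Sum>b\<in>Basis. (v \<bullet> b) *\<^sub>R b)" by (simp add: euclidean_representation)
  also have "\<dots> = (\<Sum>b\<in>Basis. (v \<bullet> b) *\<^sub>R L b)"
    by (simp add: linear_sum[OF assms] linear_scale[OF assms])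
  finally show ?thesis .
qed

lemma fd_expansion:
  fixes f :: "'y::euclidean_space \<Rightarrow> 'b::real_normed_vector"
  assumes "(f has_derivative fd f x) (at x)"
  shows "fd f x v = (\<Sum>b\<in>Basis. (v \<bullet> b) *\<^sub>R fd f x b)"
  using assms has_derivative_bounded_linear bounded_linear.linear linear_Basis_expansion by blast

lemma Ck_on_compose:
  fixes f :: "'y::euclidean_space \<Rightarrow> 'b::real_normed_vector"
  assumes "open S" "open T" "g ` S \<subseteq> T"
  shows "Ck_on k T f \<Longrightarrow> Ck_on k S g \<Longrightarrow> Ck_on k S (\<lambda>x. f (g x))"
proof (induction k arbitrary: f)
  case 0
  then show ?case using assms(3) by (auto intro: continuous_on_compose2)
next
  case (Suc k)
  note f = Ck_on_SucE[OF Suc.prems(1)] and g = Ck_on_SucE[OF Suc.prems(2)]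
  show ?case
  proof (rule Ck_on_SucI[OF assms(1)])
    fix x assume "x \<in> S"
    then have "((\<lambda>x. f (g x)) has_derivative (\<lambda>v. fd f (g x) (fd g x v))) (at x)"
      using has_derivative_compose[OF g(1) f(1)] assms(3) by auto
    moreover have "fd f (g x) (fd g x v) = (\<Sum>b\<in>Basis. (fd g x v \<bullet> b) *\<^sub>R fd f (g x) b)" for v
      by (rule fd_expansion[OF f(1)]) (use \<open>x \<in> S\<close> assms(3) in auto)
    ultimately show "((\<lambda>x. f (g x)) has_derivative (\<lambda>v. \<Sum>b\<in>Basis. (fd g x v \<bullet> b) *\<^sub>R fd f (g x) b)) (at x)"
      by simp
  next
    fix v
    show "Ck_on k S (\<lambda>x. \<Sum>b\<in>Basis. (fd g x v \<bullet> b) *\<^sub>R fd f (g x) b)"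
      by (intro Ck_on_sum Ck_on_bounded_bilinear[OF bounded_bilinear_scaleR] assms(1) finite_Basis
          Ck_on_bounded_linear[OF bounded_linear_inner_left] g(2) Suc.IH f(2) Ck_on_SucD[OF Suc.prems(2)])
  qed
qed

lemma Ck_on_inverse: "Ck_on k (- {0::real}) inverse"
proof (induction k)
  case 0
  then show ?case by (auto intro!: continuous_intros)
next
  case (Suc k)
  show ?case
    by (rule Ck_on_SucI[OF _ has_derivative_inverse'])
      (auto intro!: Ck_on_bounded_linear[OF bounded_linear_minus[OF bounded_linear_ident]]
         Ck_on_bounded_bilinear[OF bounded_bilinear_mult] Suc Ck_on_const simp del: Ck_on.simps)
qed

lemma Ck_on_sqrt: "Ck_on k {0<..} sqrt"
proof (induction k)
  case 0
  then show ?case by (auto intro!: continuous_intros)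
next
  case (Suc k)
  have inv: "Ck_on k {0<..} (\<lambda>x. inverse (sqrt x))"
    by (rule Ck_on_compose[OF _ _ _ Ck_on_inverse Suc]) auto
  show ?case
  proof (rule Ck_on_SucI)
    show "(sqrt has_derivative (\<lambda>v. v * (inverse (sqrt x) * inverse 2))) (at x)" if "x \<in> {0<..}" for x
      using DERIV_real_sqrt[of x] that unfolding has_field_derivative_def
      by (rule_tac has_derivative_eq_rhs) (auto simp: fun_eq_iff field_simps)
    show "Ck_on k {0<..} (\<lambda>x. v * (inverse (sqrt x) * inverse 2))" for v
      by (intro Ck_on_bounded_bilinear[OF bounded_bilinear_mult] Ck_on_const open_greaterThan inv)
  qed simp
qed

text \<open>Openness of the domain is part of the notion: \<open>Ck_on\<close> is insensitive to changes of the function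
  outside the domain only if the domain is open.\<close>

definition Cinf_on :: "'x::real_normed_vector set \<Rightarrow> ('x \<Rightarrow> 'b::real_normed_vector) \<Rightarrow> bool" where
  "Cinf_on S f \<longleftrightarrow> open S \<and> (\<forall>k. Ck_on k S f)"

lemma Cinf_on_open: "Cinf_on S f \<Longrightarrow> open S"
  by (simp add: Cinf_on_def)

lemma Cinf_on_continuous: "Cinf_on S f \<Longrightarrow> continuous_on S f"
  by (auto simp: Cinf_on_def intro: Ck_on_continuous)

lemma Cinf_on_subset: "Cinf_on S f \<Longrightarrow> open T \<Longrightarrow> T \<subseteq> S \<Longrightarrow> Cinf_on T f"
  by (auto simp: Cinf_on_def intro: Ck_on_subset)

lemma Cinf_on_cong: "Cinf_on S f \<Longrightarrow> (\<And>x. x \<in> S \<Longrightarrow> f x = g x) \<Longrightarrow> Cinf_on S g"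
  by (auto simp: Cinf_on_def intro: Ck_on_cong)

lemma Cinf_on_local:
  assumes "\<And>x. x \<in> S \<Longrightarrow> \<exists>T. x \<in> T \<and> T \<subseteq> S \<and> Cinf_on T f"
  shows "Cinf_on S f"
proof -
  have "open S" using assms by (subst open_subopen) (meson Cinf_on_open)
  moreover have "Ck_on k S f" for k
    by (rule Ck_on_local) (meson assms Cinf_on_def)
  ultimately show ?thesis by (simp add: Cinf_on_def)
qed

lemma Cinf_on_has_derivative: "Cinf_on S f \<Longrightarrow> x \<in> S \<Longrightarrow> (f has_derivative fd f x) (at x)"
  by (rule Ck_on_SucE(1)) (auto simp: Cinf_on_def simp del: Ck_on.simps)

lemma Cinf_on_fd_const: "Cinf_on S f \<Longrightarrow> Cinf_on S (\<lambda>x. fd f x v)"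
  unfolding Cinf_on_def using Ck_on_SucE(2) by blast

lemma fd_linear: "Cinf_on S f \<Longrightarrow> x \<in> S \<Longrightarrow> linear (fd f x)"
  by (meson Cinf_on_has_derivative has_derivative_linear)

lemma Cinf_on_const: "open S \<Longrightarrow> Cinf_on S (\<lambda>x. c)"
  and Cinf_on_ident: "open S \<Longrightarrow> Cinf_on S (\<lambda>x. x)"
  and Cinf_on_add: "Cinf_on S f \<Longrightarrow> Cinf_on S g \<Longrightarrow> Cinf_on S (\<lambda>x. f x + g x)"
  and Cinf_on_bounded_bilinear: "bounded_bilinear b \<Longrightarrow> Cinf_on S f1 \<Longrightarrow> Cinf_on S g1 \<Longrightarrow> Cinf_on S (\<lambda>x. b (f1 x) (g1 x))"
  and Cinf_on_bounded_linear: "bounded_linear L \<Longrightarrow> Cinf_on S f \<Longrightarrow> Cinf_on S (\<lambda>x. L (f x))"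
  and Cinf_on_sum: "finite I \<Longrightarrow> open S \<Longrightarrow> (\<And>i. i \<in> I \<Longrightarrow> Cinf_on S (F i)) \<Longrightarrow> Cinf_on S (\<lambda>x. \<Sum>i\<in>I. F i x)"
  unfolding Cinf_on_def
  by (blast intro: Ck_on_const Ck_on_ident Ck_on_add Ck_on_bounded_bilinear Ck_on_bounded_linear Ck_on_sum)+

lemma Cinf_on_compose:
  fixes f :: "'y::euclidean_space \<Rightarrow> 'b::real_normed_vector"
  assumes "Cinf_on T f" "Cinf_on S g" "\<And>x. x \<in> S \<Longrightarrow> g x \<in> T"
  shows "Cinf_on S (\<lambda>x. f (g x))"
  using assms Ck_on_compose[of S T g _ f] unfolding Cinf_on_def by blast

lemma Cinf_on_minus: "Cinf_on S f \<Longrightarrow> Cinf_on S (\<lambda>x. - f x)"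
  by (rule Cinf_on_bounded_linear[OF bounded_linear_minus[OF bounded_linear_ident]])

lemma Cinf_on_diff: "Cinf_on S f \<Longrightarrow> Cinf_on S g \<Longrightarrow> Cinf_on S (\<lambda>x. f x - g x)"
  using Cinf_on_add[OF _ Cinf_on_minus, of S f g] by simp

lemmas Cinf_on_mult = Cinf_on_bounded_bilinear[OF bounded_bilinear_mult]
lemmas Cinf_on_scaleR = Cinf_on_bounded_bilinear[OF bounded_bilinear_scaleR]
lemmas Cinf_on_inner = Cinf_on_bounded_bilinear[OF bounded_bilinear_inner]

lemma Cinf_on_power: "Cinf_on S f \<Longrightarrow> Cinf_on S (\<lambda>x. f x ^ n :: real)"
  by (induction n) (auto intro: Cinf_on_mult Cinf_on_const simp: Cinf_on_open)

lemma Cinf_on_prod: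
  "finite I \<Longrightarrow> open S \<Longrightarrow> (\<And>i. i \<in> I \<Longrightarrow> Cinf_on S (f i)) \<Longrightarrow> Cinf_on S (\<lambda>x. \<Prod>i\<in>I. f i x :: real)"
  by (induction I rule: finite_induct) (auto intro!: Cinf_on_const Cinf_on_mult)

lemma Cinf_on_inverse:
  assumes "Cinf_on S f" "\<And>x. x \<in> S \<Longrightarrow> f x \<noteq> 0"
  shows "Cinf_on S (\<lambda>x. inverse (f x :: real))"
proof (rule Cinf_on_compose[where T = "- {0}", OF _ assms(1)])
  show "Cinf_on (- {0::real}) inverse"
    by (auto simp: Cinf_on_def Ck_on_inverse simp del: Ck_on.simps)
qed (use assms(2) in auto)

lemma Cinf_on_divide:
  "Cinf_on S f \<Longrightarrow> Cinf_on S g \<Longrightarrow> (\<And>x. x \<in> S \<Longrightarrow> g x \<noteq> 0) \<Longrightarrow> Cinf_on S (\<lambda>x. f x / g x :: real)"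
  unfolding divide_inverse by (intro Cinf_on_mult Cinf_on_inverse)

lemma Cinf_on_sqrt:
  assumes "Cinf_on S f" "\<And>x. x \<in> S \<Longrightarrow> f x > 0"
  shows "Cinf_on S (\<lambda>x. sqrt (f x))"
proof (rule Cinf_on_compose[where T = "{0<..}", OF _ assms(1)])
  show "Cinf_on {0<..} sqrt"
    by (auto simp: Cinf_on_def Ck_on_sqrt simp del: Ck_on.simps)
qed (use assms(2) in auto)

lemma Cinf_on_fd:
  fixes f :: "'y::euclidean_space \<Rightarrow> 'b::real_normed_vector"
  assumes "Cinf_on S f" "Cinf_on S X"
  shows "Cinf_on S (\<lambda>x. fd f x (X x))"
proof (rule Cinf_on_cong)
  show "Cinf_on S (\<lambda>x. \<Sum>b\<in>Basis. (X x \<bullet> b) *\<^sub>R fd f x b)"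
    by (intro Cinf_on_sum Cinf_on_scaleR Cinf_on_fd_const assms Cinf_on_bounded_linear[OF bounded_linear_inner_left]
        Cinf_on_open[OF assms(1)] finite_Basis)
  show "(\<Sum>b\<in>Basis. (X x \<bullet> b) *\<^sub>R fd f x b) = fd f x (X x)" if "x \<in> S" for x
    by (rule fd_expansion[OF Cinf_on_has_derivative[OF assms(1) that], symmetric])
qed

lemma Cinf_on_vec_nth: "Cinf_on S f \<Longrightarrow> Cinf_on S (\<lambda>x. f x $ i)"
  by (rule Cinf_on_bounded_linear[OF bounded_linear_vec_nth])

lemma Cinf_on_vec_lambda:
  fixes f :: "'i::finite \<Rightarrow> 'x::real_normed_vector \<Rightarrow> 'b::euclidean_space"
  assumes "\<And>i. Cinf_on S (f i)"
  shows "Cinf_on S (\<lambda>x. \<chi> i. f i x)"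
proof (rule Cinf_on_cong)
  have lin: "bounded_linear (\<lambda>y::'b. axis i y :: 'b^'i)" for i
    by (intro linear_conv_bounded_linear[THEN iffD1] linearI) (auto simp: axis_def vec_eq_iff)
  show "Cinf_on S (\<lambda>x. \<Sum>i\<in>UNIV. axis i (f i x))"
    by (intro Cinf_on_sum Cinf_on_bounded_linear[OF lin] assms Cinf_on_open[OF assms]) auto
  show "(\<Sum>i\<in>UNIV. axis i (f i x)) = (\<chi> i. f i x)" for x
    by (simp add: vec_eq_iff axis_def if_distrib if_distribR cong: if_cong)
qed

lemma bounded_bilinear_mv: "bounded_bilinear (\<lambda>(M :: real^'m^'n) v. M *v v)"
  by (subst bilinear_conv_bounded_bilinear[symmetric])
    (auto simp: bilinear_def matrix_vector_mult_add_rdistrib matrix_vector_right_distrib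
       scaleR_matrix_vector_assoc[symmetric] matrix_vector_mult_scaleR intro!: linearI)

lemmas Cinf_on_mv = Cinf_on_bounded_bilinear[OF bounded_bilinear_mv]

lemma Cinf_on_det:
  fixes M :: "'x::real_normed_vector \<Rightarrow> real^'n^'n"
  assumes "Cinf_on S M"
  shows "Cinf_on S (\<lambda>x. det (M x))"
  unfolding det_def
  by (intro Cinf_on_sum Cinf_on_mult Cinf_on_prod Cinf_on_const Cinf_on_vec_nth assms
      Cinf_on_open[OF assms]) auto

text \<open>By Cramer's rule the solution is a rational function of the coefficients.\<close>

lemma Cinf_on_linear_solve:
  fixes M :: "'x::real_normed_vector \<Rightarrow> real^'n^'n"
  assumes "Cinf_on S M" "Cinf_on S b" "\<And>x. x \<in> S \<Longrightarrow> det (M x) \<noteq> 0"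
  obtains z where "Cinf_on S z" "\<And>x y. x \<in> S \<Longrightarrow> M x *v y = b x \<longleftrightarrow> y = z x"
proof
  let ?z = "\<lambda>x. \<chi> k. det (\<chi> i j. if j = k then b x $ i else M x $ i $ j) / det (M x)"
  show "M x *v y = b x \<longleftrightarrow> y = ?z x" if "x \<in> S" for x y
    using cramer[OF assms(3)[OF that]] by simp
  show "Cinf_on S ?z"
  proof (intro Cinf_on_vec_lambda Cinf_on_divide Cinf_on_det)
    show "Cinf_on S (\<lambda>x. if j = k then b x $ i else M x $ i $ j)" for i j k
      by (cases "j = k") (simp_all add: Cinf_on_vec_nth Cinf_on_vec_nth[OF Cinf_on_vec_nth[OF assms(1)]] assms(2))
  qed (use assms in auto)
qed

section \<open>Second derivatives\<close>

text \<open>The mean value theorem, applied twice, identifies the second difference quotient with a mixed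
  second derivative at a nearby point. This works for either order of differentiation.\<close>

lemma fd_fd_sym_real:
  fixes f :: "'x::euclidean_space \<Rightarrow> real"
  assumes f: "Cinf_on S f" and x: "x \<in> S"
  shows "fd (\<lambda>y. fd f y u) x v = fd (\<lambda>y. fd f y v) x u"
proof (rule ccontr)
  have near: "\<exists>d>0. \<forall>s. 0 < s \<and> s < d \<longrightarrow>
      \<bar>(f (x + s *\<^sub>R u + s *\<^sub>R v) - f (x + s *\<^sub>R u) - f (x + s *\<^sub>R v) + f x) / s\<^sup>2 - fd (\<lambda>y. fd f y u) x v\<bar> < e"
    if "e > 0" for u v and e :: real
  proof -
    let ?g = "\<lambda>y. fd (\<lambda>y. fd f y u) y v"
    have "continuous_on S ?g"
      by (intro Cinf_on_continuous Cinf_on_fd_const f)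
    then obtain d0 where d0: "d0 > 0" "\<And>y. dist y x < d0 \<Longrightarrow> y \<in> S \<and> \<bar>?g y - ?g x\<bar> < e"
    proof -
      have "(?g \<longlongrightarrow> ?g x) (nhds x)"
        using \<open>continuous_on S ?g\<close> Cinf_on_open[OF f] x
        by (simp only: continuous_on_eq_continuous_at isCont_def flip: tendsto_at_iff_tendsto_nhds[of ?g x])
      then have "\<forall>\<^sub>F y in nhds x. y \<in> S \<and> dist (?g y) (?g x) < e"
        using Cinf_on_open[OF f] x \<open>e > 0\<close>
        by (intro eventually_conj eventually_nhds_in_open tendstoD)
      then show ?thesis using that unfolding eventually_nhds_metric dist_real_def by metis
    qed
    \<comment> \<open>steps shorter than \<open>d\<close> keep the whole parallelogram in the ball of radius \<open>d0\<close>\<close>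
    define d where "d = d0 / (1 + norm u + norm v)"
    have pos: "1 + norm u + norm v > 0" using norm_ge_zero[of u] norm_ge_zero[of v] by linarith
    have "d > 0" using d0 pos by (simp add: d_def)
    have close: "dist (x + a *\<^sub>R u + b *\<^sub>R v) x < d0" if "0 \<le> a" "a \<le> s" "0 \<le> b" "b \<le> s" "s < d" for a b s
    proof -
      have "dist (x + a *\<^sub>R u + b *\<^sub>R v) x \<le> norm (a *\<^sub>R u) + norm (b *\<^sub>R v)"
        by (metis add.assoc add_diff_cancel_left' dist_norm norm_triangle_ineq)
      also have "\<dots> \<le> s * norm u + s * norm v"
        using that by (simp add: mult_right_mono add_mono)
      also have "\<dots> \<le> s * (1 + norm u + norm v)" using that by (simp add: algebra_simps)
      also have "\<dots> < d * (1 + norm u + norm v)" using that pos by (intro mult_strict_right_mono) auto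
      also have "\<dots> = d0" using pos by (simp add: d_def)
      finally show ?thesis .
    qed
    show ?thesis
    proof (intro exI conjI allI impI)
      fix s :: real assume s: "0 < s \<and> s < d"
      define p where "p a = f (x + a *\<^sub>R u + s *\<^sub>R v) - f (x + a *\<^sub>R u)" for a
      have dp: "(p has_real_derivative (fd f (x + a *\<^sub>R u + s *\<^sub>R v) u - fd f (x + a *\<^sub>R u) u)) (at a)"
        if "0 \<le> a" "a \<le> s" for a
      proof -
        have *: "((\<lambda>a. f (x + a *\<^sub>R u + b *\<^sub>R v)) has_derivative (\<lambda>t. fd f (x + a *\<^sub>R u + b *\<^sub>R v) (t *\<^sub>R u))) (at a)"
          if "0 \<le> b" "b \<le> s" for b
          by (rule has_derivative_compose[where g = f])
            (use d0(2)[OF close[of a s b]] that s \<open>0 \<le> a\<close> \<open>a \<le> s\<close> in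
              \<open>auto intro!: derivative_eq_intros Cinf_on_has_derivative[OF f]\<close>)
        have lin: "linear (fd f (x + a *\<^sub>R u + b *\<^sub>R v))" if "0 \<le> b" "b \<le> s" for b
          using d0(2)[OF close[of a s b]] that s \<open>0 \<le> a\<close> \<open>a \<le> s\<close> by (intro fd_linear[OF f]) auto
        show ?thesis
          unfolding has_field_derivative_def p_def
          using has_derivative_diff[OF *[of s] *[of 0]] s
          by (rule_tac has_derivative_eq_rhs)
            (auto simp: fun_eq_iff left_diff_distrib right_diff_distrib mult.commute
               linear_scale[OF lin[of s]] linear_scale[OF lin[of 0], simplified])
      qed
      obtain a where a: "0 < a" "a < s" "p s - p 0 = s * (fd f (x + a *\<^sub>R u + s *\<^sub>R v) u - fd f (x + a *\<^sub>R u) u)"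
        using MVT2[of 0 s p, OF _ dp] s by auto
      define q where "q b = fd f (x + a *\<^sub>R u + b *\<^sub>R v) u" for b
      have dq: "(q has_real_derivative ?g (x + a *\<^sub>R u + b *\<^sub>R v)) (at b)" if "0 \<le> b" "b \<le> s" for b
      proof -
        have mem: "x + a *\<^sub>R u + b *\<^sub>R v \<in> S" using d0(2)[OF close[of a s b]] that s a by auto
        have "(q has_derivative (\<lambda>t. fd (\<lambda>y. fd f y u) (x + a *\<^sub>R u + b *\<^sub>R v) (t *\<^sub>R v))) (at b)"
          unfolding q_def
          by (rule has_derivative_compose[where g = "\<lambda>y. fd f y u"])
            (auto intro!: derivative_eq_intros Cinf_on_has_derivative[OF Cinf_on_fd_const[OF f]] mem)
        then show ?thesis
          unfolding has_field_derivative_def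
          by (rule has_derivative_eq_rhs)
            (auto simp: fun_eq_iff linear_scale[OF fd_linear[OF Cinf_on_fd_const[OF f] mem]])
      qed
      obtain b where b: "0 < b" "b < s" "q s - q 0 = s * ?g (x + a *\<^sub>R u + b *\<^sub>R v)"
        using MVT2[of 0 s q, OF _ dq] s by auto
      have "p s - p 0 = s\<^sup>2 * ?g (x + a *\<^sub>R u + b *\<^sub>R v)"
        using a(3) b(3) by (simp add: q_def power2_eq_square)
      then have "(f (x + s *\<^sub>R u + s *\<^sub>R v) - f (x + s *\<^sub>R u) - f (x + s *\<^sub>R v) + f x) / s\<^sup>2
         = ?g (x + a *\<^sub>R u + b *\<^sub>R v)"
        using s by (simp add: p_def field_simps)
      then show "\<bar>(f (x + s *\<^sub>R u + s *\<^sub>R v) - f (x + s *\<^sub>R u) - f (x + s *\<^sub>R v) + f x) / s\<^sup>2 - ?g x\<bar> < e"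
        using d0(2)[OF close[of a s b]] a b s by simp
    qed (fact \<open>d > 0\<close>)
  qed
  assume ne: "\<not> ?thesis"
  define e where "e = \<bar>fd (\<lambda>y. fd f y u) x v - fd (\<lambda>y. fd f y v) x u\<bar> / 2"
  have "e > 0" using ne by (simp add: e_def)
  obtain d1 d2 where d: "d1 > 0" "d2 > 0"
    and 1: "\<And>s. 0 < s \<and> s < d1 \<Longrightarrow> \<bar>(f (x + s *\<^sub>R u + s *\<^sub>R v) - f (x + s *\<^sub>R u) - f (x + s *\<^sub>R v) + f x) / s\<^sup>2 - fd (\<lambda>y. fd f y u) x v\<bar> < e"
    and 2: "\<And>s. 0 < s \<and> s < d2 \<Longrightarrow> \<bar>(f (x + s *\<^sub>R v + s *\<^sub>R u) - f (x + s *\<^sub>R v) - f (x + s *\<^sub>R u) + f x) / s\<^sup>2 - fd (\<lambda>y. fd f y v) x u\<bar> < e"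
    using near[OF \<open>e > 0\<close>, of u v] near[OF \<open>e > 0\<close>, of v u] by blast
  define s where "s = min d1 d2 / 2"
  have s: "0 < s \<and> s < d1" "0 < s \<and> s < d2" using d by (auto simp: s_def)
  have eq: "f (x + s *\<^sub>R v + s *\<^sub>R u) - f (x + s *\<^sub>R v) - f (x + s *\<^sub>R u) + f x =
     f (x + s *\<^sub>R u + s *\<^sub>R v) - f (x + s *\<^sub>R u) - f (x + s *\<^sub>R v) + f x"
    by (simp add: add.commute add.left_commute)
  have tri: "\<bar>A - B\<bar> < e \<Longrightarrow> \<bar>A - C\<bar> < e \<Longrightarrow> \<bar>B - C\<bar> < 2 * e" for A B C :: real by linarith
  show False
    using tri[OF 1[OF s(1)] 2[OF s(2), unfolded eq]] by (simp add: e_def)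
qed

lemma fd_bounded_linear:
  "bounded_linear L \<Longrightarrow> Cinf_on S f \<Longrightarrow> x \<in> S \<Longrightarrow> fd (\<lambda>y. L (f y)) x v = L (fd f x v)"
  using fd_eq[OF bounded_linear.has_derivative[OF _ Cinf_on_has_derivative]] by metis

lemma fd_cong:
  assumes "Cinf_on S f" "x \<in> S" "\<And>y. y \<in> S \<Longrightarrow> f y = g y"
  shows "fd g x = fd f x"
  using fd_eq[OF has_derivative_transform_within_open[OF Cinf_on_has_derivative[OF assms(1,2)] Cinf_on_open[OF assms(1)] assms(2,3)]] .

lemma fd_fd_sym:
  fixes f :: "'x::euclidean_space \<Rightarrow> 'b::euclidean_space"
  assumes f: "Cinf_on S f" and x: "x \<in> S"
  shows "fd (\<lambda>y. fd f y u) x v = fd (\<lambda>y. fd f y v) x u"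
proof (rule euclidean_eqI)
  fix b :: 'b
  have "fd (\<lambda>y. fd f y u) x v \<bullet> b = fd (\<lambda>y. fd (\<lambda>z. f z \<bullet> b) y u) x v" for u v
  proof -
    have "fd (\<lambda>y. fd (\<lambda>z. f z \<bullet> b) y u) x v = fd (\<lambda>y. fd f y u \<bullet> b) x v"
      by (subst fd_cong[OF Cinf_on_fd_const[OF Cinf_on_bounded_linear[OF bounded_linear_inner_left f]] x,
           where g = "\<lambda>y. fd f y u \<bullet> b"])
        (simp_all add: fd_bounded_linear[OF bounded_linear_inner_left f])
    then show ?thesis
      by (simp add: fd_bounded_linear[OF bounded_linear_inner_left Cinf_on_fd_const[OF f] x])
  qed
  then show "fd (\<lambda>y. fd f y u) x v \<bullet> b = fd (\<lambda>y. fd f y v) x u \<bullet> b"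
    using fd_fd_sym_real[OF Cinf_on_bounded_linear[OF bounded_linear_inner_left f] x] by simp
qed

text \<open>The product rule for a derivative in a variable direction, obtained by expanding the direction in
  the standard basis.\<close>

lemma fd_fd_field:
  fixes F :: "'x::euclidean_space \<Rightarrow> 'b::euclidean_space"
  assumes F: "Cinf_on S F" and Z: "Cinf_on S Z" and x: "x \<in> S"
  shows "fd (\<lambda>y. fd F y (Z y)) x w = fd (\<lambda>y. fd F y (Z x)) x w + fd F x (fd Z x w)"
proof -
  have "fd (\<lambda>y. fd F y (Z y)) x w = fd (\<lambda>y. \<Sum>b\<in>Basis. (Z y \<bullet> b) *\<^sub>R fd F y b) x w"
    by (subst fd_cong[OF Cinf_on_fd[OF F Z] x, where g = "\<lambda>y. \<Sum>b\<in>Basis. (Z y \<bullet> b) *\<^sub>R fd F y b"])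
      (rule refl | rule fd_expansion[OF Cinf_on_has_derivative[OF F]] | assumption)+
  also have "\<dots> = (\<Sum>b\<in>Basis. (Z x \<bullet> b) *\<^sub>R fd (\<lambda>y. fd F y b) x w + (fd Z x w \<bullet> b) *\<^sub>R fd F x b)"
  proof -
    have "((\<lambda>y. (Z y \<bullet> b) *\<^sub>R fd F y b) has_derivative (\<lambda>w. (Z x \<bullet> b) *\<^sub>R fd (\<lambda>y. fd F y b) x w + (fd Z x w \<bullet> b) *\<^sub>R fd F x b)) (at x)" for b
      by (rule bounded_bilinear.FDERIV[OF bounded_bilinear_scaleR
          bounded_linear.has_derivative[OF bounded_linear_inner_left Cinf_on_has_derivative[OF Z x]]
          Cinf_on_has_derivative[OF Cinf_on_fd_const[OF F] x]])
    then have "((\<lambda>y. \<Sum>b\<in>Basis. (Z y \<bullet> b) *\<^sub>R fd F y b) has_derivative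
        (\<lambda>w. \<Sum>b\<in>Basis. (Z x \<bullet> b) *\<^sub>R fd (\<lambda>y. fd F y b) x w + (fd Z x w \<bullet> b) *\<^sub>R fd F x b)) (at x)"
      by (rule has_derivative_sum)
    from fd_eq[OF this] show ?thesis by (simp only:)
  qed
  also have "\<dots> = (\<Sum>b\<in>Basis. (Z x \<bullet> b) *\<^sub>R fd (\<lambda>y. fd F y b) x w) + fd F x (fd Z x w)"
    by (simp only: sum.distrib fd_expansion[OF Cinf_on_has_derivative[OF F x], of "fd Z x w"])
  also have "(\<Sum>b\<in>Basis. (Z x \<bullet> b) *\<^sub>R fd (\<lambda>y. fd F y b) x w) = fd (\<lambda>y. fd F y (Z x)) x w"
  proof -
    have "(\<Sum>b\<in>Basis. (Z x \<bullet> b) *\<^sub>R fd (\<lambda>y. fd F y b) x w) = (\<Sum>b\<in>Basis. (Z x \<bullet> b) *\<^sub>R fd (\<lambda>y. fd F y w) x b)"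
      by (intro sum.cong refl) (simp only: fd_fd_sym[OF F x])
    also have "\<dots> = fd (\<lambda>y. fd F y w) x (Z x)"
      by (rule fd_expansion[symmetric, OF Cinf_on_has_derivative[OF Cinf_on_fd_const[OF F] x]])
    finally show ?thesis by (simp only: fd_fd_sym[OF F x])
  qed
  finally show ?thesis .
qed

lemma Cinf_on_fd_fd:
  fixes F :: "'x::euclidean_space \<Rightarrow> 'b::euclidean_space"
  assumes F: "Cinf_on S F" and X: "Cinf_on S X" and Y: "Cinf_on S Y"
  shows "Cinf_on S (\<lambda>x. fd (\<lambda>y. fd F y (Y x)) x (X x))"
proof (rule Cinf_on_cong)
  show "Cinf_on S (\<lambda>x. fd (\<lambda>y. fd F y (Y y)) x (X x) - fd F x (fd Y x (X x)))"
    by (intro Cinf_on_diff Cinf_on_fd F X Y)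
  show "fd (\<lambda>y. fd F y (Y y)) x (X x) - fd F x (fd Y x (X x)) = fd (\<lambda>y. fd F y (Y x)) x (X x)" if "x \<in> S" for x
    unfolding fd_fd_field[OF F Y that] by simp
qed

section \<open>Hadamard's lemma\<close>

lemma norm_remove_component_le:
  fixes z e :: "'x::real_inner"
  assumes "norm e = 1" "0 \<le> t" "t \<le> 1"
  shows "norm (z - ((1 - t) * (z \<bullet> e)) *\<^sub>R e) \<le> norm z"
proof (rule norm_le[THEN iffD2])
  have "e \<bullet> e = 1" using assms(1) by (simp add: dot_square_norm)
  then have "(z - ((1 - t) * (z \<bullet> e)) *\<^sub>R e) \<bullet> (z - ((1 - t) * (z \<bullet> e)) *\<^sub>R e)
      = z \<bullet> z - (1 - t) * (1 + t) * (z \<bullet> e)\<^sup>2"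
    by (simp add: inner_diff_left inner_diff_right power2_eq_square algebra_simps inner_commute)
  also have "\<dots> \<le> z \<bullet> z" using assms by simp
  finally show "(z - ((1 - t) * (z \<bullet> e)) *\<^sub>R e) \<bullet> (z - ((1 - t) * (z \<bullet> e)) *\<^sub>R e) \<le> z \<bullet> z" .
qed

text \<open>Moments of \<open>\<Phi>\<close> along the segment that joins the projection of \<open>x\<close> to the hyperplane orthogonal to
  \<open>e\<close> with \<open>x\<close>. Hadamard's lemma only needs \<open>j = 0\<close>; differentiation under the integral sign produces
  factors \<open>1 - t\<close>, and the family of all moments is closed under it.\<close>

definition ray_moment :: "'x::real_inner \<Rightarrow> nat \<Rightarrow> ('x \<Rightarrow> real) \<Rightarrow> 'x \<Rightarrow> real" where
  "ray_moment e j \<Phi> x = integral (cbox 0 1) (\<lambda>t. t ^ j * \<Phi> (x - ((1 - t) * (x \<bullet> e)) *\<^sub>R e))"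

lemma ray_in_ball:
  fixes x x0 :: "'x::real_inner"
  assumes "norm e = 1" "x0 \<bullet> e = 0" "0 \<le> t" "t \<le> 1" "x \<in> ball x0 r"
  shows "x - ((1 - t) * (x \<bullet> e)) *\<^sub>R e \<in> ball x0 r"
proof -
  have "x - ((1 - t) * (x \<bullet> e)) *\<^sub>R e - x0 = (x - x0) - ((1 - t) * ((x - x0) \<bullet> e)) *\<^sub>R e"
    using assms(2) by (simp add: inner_diff_left)
  then have "norm (x - ((1 - t) * (x \<bullet> e)) *\<^sub>R e - x0) \<le> norm (x - x0)"
    using norm_remove_component_le[OF assms(1,3,4), of "x - x0"] by (simp only:)
  then show ?thesis using assms(5) by (simp add: dist_norm norm_minus_commute)
qed

text \<open>Differentiation under the integral sign: the derivative of the point of the segment with parameter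
  \<open>t\<close> in direction \<open>v\<close> is \<open>v - (1 - t) (v \<bullet> e) e\<close>.\<close>

lemma ray_moment_has_derivative:
  fixes \<Phi> :: "'x::euclidean_space \<Rightarrow> real"
  assumes e: "norm e = 1" "x0 \<bullet> e = 0" and \<Phi>: "Cinf_on (ball x0 r) \<Phi>" and x: "x \<in> ball x0 r"
  shows "(ray_moment e j \<Phi> has_derivative (\<lambda>v. ray_moment e j (\<lambda>y. fd \<Phi> y v) x
     - (v \<bullet> e) * (ray_moment e j (\<lambda>y. fd \<Phi> y e) x - ray_moment e (Suc j) (\<lambda>y. fd \<Phi> y e) x))) (at x)"
proof -
  let ?y = "\<lambda>x t. x - ((1 - t) * (x \<bullet> e)) *\<^sub>R e"
  let ?D = "\<lambda>x t. \<Sum>b\<in>Basis. (t ^ j * fd \<Phi> (?y x t) b) *\<^sub>R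
     (blinfun_inner_left b - ((1 - t) * (e \<bullet> b)) *\<^sub>R blinfun_inner_left e)"
  have mem: "?y x t \<in> ball x0 r" if "x \<in> ball x0 r" "t \<in> cbox 0 1" for x t
    using ray_in_ball[OF e _ _ that(1)] that(2) by auto
  have cont: "continuous_on (ball x0 r \<times> cbox 0 1) (\<lambda>(x, t). \<Psi> (?y x t))"
    if "Cinf_on (ball x0 r) \<Psi>" for \<Psi> :: "'x \<Rightarrow> real"
    unfolding split_beta
    by (rule continuous_on_compose2[OF Cinf_on_continuous[OF that]])
      (use mem in \<open>auto intro!: continuous_intros\<close>)
  have cont1: "continuous_on (cbox 0 1) (\<lambda>t. \<Psi> (?y x t))" if "Cinf_on (ball x0 r) \<Psi>" "x \<in> ball x0 r" for \<Psi> :: "'x \<Rightarrow> real" and x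
    by (rule continuous_on_compose2[OF Cinf_on_continuous[OF that(1)]])
      (use mem that in \<open>auto intro!: continuous_intros\<close>)
  have int: "(\<lambda>t. t ^ i * \<Psi> (?y x t)) integrable_on cbox 0 1" if "Cinf_on (ball x0 r) \<Psi>" for \<Psi> :: "'x \<Rightarrow> real" and i
    by (intro integrable_continuous continuous_intros cont1 that x)
  have D: "blinfun_apply (?D x t) v = t ^ j * fd \<Phi> (?y x t) (v - ((1 - t) * (v \<bullet> e)) *\<^sub>R e)"
    if "x \<in> ball x0 r" "t \<in> cbox 0 1" for x t v
  proof -
    have *: "fd \<Phi> (?y x t) (v - ((1 - t) * (v \<bullet> e)) *\<^sub>R e)
       = (\<Sum>b\<in>Basis. ((v - ((1 - t) * (v \<bullet> e)) *\<^sub>R e) \<bullet> b) *\<^sub>R fd \<Phi> (?y x t) b)"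
      by (rule fd_expansion[OF Cinf_on_has_derivative[OF \<Phi> mem[OF that]]])
    show ?thesis
      apply (subst *)
      apply (simp only: sum_distrib_left blinfun.sum_left)
      apply (rule sum.cong[OF refl])
      apply (simp only: blinfun.scaleR_left blinfun.diff_left inner_diff_left blinfun_inner_left.rep_eq real_scaleR_def inner_scaleR_left)
      apply (simp only: algebra_simps)
      done
  qed
  have "((\<lambda>x. integral (cbox 0 1) (\<lambda>t. t ^ j * \<Phi> (?y x t))) has_derivative integral (cbox 0 1) (?D x)) (at x within ball x0 r)"
  proof (rule leibniz_rule[where fx = ?D])
    fix x :: 'x and t :: real assume xt: "x \<in> ball x0 r" "t \<in> cbox 0 1"
    have "((\<lambda>x. \<Phi> (?y x t)) has_derivative (\<lambda>v. fd \<Phi> (?y x t) (v - ((1 - t) * (v \<bullet> e)) *\<^sub>R e))) (at x)"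
      by (rule has_derivative_compose[where g = \<Phi> and f = "\<lambda>x. ?y x t", OF _ Cinf_on_has_derivative[OF \<Phi> mem[OF xt]]])
        (auto intro!: derivative_eq_intros)
    from has_derivative_at_withinI[OF has_derivative_mult_right[OF this, of "t ^ j"]]
    show "((\<lambda>x. t ^ j * \<Phi> (?y x t)) has_derivative blinfun_apply (?D x t)) (at x within ball x0 r)"
      by (rule has_derivative_eq_rhs) (rule ext, rule D[OF xt, symmetric])
  next
    show "(\<lambda>t. t ^ j * \<Phi> (?y x t)) integrable_on cbox 0 1" if "x \<in> ball x0 r" for x
      by (intro integrable_continuous continuous_intros cont1 \<Phi> that)
    show "continuous_on (ball x0 r \<times> cbox 0 1) (\<lambda>(x, t). ?D x t)"
      unfolding split_beta
      by (intro continuous_intros cont[OF Cinf_on_fd_const[OF \<Phi>], unfolded split_beta])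
  qed (use x in auto)
  then have der: "((\<lambda>x. integral (cbox 0 1) (\<lambda>t. t ^ j * \<Phi> (?y x t))) has_derivative integral (cbox 0 1) (?D x)) (at x)"
    using x by (simp add: at_within_open[OF x open_ball])
  have "blinfun_apply (integral (cbox 0 1) (?D x)) v = ray_moment e j (\<lambda>y. fd \<Phi> y v) x
     - (v \<bullet> e) * (ray_moment e j (\<lambda>y. fd \<Phi> y e) x - ray_moment e (Suc j) (\<lambda>y. fd \<Phi> y e) x)" for v
  proof -
    have "?D x integrable_on cbox 0 1"
      by (intro integrable_continuous continuous_intros cont1 Cinf_on_fd_const \<Phi> x)
    then have "blinfun_apply (integral (cbox 0 1) (?D x)) v = integral (cbox 0 1) (\<lambda>t. blinfun_apply (?D x t) v)"
      by (rule blinfun_apply_integral)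
    also have "\<dots> = integral (cbox 0 1) (\<lambda>t. t ^ j * fd \<Phi> (?y x t) v
        - (v \<bullet> e) * (t ^ j * fd \<Phi> (?y x t) e - t ^ Suc j * fd \<Phi> (?y x t) e))"
    proof (rule integral_cong)
      fix t :: real assume t: "t \<in> cbox 0 1"
      have lin: "linear (fd \<Phi> (?y x t))" by (rule fd_linear[OF \<Phi> mem[OF x t]])
      show "blinfun_apply (?D x t) v = t ^ j * fd \<Phi> (?y x t) v
        - (v \<bullet> e) * (t ^ j * fd \<Phi> (?y x t) e - t ^ Suc j * fd \<Phi> (?y x t) e)"
        unfolding D[OF x t] linear_diff[OF lin] linear_scale[OF lin] by (simp add: algebra_simps)
    qed
    also have "\<dots> = ray_moment e j (\<lambda>y. fd \<Phi> y v) x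
     - (v \<bullet> e) * (ray_moment e j (\<lambda>y. fd \<Phi> y e) x - ray_moment e (Suc j) (\<lambda>y. fd \<Phi> y e) x)"
      unfolding ray_moment_def
      by (intro integral_unique has_integral_diff has_integral_mult_right integrable_integral
          int[OF Cinf_on_fd_const[OF \<Phi>]])
    finally show ?thesis .
  qed
  then have "blinfun_apply (integral (cbox 0 1) (?D x)) = (\<lambda>v. ray_moment e j (\<lambda>y. fd \<Phi> y v) x
     - (v \<bullet> e) * (ray_moment e j (\<lambda>y. fd \<Phi> y e) x - ray_moment e (Suc j) (\<lambda>y. fd \<Phi> y e) x))" by blast
  moreover have "(\<lambda>x. integral (cbox 0 1) (\<lambda>t. t ^ j * \<Phi> (?y x t))) = ray_moment e j \<Phi>"
    by (simp add: ray_moment_def fun_eq_iff)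
  ultimately show ?thesis using der by simp
qed

lemma Cinf_on_ray_moment:
  fixes \<Phi> :: "'x::euclidean_space \<Rightarrow> real"
  assumes e: "norm e = 1" "x0 \<bullet> e = 0" and \<Phi>: "Cinf_on (ball x0 r) \<Phi>"
  shows "Cinf_on (ball x0 r) (ray_moment e j \<Phi>)"
proof -
  have "Ck_on k (ball x0 r) (ray_moment e j \<Phi>)" for k
    using \<Phi>
  proof (induction k arbitrary: \<Phi> j)
    case 0
    then show ?case
      using ray_moment_has_derivative[OF e]
      by (auto intro!: continuous_at_imp_continuous_on has_derivative_continuous)
  next
    case (Suc k)
    have neg: "Ck_on k (ball x0 r) (\<lambda>x. - f x)" if "Ck_on k (ball x0 r) f" for f :: "'x \<Rightarrow> real"
      by (rule Ck_on_bounded_linear[OF bounded_linear_minus[OF bounded_linear_ident] open_ball that])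
    show ?case
      by (rule Ck_on_SucI[OF open_ball ray_moment_has_derivative[OF e Suc.prems]], assumption,
          unfold diff_conv_add_uminus,
          intro Ck_on_add neg Ck_on_bounded_bilinear[OF bounded_bilinear_mult] Ck_on_const open_ball
            Suc.IH Cinf_on_fd_const Suc.prems)
  qed
  then show ?thesis by (simp add: Cinf_on_def)
qed

text \<open>By the fundamental theorem of calculus the quotient is the average of the normal derivative along the
  segment from the hyperplane to the point.\<close>

lemma Hadamard:
  fixes F :: "'x::euclidean_space \<Rightarrow> real"
  assumes F: "Cinf_on W F" and x0: "x0 \<in> W" "x0 \<bullet> e = 0" and e: "norm e = 1"
    and vanish: "\<And>x. x \<in> W \<Longrightarrow> x \<bullet> e = 0 \<Longrightarrow> F x = 0"
  obtains W' H where "x0 \<in> W'" "W' \<subseteq> W" "Cinf_on W' H" "\<And>x. x \<in> W' \<Longrightarrow> F x = (x \<bullet> e) * H x"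
proof -
  obtain r where r: "r > 0" "ball x0 r \<subseteq> W"
    using Cinf_on_open[OF F] x0(1) openE by blast
  have Fr: "Cinf_on (ball x0 r) F" by (rule Cinf_on_subset[OF F open_ball r(2)])
  show thesis
  proof
    show "Cinf_on (ball x0 r) (ray_moment e 0 (\<lambda>y. fd F y e))"
      by (intro Cinf_on_ray_moment e x0 Cinf_on_fd_const Fr)
    fix x assume x: "x \<in> ball x0 r"
    let ?y = "\<lambda>t. x - ((1 - t) * (x \<bullet> e)) *\<^sub>R e"
    have mem: "?y t \<in> ball x0 r" if "0 \<le> t" "t \<le> 1" for t
      by (rule ray_in_ball[OF e x0(2) that x])
    have "((\<lambda>t. (x \<bullet> e) * fd F (?y t) e) has_integral F (?y 1) - F (?y 0)) {0..1}"
    proof (rule fundamental_theorem_of_calculus)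
      fix t :: real assume t: "t \<in> {0..1}"
      then have mem: "?y t \<in> ball x0 r" using mem by auto
      have "((\<lambda>t. F (?y t)) has_derivative (\<lambda>s. fd F (?y t) ((s * (x \<bullet> e)) *\<^sub>R e))) (at t)"
        by (rule has_derivative_compose[where g = F and f = ?y, OF _ Cinf_on_has_derivative[OF Fr mem]])
          (auto intro!: derivative_eq_intros simp: algebra_simps)
      then show "((\<lambda>t. F (?y t)) has_vector_derivative (x \<bullet> e) * fd F (?y t) e) (at t within {0..1})"
        unfolding has_vector_derivative_def
        by (simp add: has_derivative_at_withinI linear_scale[OF fd_linear[OF Fr mem]] mult.assoc)
    qed simp
    moreover have "F (?y 0) = 0"
      using vanish[of "?y 0"] mem[of 0] r(2) e by (auto simp: inner_diff_left dot_square_norm)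
    ultimately have "((\<lambda>t. (x \<bullet> e) * fd F (?y t) e) has_integral F x) {0..1}"
      by simp
    from integral_unique[OF this] show "F x = (x \<bullet> e) * ray_moment e 0 (\<lambda>y. fd F y e) x"
      by (simp add: ray_moment_def)
  qed (use r in auto)
qed

section \<open>Bump functions\<close>

text \<open>Differentiating \<open>p(1/t) exp(-1/t)\<close> only changes the polynomial, so smoothness of all these functions
  at once follows by induction on the order of differentiability.\<close>

definition poly_exp :: "real poly \<Rightarrow> real \<Rightarrow> real" where
  "poly_exp p t = (if t > 0 then poly p (inverse t) * exp (- inverse t) else 0)"

lemma poly_exp_tendsto_0: "(poly_exp p \<longlongrightarrow> 0) (at 0)"
proof -
  have "((\<lambda>u. \<Sum>i\<le>degree p. coeff p i * (u ^ i / exp u)) \<longlongrightarrow> (\<Sum>i\<le>degree p. coeff p i * 0)) at_top"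
    by (intro tendsto_intros tendsto_power_div_exp_0)
  then have "((\<lambda>u. poly p u * exp (- u)) \<longlongrightarrow> 0) at_top"
    by (simp add: poly_altdef sum_distrib_right exp_minus divide_inverse mult.assoc)
  then have "((\<lambda>t. poly p (inverse t) * exp (- inverse t)) \<longlongrightarrow> 0) (at_right 0)"
    by (rule filterlim_compose[OF _ filterlim_inverse_at_top_right])
  then have "(poly_exp p \<longlongrightarrow> 0) (at_right 0)"
    by (rule Lim_transform_eventually) (auto simp: poly_exp_def eventually_at_filter)
  moreover have "(poly_exp p \<longlongrightarrow> 0) (at_left 0)"
    by (rule Lim_transform_eventually[OF tendsto_const]) (auto simp: poly_exp_def eventually_at_filter)
  ultimately show ?thesis by (simp add: filterlim_at_split)
qed

lemma poly_exp_has_derivative: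
  "(poly_exp p has_real_derivative poly_exp ([:0, 0, 1:] * (p - pderiv p)) t) (at t)"
proof -
  consider "t > 0" | "t < 0" | "t = 0" by linarith
  then show ?thesis
  proof cases
    case 1
    have "((\<lambda>t. poly p (inverse t) * exp (- inverse t)) has_real_derivative
        poly ([:0, 0, 1:] * (p - pderiv p)) (inverse t) * exp (- inverse t)) (at t)"
      using 1 by (auto intro!: derivative_eq_intros DERIV_chain2[OF poly_DERIV] simp: field_simps power2_eq_square)
    then show ?thesis using 1
      by (auto simp: poly_exp_def intro: has_field_derivative_transform_within_open[where S = "{0<..}"])
  next
    case 2
    then show ?thesis
      by (auto simp: poly_exp_def intro: has_field_derivative_transform_within_open[OF DERIV_const, where S = "{..<0}"])
  next
    case 3
    have "((\<lambda>h. (poly_exp p (0 + h) - poly_exp p 0) / h) \<longlongrightarrow> 0) (at 0)"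
      by (rule Lim_transform_eventually[OF poly_exp_tendsto_0[of "[:0, 1:] * p"]])
        (auto simp: poly_exp_def divide_inverse)
    then show ?thesis using 3 by (simp add: DERIV_def poly_exp_def)
  qed
qed

lemma Cinf_on_poly_exp: "Cinf_on UNIV (poly_exp p)"
proof -
  have "Ck_on k UNIV (poly_exp p)" for k
  proof (induction k arbitrary: p)
    case 0
    show ?case
      using poly_exp_has_derivative
      by (auto intro!: continuous_at_imp_continuous_on DERIV_isCont)
  next
    case (Suc k)
    show ?case
      by (rule Ck_on_SucI[OF open_UNIV poly_exp_has_derivative[unfolded has_field_derivative_def]])
        (intro Ck_on_bounded_bilinear[OF bounded_bilinear_mult] Ck_on_const Suc.IH open_UNIV)
  qed
  then show ?thesis by (simp add: Cinf_on_def)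
qed

lemma bump_function:
  fixes x0 :: "'x::euclidean_space"
  assumes "r > 0"
  obtains b :: "'x \<Rightarrow> real" where "Cinf_on UNIV b" "\<And>x. x \<in> ball x0 r \<Longrightarrow> b x > 0" "\<And>x. x \<notin> ball x0 r \<Longrightarrow> b x = 0"
proof
  let ?b = "\<lambda>x. poly_exp 1 (r\<^sup>2 - (x - x0) \<bullet> (x - x0))"
  show "Cinf_on UNIV ?b"
    by (rule Cinf_on_compose[OF Cinf_on_poly_exp])
      (auto intro!: Cinf_on_diff Cinf_on_inner Cinf_on_const Cinf_on_ident)
  have "x \<in> ball x0 r \<longleftrightarrow> (x - x0) \<bullet> (x - x0) < r\<^sup>2" for x
    using assms norm_lt_square[of "x - x0" r] by (simp add: dist_norm norm_minus_commute)
  then show "x \<in> ball x0 r \<Longrightarrow> ?b x > 0" "x \<notin> ball x0 r \<Longrightarrow> ?b x = 0" for x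
    by (auto simp: poly_exp_def)
qed

section \<open>Charts and coordinate expressions\<close>

text \<open>From every point of the half-space one can move inside it along each coordinate direction. So
  derivatives within the half-space are unique.\<close>

lemma halfspace_approach:
  fixes x :: "real^'n::finite"
  assumes "x \<in> halfspace" "i \<in> Basis" "e > 0"
  shows "\<exists>d. 0 < \<bar>d\<bar> \<and> \<bar>d\<bar> < e \<and> x + d *\<^sub>R i \<in> halfspace"
proof (intro exI conjI)
  obtain k where "i = axis k 1" using assms(2) by (auto simp: Basis_vec_def)
  then show "x + (e / 2) *\<^sub>R i \<in> halfspace"
    using assms(1,3) by (simp add: halfspace_def axis_def)
qed (use assms(3) in auto)

lemma frechet_derivative_within_halfspace:
  fixes x :: "real^'n::finite" and f :: "real^'n \<Rightarrow> 'b::real_normed_vector"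
  assumes "x \<in> halfspace" "open W" "x \<in> W" "(F has_derivative D) (at x)"
    and "\<And>y. y \<in> W \<Longrightarrow> y \<in> halfspace \<Longrightarrow> f y = F y"
  shows "frechet_derivative f (at x within halfspace) = D"
proof -
  obtain d where d: "d > 0" "ball x d \<subseteq> W" using assms(2,3) openE by blast
  have "(f has_derivative D) (at x within halfspace)"
    by (rule has_derivative_transform_within[OF has_derivative_at_withinI[OF assms(4)] d(1) assms(1)])
      (use d(2) assms(5)[symmetric] in \<open>auto simp: dist_commute subset_iff\<close>)
  then show ?thesis
    by (metis (no_types, lifting) frechet_derivative_unique_within frechet_derivative_works differentiable_def halfspace_approach[OF assms(1)])
qed

locale manifold_with_boundary =
  fixes A :: "('a::{t2_space,second_countable_topology}, 'n::finite) chart set"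
  assumes mfd: "smooth_manifold_with_boundary A"
begin

lemma chart:
  assumes "(V, \<phi>) \<in> A"
  shows chart_open: "open V"
    and chart_openin: "openin (top_of_set halfspace) (\<phi> ` V)"
    and chart_homeo: "homeomorphism V (\<phi> ` V) \<phi> (inv_into V \<phi>)"
proof -
  have "is_chart (V, \<phi>)" using mfd assms unfolding smooth_manifold_with_boundary_def by blast
  then show "open V" "openin (top_of_set halfspace) (\<phi> ` V)" "homeomorphism V (\<phi> ` V) \<phi> (inv_into V \<phi>)"
    by (auto simp: is_chart_def)
qed

lemma chart_cover: "\<exists>V \<phi>. (V, \<phi>) \<in> A \<and> p \<in> V"
  using mfd unfolding smooth_manifold_with_boundary_def by blast

lemma chart_cont: "(V, \<phi>) \<in> A \<Longrightarrow> continuous_on V \<phi>"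
  using chart_homeo homeomorphism_def by blast

lemma chart_inv: "(V, \<phi>) \<in> A \<Longrightarrow> q \<in> V \<Longrightarrow> inv_into V \<phi> (\<phi> q) = q"
  by (meson chart_homeo homeomorphism_apply1)

lemma chart_inv': "x \<in> \<phi> ` V \<Longrightarrow> \<phi> (inv_into V \<phi> x) = x \<and> inv_into V \<phi> x \<in> V"
  by (simp add: f_inv_into_f inv_into_into)

lemma chart_inj: "(V, \<phi>) \<in> A \<Longrightarrow> inj_on \<phi> V"
  by (metis chart_inv inj_onI)

lemma chart_halfspace: "(V, \<phi>) \<in> A \<Longrightarrow> q \<in> V \<Longrightarrow> \<phi> q \<in> halfspace"
  using chart_openin openin_subset by fastforce

lemma chart_image_open:
  assumes c: "(V, \<phi>) \<in> A" and U: "open U"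
  obtains W where "open W" "\<phi> ` (U \<inter> V) = W \<inter> halfspace"
proof -
  have "openin (top_of_set V) (U \<inter> V)" using U by (simp add: openin_open Int_commute) blast
  then have "openin (top_of_set (\<phi> ` V)) (\<phi> ` (U \<inter> V))"
    using homeomorphism_imp_open_map[OF chart_homeo[OF c]] by blast
  then have "openin (top_of_set halfspace) (\<phi> ` (U \<inter> V))"
    using chart_openin[OF c] openin_trans by blast
  then show thesis using that by (auto simp: openin_open Int_commute)
qed

lemma chart_preimage_open: "(V, \<phi>) \<in> A \<Longrightarrow> open W \<Longrightarrow> open (V \<inter> \<phi> -` W)"
  by (simp add: chart_cont chart_open continuous_open_preimage)

text \<open>\<open>F\<close> extends the coordinate expression of \<open>f\<close> across the bounding hyperplane. Derivatives
  within the half-space become derivatives of \<open>F\<close> on the open set \<open>W\<close>, where the usual calculus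
  is available.\<close>

definition rep :: "'a set \<Rightarrow> ('a \<Rightarrow> real^'n) \<Rightarrow> (real^'n) set \<Rightarrow> ('a \<Rightarrow> 'b::real_normed_vector) \<Rightarrow> (real^'n \<Rightarrow> 'b) \<Rightarrow> bool" where
  "rep V \<phi> W f F \<longleftrightarrow> Cinf_on W F \<and> W \<inter> halfspace \<subseteq> \<phi> ` V \<and> (\<forall>q\<in>V. \<phi> q \<in> W \<longrightarrow> F (\<phi> q) = f q)"

lemma rep_Cinf: "rep V \<phi> W f F \<Longrightarrow> Cinf_on W F"
  and rep_open: "rep V \<phi> W f F \<Longrightarrow> open W"
  and rep_image: "rep V \<phi> W f F \<Longrightarrow> x \<in> W \<Longrightarrow> x \<in> halfspace \<Longrightarrow> x \<in> \<phi> ` V"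
  and rep_eq: "rep V \<phi> W f F \<Longrightarrow> q \<in> V \<Longrightarrow> \<phi> q \<in> W \<Longrightarrow> F (\<phi> q) = f q"
  by (auto simp: rep_def Cinf_on_open)

lemma rep_restrict: "rep V \<phi> W f F \<Longrightarrow> open W' \<Longrightarrow> W' \<subseteq> W \<Longrightarrow> rep V \<phi> W' f F"
  by (auto simp: rep_def intro: Cinf_on_subset)

lemma smooth_fun_rep:
  assumes f: "smooth_fun A U f" and U: "open U" and c: "(V, \<phi>) \<in> A" and p: "p \<in> U" "p \<in> V"
  obtains W F where "\<phi> p \<in> W" "rep V \<phi> W f F" "\<And>q. q \<in> V \<Longrightarrow> \<phi> q \<in> W \<Longrightarrow> q \<in> U"
proof -
  obtain O' where O': "open O'" "\<phi> ` (U \<inter> V) = O' \<inter> halfspace" using chart_image_open[OF c U] .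
  have sm: "smooth_on (\<phi> ` (U \<inter> V)) (f \<circ> inv_into V \<phi>)"
    using f c by (auto simp: smooth_fun_def)
  have "\<phi> p \<in> \<phi> ` (U \<inter> V)" using p by blast
  from bspec[OF sm[unfolded smooth_on_def] this] obtain W F where W: "open W" "\<phi> p \<in> W" "\<And>k. Ck_on k W F"
    "\<And>y. y \<in> W \<inter> \<phi> ` (U \<inter> V) \<Longrightarrow> F y = (f \<circ> inv_into V \<phi>) y"
    by blast
  have inU: "q \<in> U" if "q \<in> V" "\<phi> q \<in> W \<inter> O'" for q
  proof -
    have "\<phi> q \<in> \<phi> ` (U \<inter> V)" using O'(2) that chart_halfspace[OF c] by auto
    then show ?thesis using chart_inj[OF c] that(1) by (auto dest: inj_onD)
  qed
  show thesis
  proof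
    show "\<phi> p \<in> W \<inter> O'" using W O' p by blast
    have "F (\<phi> q) = f q" if "q \<in> V" "\<phi> q \<in> W \<inter> O'" for q
      using W(4)[of "\<phi> q"] that inU[OF that] chart_inv[OF c that(1)] by auto
    then show "rep V \<phi> (W \<inter> O') f F"
      unfolding rep_def using W(1,3) O' by (auto simp: Cinf_on_def intro: Ck_on_subset)
    show "\<And>q. q \<in> V \<Longrightarrow> \<phi> q \<in> W \<inter> O' \<Longrightarrow> q \<in> U" by (fact inU)
  qed
qed

lemma smooth_fun_chart: "(V, \<phi>) \<in> A \<Longrightarrow> smooth_fun A V \<phi>"
  using mfd unfolding smooth_manifold_with_boundary_def smooth_fun_def by (fastforce simp: Int_commute)

lemma transition_rep:
  assumes "(V, \<phi>) \<in> A" "(V', \<phi>') \<in> A" "p \<in> V" "p \<in> V'"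
  obtains W \<tau> where "\<phi>' p \<in> W" "rep V' \<phi>' W \<phi> \<tau>" "\<And>q. q \<in> V' \<Longrightarrow> \<phi>' q \<in> W \<Longrightarrow> q \<in> V"
  using smooth_fun_rep[OF smooth_fun_chart[OF assms(1)] chart_open[OF assms(1)] assms(2,3,4)] by metis

abbreviation smooth_near :: "'a set \<Rightarrow> ('a \<Rightarrow> 'b::real_normed_vector) \<Rightarrow> 'a \<Rightarrow> bool" where
  "smooth_near U f p \<equiv> \<exists>V \<phi> W F. (V, \<phi>) \<in> A \<and> p \<in> V \<and> \<phi> p \<in> W \<and> Cinf_on W F \<and>
      (\<forall>q\<in>V \<inter> U. \<phi> q \<in> W \<longrightarrow> F (\<phi> q) = f q)"

text \<open>One chart around each point suffices, since coordinate changes are smooth.\<close>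

lemma smooth_funI:
  assumes "\<And>p. p \<in> U \<Longrightarrow> smooth_near U f p"
  shows "smooth_fun A U f"
  unfolding smooth_fun_def
proof clarify
  fix V' \<phi>' assume c': "(V', \<phi>') \<in> A"
  show "smooth_on (\<phi>' ` (U \<inter> V')) (f \<circ> inv_into V' \<phi>')"
    unfolding smooth_on_def
  proof clarify
    fix p assume p: "p \<in> U" "p \<in> V'"
    obtain V \<phi> W F where c: "(V, \<phi>) \<in> A" "p \<in> V" and F: "\<phi> p \<in> W" "Cinf_on W F"
      "\<And>q. q \<in> V \<inter> U \<Longrightarrow> \<phi> q \<in> W \<Longrightarrow> F (\<phi> q) = f q"
      using assms[OF p(1)] by blast
    obtain W1 \<tau> where \<tau>: "\<phi>' p \<in> W1" "rep V' \<phi>' W1 \<phi> \<tau>" "\<And>q. q \<in> V' \<Longrightarrow> \<phi>' q \<in> W1 \<Longrightarrow> q \<in> V"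
      using transition_rep[OF c(1) c' c(2) p(2)] by metis
    have "open (W1 \<inter> \<tau> -` W)"
      by (intro continuous_open_preimage Cinf_on_continuous rep_Cinf[OF \<tau>(2)] rep_open[OF \<tau>(2)] Cinf_on_open[OF F(2)])
    then have "Cinf_on (W1 \<inter> \<tau> -` W) (\<lambda>y. F (\<tau> y))"
      by (intro Cinf_on_compose[OF F(2)] Cinf_on_subset[OF rep_Cinf[OF \<tau>(2)]]) auto
    moreover have "\<tau> (\<phi>' p) = \<phi> p" using rep_eq[OF \<tau>(2) p(2) \<tau>(1)] .
    moreover have "F (\<tau> y) = (f \<circ> inv_into V' \<phi>') y" if y: "y \<in> (W1 \<inter> \<tau> -` W) \<inter> \<phi>' ` (U \<inter> V')" for y
    proof -
      obtain q where q: "y = \<phi>' q" "q \<in> U" "q \<in> V'" using y by blast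
      then have "\<tau> y = \<phi> q" "q \<in> V" using rep_eq[OF \<tau>(2), of q] \<tau>(3)[of q] y by auto
      then show ?thesis using F(3)[of q] q y chart_inv[OF c' q(3)] by auto
    qed
    ultimately show "\<exists>W F. open W \<and> \<phi>' p \<in> W \<and> (\<forall>k. Ck_on k W F) \<and>
        (\<forall>y\<in>W \<inter> \<phi>' ` (U \<inter> V'). F y = (f \<circ> inv_into V' \<phi>') y)"
      using F(1) \<tau>(1) unfolding Cinf_on_def
      by (intro exI[of _ "W1 \<inter> \<tau> -` W"] exI[of _ "\<lambda>y. F (\<tau> y)"]) auto
  qed
qed

lemma smooth_fun_subset:
  assumes "smooth_fun A U f" "open U" "O' \<subseteq> U"
  shows "smooth_fun A O' f"
proof (rule smooth_funI)
  fix p assume p: "p \<in> O'"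
  obtain V \<phi> where c: "(V, \<phi>) \<in> A" "p \<in> V" using chart_cover by blast
  obtain W F where "\<phi> p \<in> W" "rep V \<phi> W f F"
    using smooth_fun_rep[OF assms(1,2) c(1) subsetD[OF assms(3) p] c(2)] by metis
  then show "smooth_near O' f p"
    using c by (intro exI[of _ V] exI[of _ \<phi>] exI[of _ W] exI[of _ F]) (auto simp: rep_def)
qed

lemma rep_transfer:
  assumes \<tau>: "rep V' \<phi>' W1 \<phi> \<tau>" "\<And>q. q \<in> V' \<Longrightarrow> \<phi>' q \<in> W1 \<Longrightarrow> q \<in> V" and F: "rep V \<phi> W f F"
  shows "rep V' \<phi>' (W1 \<inter> \<tau> -` W) f (\<lambda>x. F (\<tau> x))"
proof -
  have "open (W1 \<inter> \<tau> -` W)"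
    by (intro continuous_open_preimage Cinf_on_continuous rep_Cinf[OF \<tau>(1)] rep_open[OF \<tau>(1)] rep_open[OF F])
  then have "Cinf_on (W1 \<inter> \<tau> -` W) (\<lambda>y. F (\<tau> y))"
    by (intro Cinf_on_compose[OF rep_Cinf[OF F]] Cinf_on_subset[OF rep_Cinf[OF \<tau>(1)]]) auto
  then show ?thesis
    unfolding rep_def using \<tau> rep_eq[OF F] rep_eq[OF \<tau>(1)] rep_image[OF \<tau>(1)] by (auto 4 3)
qed

lemma chart_at:
  assumes "chart_at A p = (V, \<phi>)"
  shows "(V, \<phi>) \<in> A" "p \<in> V"
proof -
  have "\<exists>c. c \<in> A \<and> p \<in> fst c" using chart_cover[of p] by fastforce
  then have "chart_at A p \<in> A \<and> p \<in> fst (chart_at A p)" unfolding chart_at_def by (rule someI_ex)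
  then show "(V, \<phi>) \<in> A" "p \<in> V" using assms by auto
qed

lemma dd_chart_at:
  assumes "chart_at A p = (V, \<phi>)" "rep V \<phi> W f F" "\<phi> p \<in> W"
  shows "dd A f p = fd F (\<phi> p)"
proof -
  note c = chart_at[OF assms(1)]
  have "frechet_derivative (f \<circ> inv_into V \<phi>) (at (\<phi> p) within halfspace) = fd F (\<phi> p)"
  proof (rule frechet_derivative_within_halfspace[OF _ rep_open[OF assms(2)] assms(3)])
    show "\<phi> p \<in> halfspace" by (rule chart_halfspace[OF c])
    show "(F has_derivative fd F (\<phi> p)) (at (\<phi> p))"
      by (rule Cinf_on_has_derivative[OF rep_Cinf[OF assms(2)] assms(3)])
    show "(f \<circ> inv_into V \<phi>) y = F y" if "y \<in> W" "y \<in> halfspace" for y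
      using chart_inv'[OF rep_image[OF assms(2) that]] rep_eq[OF assms(2), of "inv_into V \<phi> y"] that by auto
  qed
  then show ?thesis using assms(1) by (auto simp: dd_def fun_eq_iff)
qed

text \<open>The chain rule for the coordinate change from the chart that represents tangent vectors at \<open>p\<close>.\<close>

lemma dd_rep:
  assumes c: "(V, \<phi>) \<in> A" "p \<in> V" and F: "rep V \<phi> W f F" "\<phi> p \<in> W"
  shows "dd A f p v = fd F (\<phi> p) (dd A \<phi> p v)"
proof -
  obtain V' \<phi>' where c': "chart_at A p = (V', \<phi>')" by (cases "chart_at A p")
  obtain W1 \<tau> where \<tau>: "\<phi>' p \<in> W1" "rep V' \<phi>' W1 \<phi> \<tau>" "\<And>q. q \<in> V' \<Longrightarrow> \<phi>' q \<in> W1 \<Longrightarrow> q \<in> V"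
    using transition_rep[OF c(1) chart_at(1)[OF c'] c(2) chart_at(2)[OF c']] by metis
  have \<tau>p: "\<tau> (\<phi>' p) = \<phi> p" using rep_eq[OF \<tau>(2) chart_at(2)[OF c'] \<tau>(1)] .
  have "dd A f p = fd (\<lambda>x. F (\<tau> x)) (\<phi>' p)"
    by (rule dd_chart_at[OF c' rep_transfer[OF \<tau>(2,3) F(1)]]) (use \<tau> \<tau>p F in auto)
  also have "\<dots> = (\<lambda>v. fd F (\<phi> p) (fd \<tau> (\<phi>' p) v))"
    by (rule fd_eq)
      (use has_derivative_compose[OF Cinf_on_has_derivative[OF rep_Cinf[OF \<tau>(2)] \<tau>(1)], of F]
        Cinf_on_has_derivative[OF rep_Cinf[OF F(1)] F(2)] \<tau>p in simp)
  also have "fd \<tau> (\<phi>' p) = dd A \<phi> p" using dd_chart_at[OF c' \<tau>(2,1)] by simp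
  finally show ?thesis by simp
qed

lemma dd_linear:
  assumes "smooth_fun A U f" "open U" "p \<in> U"
  shows "linear (dd A f p)"
proof -
  obtain V' \<phi>' where c': "chart_at A p = (V', \<phi>')" by (cases "chart_at A p")
  obtain W F where "\<phi>' p \<in> W" "rep V' \<phi>' W f F"
    using smooth_fun_rep[OF assms(1,2) chart_at(1)[OF c'] assms(3) chart_at(2)[OF c']] by metis
  then show ?thesis using dd_chart_at[OF c'] fd_linear[OF rep_Cinf] by metis
qed

lemma chart_dd_linear: "(V, \<phi>) \<in> A \<Longrightarrow> p \<in> V \<Longrightarrow> linear (dd A \<phi> p)"
  using dd_linear smooth_fun_chart chart_open by blast

lemma rep_ident: "(V, \<phi>) \<in> A \<Longrightarrow> \<exists>W. \<phi> ` V \<subseteq> W \<and> rep V \<phi> W \<phi> (\<lambda>x. x)"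
proof -
  assume c: "(V, \<phi>) \<in> A"
  obtain W where "open W" "\<phi> ` V = W \<inter> halfspace"
    using chart_image_open[OF c chart_open[OF c]] by auto
  then show ?thesis by (intro exI[of _ W]) (auto simp: rep_def Cinf_on_ident)
qed

lemma chart_at_dd:
  assumes "chart_at A p = (V, \<phi>)"
  shows "dd A \<phi> p v = v"
proof -
  obtain W where "\<phi> ` V \<subseteq> W" "rep V \<phi> W \<phi> (\<lambda>x. x)" using rep_ident[OF chart_at(1)[OF assms]] by blast
  then show ?thesis
    using dd_chart_at[OF assms, of W \<phi> "\<lambda>x. x"] chart_at(2)[OF assms] by (auto simp: frechet_derivative_ident)
qed

text \<open>The differential of the inverse coordinate change is a left inverse.\<close>

lemma chart_dd_bij:
  assumes c: "(V, \<phi>) \<in> A" "p \<in> V"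
  shows "bij (dd A \<phi> p)"
proof -
  obtain V' \<phi>' where c': "chart_at A p = (V', \<phi>')" by (cases "chart_at A p")
  obtain W \<sigma> where \<sigma>: "\<phi> p \<in> W" "rep V \<phi> W \<phi>' \<sigma>"
    using transition_rep[OF chart_at(1)[OF c'] c(1) chart_at(2)[OF c'] c(2)] by metis
  have "fd \<sigma> (\<phi> p) (dd A \<phi> p v) = v" for v
    using dd_rep[OF c \<sigma>(2,1), of v] chart_at_dd[OF c'] by simp
  then have "inj (dd A \<phi> p)" by (metis injI)
  then show ?thesis
    using linear_injective_imp_surjective[OF chart_dd_linear[OF c]] by (simp add: bij_def)
qed

definition from_coords :: "('a \<Rightarrow> real^'n) \<Rightarrow> 'a \<Rightarrow> real^'n \<Rightarrow> real^'n" where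
  "from_coords \<phi> p = inv (dd A \<phi> p)"

lemma dd_from_coords: "(V, \<phi>) \<in> A \<Longrightarrow> p \<in> V \<Longrightarrow> dd A \<phi> p (from_coords \<phi> p v) = v"
  and from_coords_dd: "(V, \<phi>) \<in> A \<Longrightarrow> p \<in> V \<Longrightarrow> from_coords \<phi> p (dd A \<phi> p v) = v"
  unfolding from_coords_def
  by (meson bij_inv_eq_iff chart_dd_bij, meson bij_is_inj chart_dd_bij inv_f_f)

lemma dd_chart_cancel: "(V, \<phi>) \<in> A \<Longrightarrow> p \<in> V \<Longrightarrow> dd A \<phi> p v = dd A \<phi> p w \<longleftrightarrow> v = w"
  by (metis from_coords_dd)

section \<open>The boundary\<close>

text \<open>A coordinate change cannot send a boundary point into the open half-space: otherwise the normal
  coordinate of the other chart would attain its minimum at an interior point of the domain, so the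
  differential of the coordinate change would not be surjective.\<close>

lemma bdry_iff:
  assumes c: "(V, \<phi>) \<in> A" "p \<in> V"
  shows "p \<in> bdry A \<longleftrightarrow> \<phi> p $ bidx = 0"
proof
  assume "p \<in> bdry A"
  then obtain V' \<phi>' where c': "(V', \<phi>') \<in> A" "p \<in> V'" and 0: "\<phi>' p $ bidx = 0"
    by (auto simp: bdry_def)
  obtain W \<tau> where \<tau>: "\<phi> p \<in> W" "rep V \<phi> W \<phi>' \<tau>" "\<And>q. q \<in> V \<Longrightarrow> \<phi> q \<in> W \<Longrightarrow> q \<in> V'"
    using transition_rep[OF c'(1) c(1) c'(2) c(2)] by metis
  show "\<phi> p $ bidx = 0"
  proof (rule ccontr)
    assume "\<phi> p $ bidx \<noteq> 0"
    then have pos: "\<phi> p $ bidx > 0" using chart_halfspace[OF c] by (auto simp: halfspace_def)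
    let ?O = "W \<inter> {x. x $ bidx > 0}"
    have "open ?O" by (intro open_Int rep_open[OF \<tau>(2)] open_Collect_less continuous_intros)
    have "((\<lambda>x. \<tau> x $ bidx) has_derivative (\<lambda>v. fd \<tau> (\<phi> p) v $ bidx)) (at (\<phi> p))"
      by (rule bounded_linear.has_derivative[OF bounded_linear_vec_nth Cinf_on_has_derivative[OF rep_Cinf[OF \<tau>(2)] \<tau>(1)]])
    moreover have "\<tau> (\<phi> p) $ bidx \<le> \<tau> x $ bidx" if x: "x \<in> ?O" for x
    proof -
      have "x \<in> \<phi> ` V" using rep_image[OF \<tau>(2)] x by (auto simp: halfspace_def)
      then obtain q where "x = \<phi> q" "q \<in> V" by blast
      then have "\<tau> x = \<phi>' q" "q \<in> V'" using rep_eq[OF \<tau>(2)] \<tau>(3) x by auto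
      then show ?thesis using rep_eq[OF \<tau>(2) c(2) \<tau>(1)] 0 chart_halfspace[OF c'(1)] by (auto simp: halfspace_def)
    qed
    ultimately have "(\<lambda>v. fd \<tau> (\<phi> p) v $ bidx) = (\<lambda>v. 0)"
      using differential_zero_maxmin[of "\<phi> p" ?O "\<lambda>x. \<tau> x $ bidx"] \<open>open ?O\<close> pos \<tau>(1) by blast
    then have "dd A \<phi>' p v $ bidx = 0" for v
      using dd_rep[OF c \<tau>(2,1)] by metis
    then show False using dd_from_coords[OF c', of "axis bidx 1"] by (metis axis_nth zero_neq_one)
  qed
next
  assume "\<phi> p $ bidx = 0" then show "p \<in> bdry A" using c by (auto simp: bdry_def)
qed

lemma open_interior: "open (- bdry A)"
proof (subst open_subopen, intro ballI)
  fix p assume p: "p \<in> - bdry A"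
  obtain V \<phi> where c: "(V, \<phi>) \<in> A" "p \<in> V" using chart_cover by blast
  have "open (V \<inter> \<phi> -` {x. x $ bidx > 0})"
    by (intro chart_preimage_open[OF c(1)] open_Collect_less continuous_intros)
  moreover have "p \<in> V \<inter> \<phi> -` {x. x $ bidx > 0}"
    using c p bdry_iff[OF c] chart_halfspace[OF c] by (auto simp: halfspace_def)
  moreover have "V \<inter> \<phi> -` {x. x $ bidx > 0} \<subseteq> - bdry A"
    using bdry_iff[OF c(1)] by auto
  ultimately show "\<exists>T. open T \<and> p \<in> T \<and> T \<subseteq> - bdry A" by blast
qed

lemma vanish_bdry_derivative:
  fixes F :: "real^'n \<Rightarrow> 'b::real_normed_vector"
  assumes F: "Cinf_on W F" and x: "x \<in> W" "x $ bidx = 0"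
    and 0: "\<And>y. y \<in> W \<Longrightarrow> y $ bidx = 0 \<Longrightarrow> F y = 0" and v: "v $ bidx = 0"
  shows "fd F x v = 0"
proof -
  have line: "((\<lambda>t::real. x + t *\<^sub>R v) has_derivative (\<lambda>t. t *\<^sub>R v)) (at 0)"
    by (auto intro!: derivative_eq_intros)
  have "((\<lambda>t. F (x + t *\<^sub>R v)) has_derivative (\<lambda>t. fd F x (t *\<^sub>R v))) (at 0)"
    using has_derivative_compose[OF line, of F] Cinf_on_has_derivative[OF F x(1)] by simp
  moreover have "((\<lambda>t::real. F (x + t *\<^sub>R v)) has_derivative (\<lambda>t. 0)) (at 0)"
  proof (rule has_derivative_transform_within_open[OF has_derivative_const])
    show "open ((\<lambda>t::real. x + t *\<^sub>R v) -` W)"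
      by (intro open_vimage Cinf_on_open[OF F] continuous_intros)
  qed (use x v 0 in auto)
  ultimately have "(\<lambda>t. fd F x (t *\<^sub>R v)) = (\<lambda>t. 0)" by (rule has_derivative_unique)
  then show ?thesis by (metis scaleR_one)
qed

text \<open>The normal coordinate of one chart vanishes on the bounding hyperplane of the other, so it has zero
  derivative in the directions of that hyperplane. Both directions of the equivalence are instances
  of this, for a coordinate change and for its inverse.\<close>

lemma tangent_bdry_iff:
  assumes c: "(V, \<phi>) \<in> A" "p \<in> V" and p: "p \<in> bdry A"
  shows "v \<in> tangent_bdry A p \<longleftrightarrow> dd A \<phi> p v $ bidx = 0"
proof -
  obtain V' \<phi>' where c': "chart_at A p = (V', \<phi>')" by (cases "chart_at A p")
  note c'' = chart_at[OF c']
  have key: "fd \<tau> (\<psi> p) v $ bidx = 0"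
    if "(V1, \<psi>) \<in> A" "(V2, \<psi>') \<in> A" "p \<in> V1" "p \<in> V2" "\<psi> p \<in> W" "rep V1 \<psi> W \<psi>' \<tau>"
      "\<And>q. q \<in> V1 \<Longrightarrow> \<psi> q \<in> W \<Longrightarrow> q \<in> V2" "v $ bidx = 0" for V1 \<psi> V2 \<psi>' W \<tau> v
  proof -
    have "fd (\<lambda>x. \<tau> x $ bidx) (\<psi> p) v = 0"
    proof (rule vanish_bdry_derivative[OF Cinf_on_vec_nth[OF rep_Cinf[OF that(6)]] that(5)])
      show "\<psi> p $ bidx = 0" using bdry_iff that p by blast
      show "\<tau> y $ bidx = 0" if y: "y \<in> W" "y $ bidx = 0" for y
      proof -
        have "y \<in> \<psi> ` V1" using rep_image[OF \<open>rep V1 \<psi> W \<psi>' \<tau>\<close>, of y] y by (auto simp: halfspace_def)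
        then obtain q where q: "y = \<psi> q" "q \<in> V1" by blast
        then have "q \<in> bdry A" using bdry_iff \<open>(V1, \<psi>) \<in> A\<close> y by blast
        moreover have "q \<in> V2" "\<tau> y = \<psi>' q" using q y \<open>\<And>q. q \<in> V1 \<Longrightarrow> \<psi> q \<in> W \<Longrightarrow> q \<in> V2\<close> rep_eq[OF \<open>rep V1 \<psi> W \<psi>' \<tau>\<close>] by auto
        ultimately show ?thesis using bdry_iff \<open>(V2, \<psi>') \<in> A\<close> by auto
      qed
    qed (fact that(8))
    then show ?thesis
      using fd_bounded_linear[OF bounded_linear_vec_nth rep_Cinf[OF that(6)] that(5)] by metis
  qed
  obtain W1 \<tau> where \<tau>: "\<phi>' p \<in> W1" "rep V' \<phi>' W1 \<phi> \<tau>" "\<And>q. q \<in> V' \<Longrightarrow> \<phi>' q \<in> W1 \<Longrightarrow> q \<in> V"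
    using transition_rep[OF c(1) c''(1) c(2) c''(2)] by metis
  obtain W2 \<sigma> where \<sigma>: "\<phi> p \<in> W2" "rep V \<phi> W2 \<phi>' \<sigma>" "\<And>q. q \<in> V \<Longrightarrow> \<phi> q \<in> W2 \<Longrightarrow> q \<in> V'"
    using transition_rep[OF c''(1) c(1) c''(2) c(2)] by metis
  have 1: "fd \<sigma> (\<phi> p) (dd A \<phi> p v) = v"
    using dd_rep[OF c \<sigma>(2,1), of v] chart_at_dd[OF c'] by simp
  have 2: "dd A \<phi> p v = fd \<tau> (\<phi>' p) v" using dd_chart_at[OF c' \<tau>(2,1)] by simp
  show ?thesis
    unfolding tangent_bdry_def mem_Collect_eq
  proof
    show "dd A \<phi> p v $ bidx = 0" if "v $ bidx = 0"
      unfolding 2 by (rule key[OF c''(1) c(1) c''(2) c(2) \<tau>(1,2) _ that]) (rule \<tau>(3))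
    show "v $ bidx = 0" if "dd A \<phi> p v $ bidx = 0"
      by (subst 1[symmetric], rule key[OF c(1) c''(1) c(2) c''(2) \<sigma>(1,2) _ that]) (rule \<sigma>(3))
  qed
qed

end

section \<open>Vector fields and tensors in coordinates\<close>

context manifold_with_boundary begin

abbreviation comps :: "('a \<Rightarrow> real^'n) \<Rightarrow> ('a \<Rightarrow> real^'n) \<Rightarrow> 'a \<Rightarrow> real^'n" where
  "comps \<phi> \<xi> \<equiv> \<lambda>q. dd A \<phi> q (\<xi> q)"

lemma vf_rep:
  assumes \<xi>: "\<xi> \<in> vector_fields A U" and U: "open U" and c: "(V, \<phi>) \<in> A" and p: "p \<in> U" "p \<in> V"
  obtains W X where "\<phi> p \<in> W" "rep V \<phi> W (comps \<phi> \<xi>) X" "\<And>q. q \<in> V \<Longrightarrow> \<phi> q \<in> W \<Longrightarrow> q \<in> U"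
proof -
  have "smooth_fun A (U \<inter> V) (comps \<phi> \<xi>)" using \<xi> c unfolding vector_fields_def by blast
  from smooth_fun_rep[OF this open_Int[OF U chart_open[OF c]] c _ p(2)] p
  show thesis using that by (metis IntI IntD1)
qed

abbreviation vf_near :: "'a set \<Rightarrow> ('a \<Rightarrow> real^'n) \<Rightarrow> 'a \<Rightarrow> bool" where
  "vf_near U \<xi> p \<equiv> \<exists>V \<phi> W X. (V, \<phi>) \<in> A \<and> p \<in> V \<and> \<phi> p \<in> W \<and> Cinf_on W X \<and>
      (\<forall>q\<in>V \<inter> U. \<phi> q \<in> W \<longrightarrow> X (\<phi> q) = dd A \<phi> q (\<xi> q))"

lemma vfI:
  assumes "\<And>p. p \<in> U \<Longrightarrow> vf_near U \<xi> p"
  shows "\<xi> \<in> vector_fields A U"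
  unfolding vector_fields_def mem_Collect_eq
proof clarify
  fix V' \<phi>' assume c': "(V', \<phi>') \<in> A"
  show "smooth_fun A (U \<inter> V') (comps \<phi>' \<xi>)"
  proof (rule smooth_funI)
    fix p assume p: "p \<in> U \<inter> V'"
    then obtain V \<phi> W X where c: "(V, \<phi>) \<in> A" "p \<in> V" and X: "\<phi> p \<in> W" "Cinf_on W X"
        "\<And>q. q \<in> V \<inter> U \<Longrightarrow> \<phi> q \<in> W \<Longrightarrow> X (\<phi> q) = dd A \<phi> q (\<xi> q)"
      using assms[of p] by blast
    obtain W1 \<sigma> where \<sigma>: "\<phi> p \<in> W1" "rep V \<phi> W1 \<phi>' \<sigma>"
      using transition_rep[OF c' c(1) _ c(2)] p by (metis IntD2)
    show "smooth_near (U \<inter> V') (\<lambda>q. dd A \<phi>' q (\<xi> q)) p"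
    proof (intro exI conjI ballI impI)
      have op: "open (W1 \<inter> W)" using rep_open[OF \<sigma>(2)] Cinf_on_open[OF X(2)] by auto
      show "Cinf_on (W1 \<inter> W) (\<lambda>x. fd \<sigma> x (X x))"
        by (rule Cinf_on_fd[OF Cinf_on_subset[OF rep_Cinf[OF \<sigma>(2)] op] Cinf_on_subset[OF X(2) op]]) auto
      show "fd \<sigma> (\<phi> q) (X (\<phi> q)) = dd A \<phi>' q (\<xi> q)" if "q \<in> V \<inter> (U \<inter> V')" "\<phi> q \<in> W1 \<inter> W" for q
        using dd_rep[OF c(1) _ \<sigma>(2)] X(3)[of q] that by auto
    qed (use c X \<sigma> in auto)
  qed
qed

lemma vf_subset:
  assumes "\<xi> \<in> vector_fields A U" "open U" "O' \<subseteq> U"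
  shows "\<xi> \<in> vector_fields A O'"
proof (rule vfI)
  fix p assume p: "p \<in> O'"
  obtain V \<phi> where c: "(V, \<phi>) \<in> A" "p \<in> V" using chart_cover by blast
  obtain W X where "\<phi> p \<in> W" "rep V \<phi> W (comps \<phi> \<xi>) X"
    using vf_rep[OF assms(1,2) c(1) subsetD[OF assms(3) p] c(2)] by metis
  then show "vf_near O' \<xi> p"
    using c by (intro exI[of _ V] exI[of _ \<phi>] exI[of _ W] exI[of _ X]) (auto simp: rep_def)
qed

lemma rep_dd:
  assumes c: "(V, \<phi>) \<in> A" and "rep V \<phi> W f F" "rep V \<phi> W (comps \<phi> \<xi>) X"
  shows "rep V \<phi> W (\<lambda>q. dd A f q (\<xi> q)) (\<lambda>x. fd F x (X x))"
  using assms(2,3) dd_rep[OF c _ assms(2)] by (auto simp: rep_def intro: Cinf_on_fd)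

lemma smooth_fun_local:
  assumes "\<And>p. p \<in> U \<Longrightarrow> \<exists>O' f'. open O' \<and> p \<in> O' \<and> smooth_fun A O' f' \<and> (\<forall>q\<in>O' \<inter> U. f' q = f q)"
  shows "smooth_fun A U f"
proof (rule smooth_funI)
  fix p assume p: "p \<in> U"
  obtain O' f' where O': "open O'" "p \<in> O'" "smooth_fun A O' f'" "\<And>q. q \<in> O' \<inter> U \<Longrightarrow> f' q = f q"
    using assms[OF p] by blast
  obtain V \<phi> where c: "(V, \<phi>) \<in> A" "p \<in> V" using chart_cover by blast
  obtain W F where W: "\<phi> p \<in> W" "rep V \<phi> W f' F" "\<And>q. q \<in> V \<Longrightarrow> \<phi> q \<in> W \<Longrightarrow> q \<in> O'"
    using smooth_fun_rep[OF O'(3,1) c(1) O'(2) c(2)] by metis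
  then show "smooth_near U f p"
    using c O'(4) by (intro exI[of _ V] exI[of _ \<phi>] exI[of _ W] exI[of _ F]) (auto simp: rep_def)
qed

lemma vf_local:
  assumes "\<And>p. p \<in> U \<Longrightarrow> \<exists>O' \<xi>'. open O' \<and> p \<in> O' \<and> \<xi>' \<in> vector_fields A O' \<and> (\<forall>q\<in>O' \<inter> U. \<xi>' q = \<xi> q)"
  shows "\<xi> \<in> vector_fields A U"
proof (rule vfI)
  fix p assume p: "p \<in> U"
  obtain O' \<xi>' where O': "open O'" "p \<in> O'" "\<xi>' \<in> vector_fields A O'" "\<And>q. q \<in> O' \<inter> U \<Longrightarrow> \<xi>' q = \<xi> q"
    using assms[OF p] by blast
  obtain V \<phi> where c: "(V, \<phi>) \<in> A" "p \<in> V" using chart_cover by blast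
  obtain W X where W: "\<phi> p \<in> W" "rep V \<phi> W (comps \<phi> \<xi>') X" "\<And>q. q \<in> V \<Longrightarrow> \<phi> q \<in> W \<Longrightarrow> q \<in> O'"
    using vf_rep[OF O'(3,1) c(1) O'(2) c(2)] by metis
  then show "vf_near U \<xi> p"
    using c O'(4) by (intro exI[of _ V] exI[of _ \<phi>] exI[of _ W] exI[of _ X]) (auto simp: rep_def)
qed

lemma smooth_fun_of_coords:
  assumes "(V, \<phi>) \<in> A" "Cinf_on W F"
  shows "smooth_fun A (V \<inter> \<phi> -` W) (\<lambda>q. F (\<phi> q))"
  by (rule smooth_funI) (use assms in \<open>auto intro!: exI[of _ V] exI[of _ \<phi>] exI[of _ W] exI[of _ F]\<close>)

lemma vf_of_coords:
  assumes "(V, \<phi>) \<in> A" "Cinf_on W X"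
  shows "(\<lambda>q. from_coords \<phi> q (X (\<phi> q))) \<in> vector_fields A (V \<inter> \<phi> -` W)"
  by (rule vfI) (use assms in \<open>auto simp: dd_from_coords intro!: exI[of _ V] exI[of _ \<phi>] exI[of _ W] exI[of _ X]\<close>)

lemma smooth_fun_vec:
  fixes f :: "'i::finite \<Rightarrow> 'a \<Rightarrow> 'b::euclidean_space"
  assumes "\<And>i. smooth_fun A U (f i)" "open U"
  shows "smooth_fun A U (\<lambda>q. \<chi> i. f i q)"
proof (rule smooth_funI)
  fix p assume p: "p \<in> U"
  obtain V \<phi> where c: "(V, \<phi>) \<in> A" "p \<in> V" using chart_cover by blast
  have "\<exists>W F. \<phi> p \<in> W \<and> rep V \<phi> W (f i) F" for i
    using smooth_fun_rep[OF assms(1)[of i] assms(2) c(1) p c(2)] by metis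
  then obtain W F where W: "\<And>i. \<phi> p \<in> W i" "\<And>i. rep V \<phi> (W i) (f i) (F i)" by metis
  have op: "open (\<Inter>i. W i)" using rep_open[OF W(2)] by (intro open_INT) auto
  show "smooth_near U (\<lambda>q. (\<chi> i. f i q)) p"
  proof (intro exI conjI ballI impI)
    show "Cinf_on (\<Inter>i. W i) (\<lambda>x. \<chi> i. F i x)"
      by (intro Cinf_on_vec_lambda Cinf_on_subset[OF rep_Cinf[OF W(2)] op]) auto
    show "(\<chi> i. F i (\<phi> q)) = (\<chi> i. f i q)" if "q \<in> V \<inter> U" "\<phi> q \<in> (\<Inter>i. W i)" for q
      using rep_eq[OF W(2)] that by (auto simp: vec_eq_iff)
  qed (use c W in auto)
qed

lemma bilinear_axis_expansion:
  fixes b :: "real^'n \<Rightarrow> real^'n \<Rightarrow> real" and L K :: "real^'n \<Rightarrow> real^'n"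
  assumes "bilinear b" "linear L" "linear K"
  shows "b (L v) (K w) = v \<bullet> ((\<chi> i j. b (L (axis i 1)) (K (axis j 1))) *v w)"
proof -
  have v: "v = (\<Sum>i\<in>UNIV. v $ i *\<^sub>R axis i 1)" for v :: "real^'n"
    by (simp add: vec_eq_iff axis_def if_distrib cong: if_cong)
  have "b (L v) (K w) = b (\<Sum>i\<in>UNIV. v $ i *\<^sub>R L (axis i 1)) (\<Sum>j\<in>UNIV. w $ j *\<^sub>R K (axis j 1))"
    by (subst v[of v], subst v[of w]) (simp add: linear_sum[OF assms(2)] linear_sum[OF assms(3)] linear_scale[OF assms(2)] linear_scale[OF assms(3)])
  also have "\<dots> = (\<Sum>i\<in>UNIV. \<Sum>j\<in>UNIV. v $ i * (w $ j * b (L (axis i 1)) (K (axis j 1))))"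
    by (simp add: bilinear_sum[OF assms(1)] bilinear_lmul[OF assms(1)] bilinear_rmul[OF assms(1)] sum.cartesian_product mult.left_commute)
  also have "\<dots> = v \<bullet> ((\<chi> i j. b (L (axis i 1)) (K (axis j 1))) *v w)"
    by (simp add: inner_vec_def matrix_vector_mult_def sum_distrib_left mult.commute mult.left_commute)
  finally show ?thesis .
qed

lemma from_coords_linear:
  assumes c: "(V, \<phi>) \<in> A" "p \<in> V"
  shows "linear (from_coords \<phi> p)"
  by (rule linearI; subst dd_chart_cancel[OF c, symmetric])
    (simp_all add: dd_from_coords[OF c] linear_add[OF chart_dd_linear[OF c]] linear_scale[OF chart_dd_linear[OF c]])

definition gram :: "('a \<Rightarrow> real^'n \<Rightarrow> real^'n \<Rightarrow> real) \<Rightarrow> ('a \<Rightarrow> real^'n) \<Rightarrow> 'a \<Rightarrow> real^'n^'n" where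
  "gram b \<phi> q = (\<chi> i j. b q (from_coords \<phi> q (axis i 1)) (from_coords \<phi> q (axis j 1)))"

lemma gram_eq:
  assumes "bilinear (b q)" "(V, \<phi>) \<in> A" "q \<in> V"
  shows "b q v w = dd A \<phi> q v \<bullet> (gram b \<phi> q *v dd A \<phi> q w)"
  using bilinear_axis_expansion[OF assms(1) from_coords_linear[OF assms(2,3)] from_coords_linear[OF assms(2,3)],
      of "dd A \<phi> q v" "dd A \<phi> q w"]
  by (simp add: from_coords_dd[OF assms(2,3)] gram_def)

lemma smooth_fun_gram:
  assumes b: "smooth_sym_tensor A U b" and U: "open U" and c: "(V, \<phi>) \<in> A"
  shows "smooth_fun A (U \<inter> V) (gram b \<phi>)"
  unfolding gram_def
proof (intro smooth_fun_vec open_Int U chart_open[OF c])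
  fix i j
  have vf: "(\<lambda>q. from_coords \<phi> q (axis i 1)) \<in> vector_fields A (U \<inter> V)" for i
    by (rule vf_subset[OF vf_of_coords[OF c Cinf_on_const[OF open_UNIV, of "axis i 1"]]]) (auto simp: chart_open[OF c])
  have "open (U \<inter> V)" "U \<inter> V \<subseteq> U" using U chart_open[OF c] by auto
  with b vf[of i] vf[of j] show "smooth_fun A (U \<inter> V) (\<lambda>q. b q (from_coords \<phi> q (axis i 1)) (from_coords \<phi> q (axis j 1)))"
    unfolding smooth_sym_tensor_def by blast
qed

section \<open>Uniqueness and gluing of extensions\<close>

text \<open>A boundary point is the limit of the interior points above it in the inward coordinate direction.\<close>

lemma smooth_fun_interior_unique:
  assumes F: "smooth_fun A U F" and G: "smooth_fun A U G" and U: "open U"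
    and eq: "\<And>q. q \<in> U - bdry A \<Longrightarrow> F q = G q" and p: "p \<in> U"
  shows "F p = G p"
proof (cases "p \<in> bdry A")
  case True
  obtain V \<phi> where c: "(V, \<phi>) \<in> A" "p \<in> V" using chart_cover by blast
  obtain W1 F' where F': "\<phi> p \<in> W1" "rep V \<phi> W1 F F'" "\<And>q. q \<in> V \<Longrightarrow> \<phi> q \<in> W1 \<Longrightarrow> q \<in> U"
    using smooth_fun_rep[OF F U c(1) p c(2)] by metis
  obtain W2 G' where G': "\<phi> p \<in> W2" "rep V \<phi> W2 G G'"
    using smooth_fun_rep[OF G U c(1) p c(2)] by metis
  let ?x = "\<lambda>t::real. \<phi> p + t *\<^sub>R axis bidx 1"
  have x: "((?x \<longlongrightarrow> \<phi> p) (at_right 0))"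
    by (auto intro!: tendsto_eq_intros)
  have lim: "((\<lambda>t. H (?x t)) \<longlongrightarrow> H (\<phi> p)) (at_right 0)" if "Cinf_on W H" "\<phi> p \<in> W" for W and H :: "real^'n \<Rightarrow> 'b"
    using Cinf_on_continuous[OF that(1)] Cinf_on_open[OF that(1)] that(2) x
    by (intro isCont_tendsto_compose[OF _ x]) (simp add: continuous_on_eq_continuous_at)
  have "\<forall>\<^sub>F t in at_right 0. ?x t \<in> W1 \<inter> W2"
    using rep_open[OF F'(2)] rep_open[OF G'(2)] F'(1) G'(1) by (intro topological_tendstoD[OF x]) auto
  moreover have "\<forall>\<^sub>F t in at_right 0. (0::real) < t"
    by (auto simp: eventually_at_filter)
  ultimately have "\<forall>\<^sub>F t in at_right 0. F' (?x t) = G' (?x t)"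
  proof eventually_elim
    case (elim t)
    have pos: "?x t $ bidx > 0"
      using elim chart_halfspace[OF c] by (auto simp: halfspace_def)
    then obtain q where q: "?x t = \<phi> q" "q \<in> V"
      using rep_image[OF F'(2), of "?x t"] elim by (auto simp: halfspace_def)
    then have "q \<in> U - bdry A" using F'(3)[of q] elim pos bdry_iff[OF c(1)] by auto
    then show ?case using q elim rep_eq[OF F'(2)] rep_eq[OF G'(2)] eq by auto
  qed
  then have "((\<lambda>t. F' (?x t)) \<longlongrightarrow> G' (\<phi> p)) (at_right 0)"
    using Lim_transform_eventually[OF lim[OF rep_Cinf[OF G'(2)] G'(1)]] by (simp add: eq_commute)
  then have "F' (\<phi> p) = G' (\<phi> p)"
    using tendsto_unique[OF _ lim[OF rep_Cinf[OF F'(2)] F'(1)]] by simp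
  then show ?thesis using rep_eq[OF F'(2) c(2) F'(1)] rep_eq[OF G'(2) c(2) G'(1)] by simp
qed (use p eq in auto)

text \<open>Local extensions agree where they overlap, so the extension chosen at each point may be evaluated
  at that point. The predicate \<open>Q\<close> transports a property of the boundary values.\<close>

lemma smooth_fun_glue:
  fixes f :: "'a \<Rightarrow> 'b::real_normed_vector"
  assumes "\<And>p. p \<in> U \<Longrightarrow> \<exists>O' F. open O' \<and> p \<in> O' \<and> smooth_fun A O' F \<and>
      (\<forall>q\<in>O' \<inter> U - bdry A. F q = f q) \<and> (\<forall>q\<in>O' \<inter> U \<inter> bdry A. Q (F q))" and U: "open U"
  shows "\<exists>F. smooth_fun A U F \<and> (\<forall>q\<in>U - bdry A. F q = f q) \<and> (\<forall>q\<in>U \<inter> bdry A. Q (F q))"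
proof -
  obtain O' F where O': "\<And>p. p \<in> U \<Longrightarrow> open (O' p) \<and> p \<in> O' p \<and> smooth_fun A (O' p) (F p) \<and>
      (\<forall>q\<in>O' p \<inter> U - bdry A. F p q = f q) \<and> (\<forall>q\<in>O' p \<inter> U \<inter> bdry A. Q (F p q))"
    using assms(1) by metis
  have eq: "F p q = F q q" if p: "p \<in> U" and q: "q \<in> O' p" "q \<in> U" for p q
  proof (rule smooth_fun_interior_unique[where F = "F p" and G = "F q" and U = "O' p \<inter> O' q \<inter> U"])
    show "smooth_fun A (O' p \<inter> O' q \<inter> U) (F p)" "smooth_fun A (O' p \<inter> O' q \<inter> U) (F q)"
      using O'[OF p] O'[OF q(2)] by (auto intro: smooth_fun_subset)
  qed (use O'[OF p] O'[OF q(2)] p q U in auto)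
  show ?thesis
  proof (intro exI conjI ballI)
    show "smooth_fun A U (\<lambda>q. F q q)"
      by (rule smooth_fun_local) (use O' eq in \<open>metis IntD1 IntD2\<close>)
  qed (use O' in auto)
qed

lemma vf_interior_unique:
  assumes \<xi>: "\<xi> \<in> vector_fields A U" and \<eta>: "\<eta> \<in> vector_fields A U" and U: "open U"
    and eq: "\<And>q. q \<in> U - bdry A \<Longrightarrow> \<xi> q = \<eta> q" and p: "p \<in> U"
  shows "\<xi> p = \<eta> p"
proof -
  obtain V \<phi> where c: "(V, \<phi>) \<in> A" "p \<in> V" using chart_cover by blast
  have "smooth_fun A (U \<inter> V) (comps \<phi> \<xi>)" "smooth_fun A (U \<inter> V) (comps \<phi> \<eta>)"
    using \<xi> \<eta> c unfolding vector_fields_def by auto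
  then have "dd A \<phi> p (\<xi> p) = dd A \<phi> p (\<eta> p)"
    by (rule smooth_fun_interior_unique[where F = "comps \<phi> \<xi>" and G = "comps \<phi> \<eta>"]) (use U chart_open[OF c(1)] eq p c in auto)
  then show ?thesis using dd_chart_cancel[OF c] by simp
qed

lemma vf_glue:
  assumes "\<And>p. p \<in> U \<Longrightarrow> \<exists>O' \<zeta>. open O' \<and> p \<in> O' \<and> \<zeta> \<in> vector_fields A O' \<and> (\<forall>q\<in>O' \<inter> U - bdry A. \<zeta> q = \<xi> q)"
    and U: "open U"
  shows "vector_field_extends A U \<xi>"
proof -
  obtain O' \<zeta> where O': "\<And>p. p \<in> U \<Longrightarrow> open (O' p) \<and> p \<in> O' p \<and> \<zeta> p \<in> vector_fields A (O' p) \<and>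
      (\<forall>q\<in>O' p \<inter> U - bdry A. \<zeta> p q = \<xi> q)"
    using assms(1) by metis
  have eq: "\<zeta> p q = \<zeta> q q" if p: "p \<in> U" and q: "q \<in> O' p" "q \<in> U" for p q
  proof (rule vf_interior_unique[where \<xi> = "\<zeta> p" and \<eta> = "\<zeta> q" and U = "O' p \<inter> O' q \<inter> U"])
    show "\<zeta> p \<in> vector_fields A (O' p \<inter> O' q \<inter> U)" "\<zeta> q \<in> vector_fields A (O' p \<inter> O' q \<inter> U)"
      using O'[OF p] O'[OF q(2)] by (auto intro: vf_subset)
  qed (use O'[OF p] O'[OF q(2)] p q U in auto)
  show ?thesis
    unfolding vector_field_extends_def
  proof (intro bexI ballI)
    show "(\<lambda>q. \<zeta> q q) \<in> vector_fields A U"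
      by (rule vf_local) (use O' eq in \<open>metis IntD1 IntD2\<close>)
  qed (use O' in auto)
qed

abbreviation vf_extends_near :: "'a set \<Rightarrow> ('a \<Rightarrow> real^'n) \<Rightarrow> 'a \<Rightarrow> bool" where
  "vf_extends_near U \<xi> p \<equiv> \<exists>V \<phi> W X. (V, \<phi>) \<in> A \<and> p \<in> V \<and> \<phi> p \<in> W \<and> Cinf_on W X \<and>
      (\<forall>q\<in>V \<inter> U - bdry A. \<phi> q \<in> W \<longrightarrow> X (\<phi> q) = dd A \<phi> q (\<xi> q))"

abbreviation fun_extends_near :: "('b::real_normed_vector \<Rightarrow> bool) \<Rightarrow> 'a set \<Rightarrow> ('a \<Rightarrow> 'b) \<Rightarrow> 'a \<Rightarrow> bool" where
  "fun_extends_near Q U f p \<equiv> \<exists>V \<phi> W F. (V, \<phi>) \<in> A \<and> p \<in> V \<and> \<phi> p \<in> W \<and> Cinf_on W F \<and>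
      (\<forall>q\<in>V \<inter> U - bdry A. \<phi> q \<in> W \<longrightarrow> F (\<phi> q) = f q) \<and> (\<forall>q\<in>V \<inter> U \<inter> bdry A. \<phi> q \<in> W \<longrightarrow> Q (F (\<phi> q)))"

lemma vf_extendsI:
  assumes "\<And>p. p \<in> U \<Longrightarrow> vf_extends_near U \<xi> p"
    and U: "open U"
  shows "vector_field_extends A U \<xi>"
proof (rule vf_glue[OF _ U])
  fix p assume "p \<in> U"
  then obtain V \<phi> W X where c: "(V, \<phi>) \<in> A" "p \<in> V" and X: "\<phi> p \<in> W" "Cinf_on W X"
      "\<And>q. q \<in> V \<inter> U - bdry A \<Longrightarrow> \<phi> q \<in> W \<Longrightarrow> X (\<phi> q) = dd A \<phi> q (\<xi> q)"
    using assms(1)[of p] by blast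
  show "\<exists>O' \<zeta>. open O' \<and> p \<in> O' \<and> \<zeta> \<in> vector_fields A O' \<and> (\<forall>q\<in>O' \<inter> U - bdry A. \<zeta> q = \<xi> q)"
  proof (intro exI conjI ballI)
    show "open (V \<inter> \<phi> -` W)" by (rule chart_preimage_open[OF c(1) Cinf_on_open[OF X(2)]])
    show "(\<lambda>q. from_coords \<phi> q (X (\<phi> q))) \<in> vector_fields A (V \<inter> \<phi> -` W)" by (rule vf_of_coords[OF c(1) X(2)])
    show "from_coords \<phi> q (X (\<phi> q)) = \<xi> q" if "q \<in> V \<inter> \<phi> -` W \<inter> U - bdry A" for q
      using X(3)[of q] that from_coords_dd[OF c(1)] by auto
  qed (use c X in auto)
qed

lemma fun_extendsI:
  fixes f :: "'a \<Rightarrow> 'b::real_normed_vector"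
  assumes "\<And>p. p \<in> U \<Longrightarrow> fun_extends_near Q U f p"
    and U: "open U"
  shows "\<exists>F. smooth_fun A U F \<and> (\<forall>q\<in>U - bdry A. F q = f q) \<and> (\<forall>q\<in>U \<inter> bdry A. Q (F q))"
proof (rule smooth_fun_glue[OF _ U])
  fix p assume "p \<in> U"
  then obtain V \<phi> W F where c: "(V, \<phi>) \<in> A" "p \<in> V" and F: "\<phi> p \<in> W" "Cinf_on W F"
      "\<And>q. q \<in> V \<inter> U - bdry A \<Longrightarrow> \<phi> q \<in> W \<Longrightarrow> F (\<phi> q) = f q" "\<And>q. q \<in> V \<inter> U \<inter> bdry A \<Longrightarrow> \<phi> q \<in> W \<Longrightarrow> Q (F (\<phi> q))"
    using assms(1)[of p] by blast
  show "\<exists>O' F. open O' \<and> p \<in> O' \<and> smooth_fun A O' F \<and> (\<forall>q\<in>O' \<inter> U - bdry A. F q = f q) \<and> (\<forall>q\<in>O' \<inter> U \<inter> bdry A. Q (F q))"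
  proof (intro exI conjI ballI)
    show "open (V \<inter> \<phi> -` W)" by (rule chart_preimage_open[OF c(1) Cinf_on_open[OF F(2)]])
    show "smooth_fun A (V \<inter> \<phi> -` W) (\<lambda>q. F (\<phi> q))" by (rule smooth_fun_of_coords[OF c(1) F(2)])
  qed (use c F in auto)
qed

text \<open>A coordinate field times a bump function, extended by zero. The support is compact in the
  chart domain; it is closed in the manifold because the manifold is Hausdorff, so the extension is
  smooth away from the chart.\<close>

lemma cutoff_vf:
  assumes c: "(V, \<phi>) \<in> A" and U: "open U" and p: "p \<in> U" "p \<in> V" and Z: "Cinf_on W Z" "\<phi> p \<in> W"
  obtains W' b \<zeta> where "\<phi> p \<in> W'" "W' \<subseteq> W" "Cinf_on W' b" "\<And>x. x \<in> W' \<Longrightarrow> b x > (0::real)"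
    "\<zeta> \<in> vector_fields A U" "\<And>q. q \<in> V \<Longrightarrow> \<phi> q \<in> W' \<Longrightarrow> q \<in> U \<and> dd A \<phi> q (\<zeta> q) = b (\<phi> q) *\<^sub>R Z (\<phi> q)"
    "\<And>q. \<not> (q \<in> V \<and> \<phi> q \<in> W') \<Longrightarrow> \<zeta> q = 0"
proof -
  obtain O' where O': "open O'" "\<phi> ` (U \<inter> V) = O' \<inter> halfspace" using chart_image_open[OF c U] .
  have "\<phi> p \<in> W \<inter> O'" using O' p Z by blast
  then obtain r where r: "r > 0" "cball (\<phi> p) r \<subseteq> W \<inter> O'"
    using open_contains_cball[of "W \<inter> O'"] O' Cinf_on_open[OF Z(1)] by (meson open_Int)
  obtain b :: "real^'n \<Rightarrow> real" where b: "Cinf_on UNIV b" "\<And>x. x \<in> ball (\<phi> p) r \<Longrightarrow> b x > 0" "\<And>x. x \<notin> ball (\<phi> p) r \<Longrightarrow> b x = 0"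
    using bump_function[OF r(1)] by metis
  have inU: "q \<in> U" if "q \<in> V" "\<phi> q \<in> O'" for q
  proof -
    have "\<phi> q \<in> \<phi> ` (U \<inter> V)" using O'(2) that chart_halfspace[OF c] by auto
    then show ?thesis using chart_inj[OF c] that(1) by (auto dest: inj_onD)
  qed
  define \<zeta> where "\<zeta> q = (if q \<in> V \<and> \<phi> q \<in> ball (\<phi> p) r then b (\<phi> q) *\<^sub>R from_coords \<phi> q (Z (\<phi> q)) else 0)" for q
  have comps: "dd A \<phi> q (\<zeta> q) = b (\<phi> q) *\<^sub>R Z (\<phi> q)" if "q \<in> V" for q
    using b(3)[of "\<phi> q"] that dd_from_coords[OF c that] linear_0[OF chart_dd_linear[OF c that]] linear_scale[OF chart_dd_linear[OF c that]]
    by (simp add: \<zeta>_def)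
  define K where "K = inv_into V \<phi> ` (cball (\<phi> p) r \<inter> halfspace)"
  have sub: "cball (\<phi> p) r \<inter> halfspace \<subseteq> \<phi> ` V" using r(2) O'(2) by blast
  have "closed (halfspace :: (real^'n) set)"
    unfolding halfspace_def by (intro closed_Collect_le continuous_intros)
  moreover have "continuous_on (cball (\<phi> p) r \<inter> halfspace) (inv_into V \<phi>)"
    by (rule continuous_on_subset[OF _ sub]) (use chart_homeo[OF c] in \<open>simp add: homeomorphism_def\<close>)
  ultimately have "closed K"
    unfolding K_def
    by (rule_tac compact_imp_closed[OF compact_continuous_image[OF _ compact_Int_closed[OF compact_cball]]])
  have inK: "q \<in> V \<and> \<phi> q \<in> cball (\<phi> p) r" if "q \<in> K" for q
  proof -
    obtain x where "x \<in> cball (\<phi> p) r \<inter> halfspace" "q = inv_into V \<phi> x" using \<open>q \<in> K\<close> unfolding K_def by blast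
    then show ?thesis using chart_inv'[of x \<phi> V] subsetD[OF sub, of x] by simp
  qed
  have zero: "\<zeta> q = 0" if "q \<notin> K" for q
  proof -
    have "q \<in> K" if "q \<in> V" "\<phi> q \<in> ball (\<phi> p) r"
      using that chart_inv[OF c that(1)] chart_halfspace[OF c that(1)] unfolding K_def
      by (intro image_eqI[of _ _ "\<phi> q"]) auto
    then show ?thesis using that by (auto simp: \<zeta>_def)
  qed
  have "\<zeta> \<in> vector_fields A U"
  proof (rule vfI)
    fix q assume q: "q \<in> U"
    show "vf_near U \<zeta> q"
    proof (cases "q \<in> V \<and> \<phi> q \<in> W")
      case True
      have "Cinf_on W (\<lambda>x. b x *\<^sub>R Z x)"
        by (intro Cinf_on_scaleR Cinf_on_subset[OF b(1)] Z Cinf_on_open[OF Z(1)]) auto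
      then show ?thesis using True comps c
        by (intro exI[of _ V] exI[of _ \<phi>] exI[of _ W] exI[of _ "\<lambda>x. b x *\<^sub>R Z x"]) auto
    next
      case False
      then have "q \<notin> K" using inK[of q] r(2) by auto
      obtain V1 \<phi>1 where c1: "(V1, \<phi>1) \<in> A" "q \<in> V1" using chart_cover by blast
      obtain W1 where W1: "open W1" "\<phi>1 ` (- K \<inter> V1) = W1 \<inter> halfspace"
        using chart_image_open[OF c1(1) open_Compl[OF \<open>closed K\<close>]] .
      have "0 = dd A \<phi>1 q' (\<zeta> q')" if "q' \<in> V1" "\<phi>1 q' \<in> W1" for q'
      proof -
        have "\<phi>1 q' \<in> \<phi>1 ` (- K \<inter> V1)" using W1(2) that chart_halfspace[OF c1(1)] by auto
        then have "q' \<notin> K" using chart_inj[OF c1(1)] that(1) by (auto dest: inj_onD)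
        then show ?thesis using zero linear_0[OF chart_dd_linear[OF c1(1) that(1)]] by simp
      qed
      moreover have "\<phi>1 q \<in> W1" using W1(2) c1(2) \<open>q \<notin> K\<close> by auto
      ultimately show ?thesis using c1 Cinf_on_const[OF W1(1), of 0]
        by (intro exI[of _ V1] exI[of _ \<phi>1] exI[of _ W1] exI[of _ "\<lambda>_. 0"]) auto
    qed
  qed
  moreover have "\<zeta> q = 0" if "\<not> (q \<in> V \<and> \<phi> q \<in> ball (\<phi> p) r)" for q using that by (auto simp: \<zeta>_def)
  moreover have "ball (\<phi> p) r \<subseteq> W" "ball (\<phi> p) r \<subseteq> O'" using r(2) ball_subset_cball by blast+
  ultimately show thesis
    using that[of "ball (\<phi> p) r" b \<zeta>] comps inU b(2) r(1) Cinf_on_subset[OF b(1) open_ball]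
    by (metis centre_in_ball subset_UNIV subsetD)
qed

end

section \<open>Christoffel vectors\<close>

text \<open>Twice the Christoffel symbols of the first kind of the metric with matrix \<open>G\<close>.\<close>

definition koszul :: "(real^'n \<Rightarrow> real^'n^'n) \<Rightarrow> real^'n \<Rightarrow> real^'n \<Rightarrow> real^'n \<Rightarrow> real^'n \<Rightarrow> real" where
  "koszul G x u v w = v \<bullet> (fd G x u *v w) + u \<bullet> (fd G x v *v w) - u \<bullet> (fd G x w *v v)"

definition christoffel :: "(real^'n \<Rightarrow> real^'n^'n) \<Rightarrow> real^'n \<Rightarrow> real^'n \<Rightarrow> real^'n \<Rightarrow> real^'n" where
  "christoffel G x u v = (THE z. \<forall>w. 2 * (z \<bullet> (G x *v w)) = koszul G x u v w)"

lemma koszul_linear: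
  fixes G :: "real^'n \<Rightarrow> real^'n^'n"
  assumes "linear (fd G x)"
  shows "linear (koszul G x u v)"
proof -
  have 1: "fd G x (a + b) = fd G x a + fd G x b" "fd G x (c *\<^sub>R a) = c *\<^sub>R fd G x a" for a b c
    using assms by (simp_all add: linear_add linear_scale)
  show ?thesis
    by (rule linearI)
      (simp_all add: koszul_def 1 matrix_vector_right_distrib matrix_vector_mult_add_rdistrib
        matrix_vector_mult_scaleR scaleR_matrix_vector_assoc[symmetric] inner_add_right algebra_simps)
qed

lemma linear_axis_inner:
  fixes f :: "real^'n \<Rightarrow> real"
  assumes "linear f"
  shows "f w = (\<chi> i. f (axis i 1)) \<bullet> w"
proof -
  have w: "w = (\<Sum>i\<in>UNIV. w $ i *\<^sub>R axis i 1)"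
    by (simp add: vec_eq_iff axis_def if_distrib cong: if_cong)
  have "f w = (\<Sum>i\<in>UNIV. w $ i *\<^sub>R f (axis i 1))"
    by (subst w) (simp add: linear_sum[OF assms] linear_scale[OF assms])
  then show ?thesis by (simp add: inner_vec_def mult.commute)
qed

lemma symmetric_inner_mv:
  fixes M :: "real^'n^'n"
  assumes "transpose M = M"
  shows "z \<bullet> (M *v w) = (M *v z) \<bullet> w"
  by (metis assms dot_lmul_matrix inner_commute transpose_matrix_vector)

lemma christoffel:
  fixes G :: "real^'n \<Rightarrow> real^'n^'n"
  assumes lin: "linear (fd G x)" and sym: "transpose (G x) = G x" and nd: "det (G x) \<noteq> 0"
  shows christoffel_koszul: "2 * (christoffel G x u v \<bullet> (G x *v w)) = koszul G x u v w"
    and christoffel_unique: "(\<And>w. 2 * (z \<bullet> (G x *v w)) = koszul G x u v w) \<Longrightarrow> z = christoffel G x u v"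
    and christoffel_solve: "G x *v christoffel G x u v = (\<chi> i. koszul G x u v (axis i 1) / 2)"
proof -
  have iff: "(\<forall>w. 2 * (z \<bullet> (G x *v w)) = koszul G x u v w) \<longleftrightarrow> G x *v z = (\<chi> i. koszul G x u v (axis i 1) / 2)" (is "?L \<longleftrightarrow> ?R") for z
  proof
    assume L: ?L
    have "(G x *v z) $ i = koszul G x u v (axis i 1) / 2" for i
      using symmetric_inner_mv[OF sym, of z "axis i 1"] spec[OF L, of "axis i 1"] by (simp add: inner_axis)
    then show ?R by (simp add: vec_eq_iff)
  next
    assume r: ?R
    have k: "koszul G x u v w = 2 * ((\<chi> i. koszul G x u v (axis i 1) / 2) \<bullet> w)" for w
      by (subst linear_axis_inner[OF koszul_linear[OF lin]]) (simp add: inner_vec_def sum_distrib_left)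
    show ?L by (intro allI) (simp only: symmetric_inner_mv[OF sym] r k[symmetric])
  qed
  have ex1: "\<exists>!z. \<forall>w. 2 * (z \<bullet> (G x *v w)) = koszul G x u v w"
    unfolding iff using cramer[OF nd] by simp
  then have all: "\<forall>w. 2 * (christoffel G x u v \<bullet> (G x *v w)) = koszul G x u v w"
    unfolding christoffel_def by (rule theI')
  then show "2 * (christoffel G x u v \<bullet> (G x *v w)) = koszul G x u v w" by simp
  show "G x *v christoffel G x u v = (\<chi> i. koszul G x u v (axis i 1) / 2)" using iff all by blast
  show "z = christoffel G x u v" if "\<And>w. 2 * (z \<bullet> (G x *v w)) = koszul G x u v w"
    using ex1 all that by blast
qed

lemma fd_apply_sym:
  fixes G :: "real^'n \<Rightarrow> real^'n^'n"
  assumes "Cinf_on S G" "x \<in> S" "\<And>y. y \<in> S \<Longrightarrow> transpose (G y) = G y"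
  shows "v \<bullet> (fd G x u *v w) = w \<bullet> (fd G x u *v v)"
proof -
  have bl: "bounded_linear (\<lambda>M :: real^'n^'n. a \<bullet> (M *v b))" for a b :: "real^'n"
    by (rule bounded_linear_compose[OF bounded_linear_inner_right bounded_bilinear.bounded_linear_left[OF bounded_bilinear_mv]])
  have "fd (\<lambda>y. v \<bullet> (G y *v w)) x = fd (\<lambda>y. w \<bullet> (G y *v v)) x"
    by (rule fd_cong[OF Cinf_on_bounded_linear[OF bl assms(1)] assms(2)])
      (use symmetric_inner_mv assms(3) inner_commute in metis)
  then show ?thesis
    using fd_bounded_linear[OF bl assms(1,2)] by metis
qed

lemma christoffel_sym:
  fixes G :: "real^'n \<Rightarrow> real^'n^'n"
  assumes G: "Cinf_on S G" "x \<in> S" "\<And>y. y \<in> S \<Longrightarrow> transpose (G y) = G y" and nd: "det (G x) \<noteq> 0"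
  shows "christoffel G x u v = christoffel G x v u"
proof -
  have "koszul G x u v w = koszul G x v u w" for w
    using fd_apply_sym[OF G] by (simp add: koszul_def)
  then show ?thesis by (simp add: christoffel_def)
qed

text \<open>Adding two Koszul formulas with the last arguments exchanged leaves twice the derivative of the
  metric.\<close>

lemma christoffel_metric:
  fixes G :: "real^'n \<Rightarrow> real^'n^'n"
  assumes G: "Cinf_on S G" "x \<in> S" "\<And>y. y \<in> S \<Longrightarrow> transpose (G y) = G y" and nd: "det (G x) \<noteq> 0"
  shows "christoffel G x u v \<bullet> (G x *v w) + v \<bullet> (G x *v christoffel G x u w) = v \<bullet> (fd G x u *v w)"
proof -
  note chr = christoffel_koszul[OF fd_linear[OF G(1,2)] G(3)[OF G(2)] nd]
  have "v \<bullet> (G x *v christoffel G x u w) = christoffel G x u w \<bullet> (G x *v v)"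
    using symmetric_inner_mv[OF G(3)[OF G(2)]] inner_commute by metis
  then have "2 * (christoffel G x u v \<bullet> (G x *v w) + v \<bullet> (G x *v christoffel G x u w)) = koszul G x u v w + koszul G x u w v"
    using chr[of u v w] chr[of u w v] by simp
  also have "\<dots> = 2 * (v \<bullet> (fd G x u *v w))"
    using fd_apply_sym[OF G] by (simp add: koszul_def)
  finally show ?thesis by simp
qed

lemma christoffel_linear:
  fixes G :: "real^'n \<Rightarrow> real^'n^'n"
  assumes G: "Cinf_on S G" "x \<in> S" "\<And>y. y \<in> S \<Longrightarrow> transpose (G y) = G y" and nd: "det (G x) \<noteq> 0"
  shows "linear (christoffel G x u)" "linear (\<lambda>u. christoffel G x u v)"
proof -
  note chr = christoffel[OF fd_linear[OF G(1,2)] G(3)[OF G(2)] nd]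
  have 1: "fd G x (a + b) = fd G x a + fd G x b" "fd G x (c *\<^sub>R a) = c *\<^sub>R fd G x a" for a b c
    using fd_linear[OF G(1,2)] by (simp_all add: linear_add linear_scale)
  show *: "linear (christoffel G x u)" for u
  proof (rule linearI; rule chr(2)[symmetric])
    fix a b w :: "real^'n" and c :: real
    show "2 * ((christoffel G x u a + christoffel G x u b) \<bullet> (G x *v w)) = koszul G x u (a + b) w"
      unfolding inner_add_left distrib_left chr(1)
      by (simp add: koszul_def 1 matrix_vector_right_distrib matrix_vector_mult_add_rdistrib inner_add_right inner_add_left)
    have "2 * ((c *\<^sub>R christoffel G x u a) \<bullet> (G x *v w)) = c * koszul G x u a w"
      using chr(1)[of u a w] by simp
    then show "2 * ((c *\<^sub>R christoffel G x u a) \<bullet> (G x *v w)) = koszul G x u (c *\<^sub>R a) w"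
      by (simp add: koszul_def 1 matrix_vector_mult_scaleR scaleR_matrix_vector_assoc[symmetric] algebra_simps)
  qed
  show "linear (\<lambda>u. christoffel G x u v)"
    using *[of v] by (simp only: christoffel_sym[OF G nd, of _ v])
qed

lemma Cinf_on_koszul:
  fixes G :: "real^'n \<Rightarrow> real^'n^'n"
  assumes "Cinf_on S G" "Cinf_on S X" "Cinf_on S Y" "Cinf_on S Z"
  shows "Cinf_on S (\<lambda>x. koszul G x (X x) (Y x) (Z x))"
  unfolding koszul_def by (intro Cinf_on_add Cinf_on_diff Cinf_on_inner Cinf_on_mv Cinf_on_fd assms)

lemma Cinf_on_christoffel:
  fixes G :: "real^'n \<Rightarrow> real^'n^'n"
  assumes G: "Cinf_on S G" and XY: "Cinf_on S X" "Cinf_on S Y"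
    and sym: "\<And>y. y \<in> S \<Longrightarrow> transpose (G y) = G y" and nd: "\<And>y. y \<in> S \<Longrightarrow> det (G y) \<noteq> 0"
  shows "Cinf_on S (\<lambda>x. christoffel G x (X x) (Y x))"
proof -
  have b: "Cinf_on S (\<lambda>x. \<chi> i. koszul G x (X x) (Y x) (axis i 1) / 2)"
    by (intro Cinf_on_vec_lambda Cinf_on_divide Cinf_on_koszul Cinf_on_const assms Cinf_on_open[OF G]) auto
  obtain z where z: "Cinf_on S z" "\<And>x y. x \<in> S \<Longrightarrow> G x *v y = (\<chi> i. koszul G x (X x) (Y x) (axis i 1) / 2) \<longleftrightarrow> y = z x"
    using Cinf_on_linear_solve[OF G b nd] by metis
  show ?thesis
  proof (rule Cinf_on_cong[OF z(1)])
    fix x assume x: "x \<in> S"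
    show "z x = christoffel G x (X x) (Y x)"
      using z(2)[OF x] christoffel_solve[of G x, OF fd_linear[OF G x] sym[OF x] nd[OF x]] by metis
  qed
qed

text \<open>Any permutation other than the identity moves at least two indices, so its product still contains an
  off-diagonal entry of the identity matrix after one factor has been differentiated.\<close>

lemma DERIV_det_identity_add:
  fixes a :: "real^'n^'n"
  shows "((\<lambda>t. det (mat 1 + t *\<^sub>R a)) has_real_derivative trace a) (at 0)"
proof -
  let ?e = "\<lambda>(p :: 'n \<Rightarrow> 'n) i. if i = p i then 1 else 0 :: real"
  have *: "((\<lambda>t. \<Prod>i\<in>UNIV. (mat 1 + t *\<^sub>R a) $ i $ p i) has_real_derivative (\<Sum>i\<in>UNIV. a $ i $ p i * (\<Prod>j\<in>UNIV - {i}. ?e p j))) (at 0)" for p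
    by (rule DERIV_cong[OF has_field_derivative_prod[where f' = "\<lambda>i. a $ i $ p i"]])
      (auto intro!: derivative_eq_intros sum.cong prod.cong simp: mat_def)
  have perm: "(\<Sum>i\<in>UNIV. a $ i $ p i * (\<Prod>j\<in>UNIV - {i}. ?e p j)) = (if p = id then trace a else 0)"
    if p: "p permutes UNIV" for p
  proof (cases "p = id")
    case False
    have z: "(\<Prod>j\<in>UNIV - {i}. ?e p j) = 0" for i
    proof -
      obtain k where k: "p k \<noteq> k" using False by (auto simp: fun_eq_iff)
      have "\<exists>j. j \<noteq> i \<and> j \<noteq> p j"
      proof (cases "k = i")
        case True
        have "p (p k) \<noteq> p k" using k p by (metis permutes_inverses(2))
        then show ?thesis using True k by metis
      qed (use k in auto)
      then show ?thesis by (intro prod_zero) auto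
    qed
    show ?thesis unfolding z using False by simp
  qed (simp add: trace_def)
  have "((\<lambda>t. \<Sum>p\<in>{p. p permutes UNIV}. of_int (sign p) * (\<Prod>i\<in>UNIV. (mat 1 + t *\<^sub>R a) $ i $ p i)) has_real_derivative
     (\<Sum>p\<in>{p. p permutes (UNIV :: 'n set)}. of_int (sign p) * (if p = id then trace a else 0))) (at 0)"
  proof (rule DERIV_sum, rule DERIV_cmult)
    fix p :: "'n \<Rightarrow> 'n" assume "p \<in> {p. p permutes UNIV}"
    then show "((\<lambda>t. \<Prod>i\<in>UNIV. (mat 1 + t *\<^sub>R a) $ i $ p i) has_real_derivative (if p = id then trace a else 0)) (at 0)"
      using *[of p] perm[of p] by simp
  qed
  moreover have "(\<Sum>p\<in>{p. p permutes (UNIV :: 'n set)}. of_int (sign p) * (if p = id then trace a else 0)) = trace a"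
    by (subst sum.remove[of _ id]) (auto simp: permutes_id finite_permutations sign_id intro!: sum.neutral)
  ultimately show ?thesis by (simp add: det_def)
qed

lemma Cinf_on_sqrt_abs: "Cinf_on (- {0}) (\<lambda>x::real. sqrt \<bar>x\<bar>)"
proof -
  have "Cinf_on (- {0}) (\<lambda>x::real. sqrt (sqrt (x\<^sup>2)))"
    by (intro Cinf_on_sqrt Cinf_on_power Cinf_on_ident) auto
  then show ?thesis by simp
qed

lemma Cinf_on_sqrt_abs_det: "Cinf_on {M :: real^'n^'n. det M \<noteq> 0} (\<lambda>M. sqrt \<bar>det M\<bar>)"
proof (rule Cinf_on_compose[OF Cinf_on_sqrt_abs])
  have d: "Cinf_on UNIV (det :: real^'n^'n \<Rightarrow> real)"
    using Cinf_on_det[OF Cinf_on_ident[OF open_UNIV]] by simp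
  have "open (det -` (- {0}) :: (real^'n^'n) set)"
    using Cinf_on_continuous[OF d] by (intro open_vimage) auto
  moreover have "det -` (- {0}) = {M :: real^'n^'n. det M \<noteq> 0}" by auto
  ultimately show "Cinf_on {M :: real^'n^'n. det M \<noteq> 0} det"
    using Cinf_on_subset[OF d] by simp
qed auto

text \<open>The curve \<open>(1 + t a) M (1 + t a)\<^sup>T\<close> has velocity \<open>a M + M a\<^sup>T\<close> at \<open>t = 0\<close>, and \<open>\<bar>det\<bar>\<close> is multiplied by
  \<open>(det (1 + t a))\<^sup>2\<close> along it.\<close>

lemma fd_sqrt_abs_det:
  fixes M a :: "real^'n^'n"
  assumes "det M \<noteq> 0"
  shows "fd (\<lambda>M. sqrt \<bar>det M\<bar>) M (a ** M + M ** transpose a) = trace a * sqrt \<bar>det M\<bar>"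
proof -
  let ?H = "\<lambda>M :: real^'n^'n. sqrt \<bar>det M\<bar>"
  let ?c = "\<lambda>t. (mat 1 + t *\<^sub>R a) ** M ** transpose (mat 1 + t *\<^sub>R a)"
  have expand: "?c t = M + t *\<^sub>R (a ** M + M ** transpose a) + (t * t) *\<^sub>R (a ** M ** transpose a)" for t
  proof -
    have r: "(X + Y) ** Z = X ** Z + Y ** Z" "(c *\<^sub>R X) ** Z = c *\<^sub>R (X ** Z)" "Z ** (c *\<^sub>R X) = c *\<^sub>R (Z ** X)"
      for X Y Z :: "real^'n^'n" and c
      by (simp_all add: vec_eq_iff matrix_matrix_mult_def sum.distrib sum_distrib_left algebra_simps)
    have t: "transpose (mat 1 + t *\<^sub>R a) = mat 1 + t *\<^sub>R transpose a"
      by (simp add: vec_eq_iff transpose_def mat_def)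
    show ?thesis
      unfolding t by (simp add: r matrix_add_ldistrib scaleR_add_right matrix_mul_lid matrix_mul_rid add.assoc)
  qed
  have "(?c has_derivative (\<lambda>t. t *\<^sub>R (a ** M + M ** transpose a))) (at 0)"
    unfolding expand by (auto intro!: derivative_eq_intros)
  moreover have "(?H has_derivative fd ?H M) (at (?c 0))"
    using Cinf_on_has_derivative[OF Cinf_on_sqrt_abs_det, of M] assms by (simp add: transpose_mat)
  ultimately have 1: "((\<lambda>t. ?H (?c t)) has_derivative (\<lambda>t. fd ?H M (t *\<^sub>R (a ** M + M ** transpose a)))) (at 0)"
    by (rule has_derivative_compose)
  have "((\<lambda>t. det (mat 1 + t *\<^sub>R a) * ?H M) has_derivative (\<lambda>t. t * (trace a * ?H M))) (at 0)"
    using DERIV_cmult_right[OF DERIV_det_identity_add[of a], of "?H M"]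
    unfolding has_field_derivative_def by (rule has_derivative_eq_rhs) (auto simp: fun_eq_iff)
  then have "((\<lambda>t. ?H (?c t)) has_derivative (\<lambda>t. t * (trace a * ?H M))) (at 0)"
  proof (rule has_derivative_transform_within_open)
    have "Cinf_on UNIV (\<lambda>t::real. det (mat 1 + t *\<^sub>R a))"
      by (intro Cinf_on_det Cinf_on_add Cinf_on_const Cinf_on_scaleR Cinf_on_ident open_UNIV)
    from Cinf_on_continuous[OF this] show "open ((\<lambda>t. det (mat 1 + t *\<^sub>R a)) -` {0<..})"
      by (intro open_vimage) auto
    show "det (mat 1 + t *\<^sub>R a) * ?H M = ?H (?c t)" if "t \<in> (\<lambda>t. det (mat 1 + t *\<^sub>R a)) -` {0<..}" for t
      using that by (simp add: det_mul det_transpose abs_mult real_sqrt_mult)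
  qed (simp add: det_I)
  from fun_cong[OF has_derivative_unique[OF 1 this], of 1] show ?thesis by simp
qed

section \<open>The Levi-Civita connection\<close>

context manifold_with_boundary begin

abbreviation interior_img :: "'a set \<Rightarrow> ('a \<Rightarrow> real^'n) \<Rightarrow> (real^'n) set" where
  "interior_img V \<phi> \<equiv> \<phi> ` (V - bdry A)"

lemma rep_compose:
  fixes f :: "'a \<Rightarrow> 'b::euclidean_space"
  assumes "rep V \<phi> W f F" "Cinf_on T H"
  shows "rep V \<phi> (W \<inter> F -` T) (\<lambda>q. H (f q)) (\<lambda>x. H (F x))"
proof -
  have "open (W \<inter> F -` T)"
    by (intro continuous_open_preimage Cinf_on_continuous rep_Cinf[OF assms(1)] rep_open[OF assms(1)] Cinf_on_open[OF assms(2)])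
  then have "Cinf_on (W \<inter> F -` T) (\<lambda>y. H (F y))"
    by (intro Cinf_on_compose[OF assms(2)] Cinf_on_subset[OF rep_Cinf[OF assms(1)]]) auto
  then show ?thesis using assms(1) by (auto simp: rep_def)
qed

lemma dd_chain:
  fixes f :: "'a \<Rightarrow> 'b::euclidean_space"
  assumes f: "smooth_fun A U f" "open U" "p \<in> U" and H: "Cinf_on T H" "f p \<in> T"
  shows "dd A (\<lambda>q. H (f q)) p v = fd H (f p) (dd A f p v)"
proof -
  obtain V \<phi> where c: "(V, \<phi>) \<in> A" "p \<in> V" using chart_cover by blast
  obtain W F where F: "\<phi> p \<in> W" "rep V \<phi> W f F"
    using smooth_fun_rep[OF f(1,2) c(1) f(3) c(2)] by metis
  have Fp: "F (\<phi> p) = f p" using rep_eq[OF F(2) c(2) F(1)] .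
  have "dd A (\<lambda>q. H (f q)) p v = fd (\<lambda>x. H (F x)) (\<phi> p) (dd A \<phi> p v)"
    by (rule dd_rep[OF c rep_compose[OF F(2) H(1)]]) (use F(1) Fp H(2) in auto)
  also have "fd (\<lambda>x. H (F x)) (\<phi> p) = (\<lambda>v. fd H (f p) (fd F (\<phi> p) v))"
    by (rule fd_eq)
      (use has_derivative_compose[OF Cinf_on_has_derivative[OF rep_Cinf[OF F(2)] F(1)], of H]
        Cinf_on_has_derivative[OF H] Fp in simp)
  finally show ?thesis using dd_rep[OF c F(2,1)] by simp
qed

lemma smooth_fun_compose:
  fixes f :: "'a \<Rightarrow> 'b::euclidean_space"
  assumes f: "smooth_fun A U f" "open U" and H: "Cinf_on T H" "\<And>q. q \<in> U \<Longrightarrow> f q \<in> T"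
  shows "smooth_fun A U (\<lambda>q. H (f q))"
proof (rule smooth_funI)
  fix p assume p: "p \<in> U"
  obtain V \<phi> where c: "(V, \<phi>) \<in> A" "p \<in> V" using chart_cover by blast
  obtain W F where F: "\<phi> p \<in> W" "rep V \<phi> W f F"
    using smooth_fun_rep[OF f(1,2) c(1) p c(2)] by metis
  have "rep V \<phi> (W \<inter> F -` T) (\<lambda>q. H (f q)) (\<lambda>x. H (F x))" by (rule rep_compose[OF F(2) H(1)])
  moreover have "\<phi> p \<in> W \<inter> F -` T" using rep_eq[OF F(2) c(2) F(1)] F(1) H(2)[OF p] by simp
  ultimately show "smooth_near U (\<lambda>q. H (f q)) p"
    using c by (intro exI[of _ V] exI[of _ \<phi>] exI[of _ "W \<inter> F -` T"] exI[of _ "\<lambda>x. H (F x)"]) (auto simp: rep_def)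
qed

lemma dd_bounded_linear:
  fixes f :: "'a \<Rightarrow> 'b::euclidean_space"
  assumes f: "smooth_fun A U f" "open U" "p \<in> U" and L: "bounded_linear L"
  shows "dd A (\<lambda>q. L (f q)) p v = L (dd A f p v)"
  using dd_chain[OF f Cinf_on_bounded_linear[OF L Cinf_on_ident[OF open_UNIV]]]
    fd_eq[OF bounded_linear_imp_has_derivative[OF L]] by simp

lemma interior_img_pos: "(V, \<phi>) \<in> A \<Longrightarrow> x \<in> interior_img V \<phi> \<Longrightarrow> x $ bidx > 0"
  using bdry_iff chart_halfspace by (fastforce simp: halfspace_def)

lemma open_interior_img:
  assumes c: "(V, \<phi>) \<in> A" and U: "open U" "U \<subseteq> - bdry A"
  shows "open (\<phi> ` (U \<inter> V))"
proof -
  obtain W where W: "open W" "\<phi> ` (U \<inter> V) = W \<inter> halfspace" using chart_image_open[OF c U(1)] .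
  have "\<phi> ` (U \<inter> V) = W \<inter> {x. x $ bidx > 0}"
  proof (intro subset_antisym subsetI)
    fix x assume "x \<in> \<phi> ` (U \<inter> V)"
    moreover then have "x \<in> interior_img V \<phi>" using U(2) by auto
    ultimately show "x \<in> W \<inter> {x. x $ bidx > 0}" using W interior_img_pos[OF c] by auto
  next
    fix x assume "x \<in> W \<inter> {x. x $ bidx > 0}"
    then show "x \<in> \<phi> ` (U \<inter> V)" using W(2) by (auto simp: halfspace_def)
  qed
  then show ?thesis using W(1) by (simp add: open_Int open_Collect_less continuous_intros)
qed

text \<open>In the interior the domains of charts are open subsets of Euclidean space, so no extension has to be
  chosen: the coordinate expression represents the function.\<close>

abbreviation cexp :: "'a set \<Rightarrow> ('a \<Rightarrow> real^'n) \<Rightarrow> ('a \<Rightarrow> 'b) \<Rightarrow> real^'n \<Rightarrow> 'b" where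
  "cexp V \<phi> f \<equiv> \<lambda>x. f (inv_into V \<phi> x)"

lemma interior_rep:
  assumes c: "(V, \<phi>) \<in> A" and U: "open U" "U \<subseteq> - bdry A" and f: "smooth_fun A (U \<inter> V) f"
  shows "rep V \<phi> (\<phi> ` (U \<inter> V)) f (cexp V \<phi> f)"
proof -
  have "Cinf_on (\<phi> ` (U \<inter> V)) (cexp V \<phi> f)"
  proof (rule Cinf_on_local)
    fix x assume "x \<in> \<phi> ` (U \<inter> V)"
    then obtain p where p: "x = \<phi> p" "p \<in> U \<inter> V" by blast
    obtain W F where F: "\<phi> p \<in> W" "rep V \<phi> W f F" "\<And>q. q \<in> V \<Longrightarrow> \<phi> q \<in> W \<Longrightarrow> q \<in> U \<inter> V"
      using smooth_fun_rep[OF f open_Int[OF U(1) chart_open[OF c]] c p(2)] p by auto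
    let ?T = "W \<inter> \<phi> ` (U \<inter> V)"
    have "open ?T" using rep_open[OF F(2)] open_interior_img[OF c U] by auto
    then have "Cinf_on ?T F" using Cinf_on_subset[OF rep_Cinf[OF F(2)]] by blast
    then have "Cinf_on ?T (cexp V \<phi> f)"
      by (rule Cinf_on_cong) (use rep_eq[OF F(2)] chart_inv[OF c] in auto)
    then show "\<exists>T. x \<in> T \<and> T \<subseteq> \<phi> ` (U \<inter> V) \<and> Cinf_on T (cexp V \<phi> f)"
      using p F(1) by (intro exI[of _ ?T]) simp
  qed
  then show ?thesis using chart_inv[OF c] by (auto simp: rep_def)
qed

lemma rep_interior_unique:
  assumes c: "(V, \<phi>) \<in> A" and p: "p \<in> V - bdry A"
    and F: "rep V \<phi> W f F" "\<phi> p \<in> W" and G: "rep V \<phi> W' f G" "\<phi> p \<in> W'"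
  shows "fd F (\<phi> p) = fd G (\<phi> p)"
proof -
  let ?O = "W \<inter> W' \<inter> interior_img V \<phi>"
  have "open (\<phi> ` (- bdry A \<inter> V))" by (rule open_interior_img[OF c open_interior]) auto
  moreover have "- bdry A \<inter> V = V - bdry A" by auto
  ultimately have "open ?O" using rep_open[OF F(1)] rep_open[OF G(1)] by auto
  then have "Cinf_on ?O G" using Cinf_on_subset[OF rep_Cinf[OF G(1)]] by blast
  then show ?thesis
    by (rule fd_cong) (use rep_eq[OF F(1)] rep_eq[OF G(1)] p F(2) G(2) in auto)
qed

lemma interior_rep_vf:
  assumes c: "(V, \<phi>) \<in> A" and U: "open U" "U \<subseteq> - bdry A" and \<xi>: "\<xi> \<in> vector_fields A U"
  shows "rep V \<phi> (\<phi> ` (U \<inter> V)) (comps \<phi> \<xi>) (cexp V \<phi> (comps \<phi> \<xi>))"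
  by (rule interior_rep[OF c U]) (use \<xi> c in \<open>auto simp: vector_fields_def\<close>)

end

locale pseudo_riemannian_interior = manifold_with_boundary A
  for A :: "('a::{t2_space,second_countable_topology}, 'n::finite) chart set" +
  fixes g :: "'a \<Rightarrow> real^'n \<Rightarrow> real^'n \<Rightarrow> real"
  assumes metric: "pseudo_riemannian_metric A (- bdry A) g"
begin

lemma g_smooth: "smooth_sym_tensor A (- bdry A) g"
  using metric by (simp add: pseudo_riemannian_metric_def)

lemma g_bilinear: "p \<notin> bdry A \<Longrightarrow> bilinear (g p)"
  and g_sym: "p \<notin> bdry A \<Longrightarrow> g p v w = g p w v"
  using g_smooth unfolding smooth_sym_tensor_def by auto

lemma g_nondeg: "p \<notin> bdry A \<Longrightarrow> (\<And>w. g p v w = 0) \<Longrightarrow> v = 0"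
  using metric unfolding pseudo_riemannian_metric_def nondegenerate_on_def by auto

abbreviation G :: "'a set \<Rightarrow> ('a \<Rightarrow> real^'n) \<Rightarrow> real^'n \<Rightarrow> real^'n^'n" where
  "G V \<phi> \<equiv> cexp V \<phi> (gram g \<phi>)"

lemma G_rep:
  assumes c: "(V, \<phi>) \<in> A"
  shows "rep V \<phi> (interior_img V \<phi>) (gram g \<phi>) (G V \<phi>)"
proof -
  have "smooth_fun A (- bdry A \<inter> V) (gram g \<phi>)" by (rule smooth_fun_gram[OF g_smooth open_interior c])
  from interior_rep[OF c open_interior _ this] show ?thesis by (simp add: Diff_eq Int_commute)
qed

lemma g_gram: "(V, \<phi>) \<in> A \<Longrightarrow> q \<in> V - bdry A \<Longrightarrow> g q v w = dd A \<phi> q v \<bullet> (gram g \<phi> q *v dd A \<phi> q w)"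
  using gram_eq[of g q V \<phi> v w] g_bilinear by auto

lemma gram_sym: "q \<notin> bdry A \<Longrightarrow> transpose (gram g \<phi> q) = gram g \<phi> q"
  by (simp add: gram_def transpose_def vec_eq_iff g_sym)

lemma gram_det:
  assumes c: "(V, \<phi>) \<in> A" and q: "q \<in> V - bdry A"
  shows "det (gram g \<phi> q) \<noteq> 0"
proof
  assume "det (gram g \<phi> q) = 0"
  then obtain x where x: "x \<noteq> 0" "gram g \<phi> q *v x = 0"
    by (metis invertible_det_nz invertible_left_inverse matrix_left_invertible_ker)
  have qV: "q \<in> V" using q by simp
  have "g q (from_coords \<phi> q x) w = 0" for w
  proof -
    have "g q (from_coords \<phi> q x) w = g q w (from_coords \<phi> q x)" using g_sym q by auto
    also have "\<dots> = 0" using g_gram[OF c q, of w] x(2) dd_from_coords[OF c qV] by simp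
    finally show ?thesis .
  qed
  then have "from_coords \<phi> q x = 0" using g_nondeg q by blast
  then show False using dd_from_coords[OF c qV, of x] linear_0[OF chart_dd_linear[OF c qV]] x(1) by simp
qed

lemma G_props:
  assumes c: "(V, \<phi>) \<in> A" and x: "x \<in> interior_img V \<phi>"
  shows "transpose (G V \<phi> x) = G V \<phi> x" "det (G V \<phi> x) \<noteq> 0"
  using x chart_inv[OF c] gram_sym gram_det[OF c] by auto

lemmas G_Cinf = rep_Cinf[OF G_rep]

text \<open>The formula \<open>D\<eta>(\<xi>) + \<Gamma>(\<xi>, \<eta>)\<close> in a single chart.\<close>

definition conn :: "'a set \<Rightarrow> ('a \<Rightarrow> real^'n) \<Rightarrow> ('a, 'n) connection" where
  "conn V \<phi> \<xi> \<eta> p = from_coords \<phi> p (fd (cexp V \<phi> (comps \<phi> \<eta>)) (\<phi> p) (dd A \<phi> p (\<xi> p)) +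
     christoffel (G V \<phi>) (\<phi> p) (dd A \<phi> p (\<xi> p)) (dd A \<phi> p (\<eta> p)))"

lemma conn_comps:
  assumes c: "(V, \<phi>) \<in> A" and U: "open U" "U \<subseteq> - bdry A" "p \<in> U" "p \<in> V" and \<eta>: "\<eta> \<in> vector_fields A U"
    and Y: "rep V \<phi> W (comps \<phi> \<eta>) Y" "\<phi> p \<in> W"
  shows "dd A \<phi> p (conn V \<phi> \<xi> \<eta> p) = fd Y (\<phi> p) (dd A \<phi> p (\<xi> p)) +
     christoffel (G V \<phi>) (\<phi> p) (dd A \<phi> p (\<xi> p)) (dd A \<phi> p (\<eta> p))"
proof -
  have "fd (cexp V \<phi> (comps \<phi> \<eta>)) (\<phi> p) = fd Y (\<phi> p)"
    by (rule rep_interior_unique[OF c _ interior_rep_vf[OF c U(1,2) \<eta>] _ Y]) (use U in auto)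
  then show ?thesis by (simp add: conn_def dd_from_coords[OF c U(4)])
qed

lemma conn_rep:
  assumes c: "(V, \<phi>) \<in> A" and U: "open U" "U \<subseteq> - bdry A" and \<xi>: "\<xi> \<in> vector_fields A U" and \<eta>: "\<eta> \<in> vector_fields A U"
  shows "rep V \<phi> (\<phi> ` (U \<inter> V)) (comps \<phi> (conn V \<phi> \<xi> \<eta>))
    (\<lambda>x. fd (cexp V \<phi> (comps \<phi> \<eta>)) x (cexp V \<phi> (comps \<phi> \<xi>) x) +
      christoffel (G V \<phi>) x (cexp V \<phi> (comps \<phi> \<xi>) x) (cexp V \<phi> (comps \<phi> \<eta>) x))" (is "rep V \<phi> ?W _ ?N")
proof -
  note rX = interior_rep_vf[OF c U \<xi>] and rY = interior_rep_vf[OF c U \<eta>]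
  have sub: "?W \<subseteq> interior_img V \<phi>" using U by auto
  have "Cinf_on ?W ?N"
    using sub by (intro Cinf_on_add Cinf_on_fd Cinf_on_christoffel rep_Cinf[OF rX] rep_Cinf[OF rY]
        Cinf_on_subset[OF G_Cinf[OF c]] rep_open[OF rX] G_props[OF c]) auto
  moreover have "?N (\<phi> q) = comps \<phi> (conn V \<phi> \<xi> \<eta>) q" if "q \<in> V" "\<phi> q \<in> ?W" for q
  proof -
    have "q \<in> U" using that chart_inj[OF c] by (auto dest: inj_onD)
    then show ?thesis using conn_comps[OF c U _ that(1) \<eta> rY that(2)] chart_inv[OF c that(1)] by simp
  qed
  ultimately show ?thesis using rX by (simp add: rep_def)
qed

lemma conn_vf:
  assumes c: "(V, \<phi>) \<in> A" and U: "open U" "U \<subseteq> - bdry A" and \<xi>: "\<xi> \<in> vector_fields A U" and \<eta>: "\<eta> \<in> vector_fields A U"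
  shows "conn V \<phi> \<xi> \<eta> \<in> vector_fields A (U \<inter> V)"
proof (rule vfI)
  obtain N where N: "rep V \<phi> (\<phi> ` (U \<inter> V)) (comps \<phi> (conn V \<phi> \<xi> \<eta>)) N"
    using conn_rep[OF c U \<xi> \<eta>] ..
  fix p assume p: "p \<in> U \<inter> V"
  then show "vf_near (U \<inter> V) (conn V \<phi> \<xi> \<eta>) p"
    using c rep_Cinf[OF N] rep_eq[OF N]
    by (intro exI[of _ V] exI[of _ \<phi>] exI[of _ "\<phi> ` (U \<inter> V)"] exI[of _ N]) auto
qed

text \<open>The Christoffel terms cancel by symmetry, and so do the second derivatives of \<open>f\<close>.\<close>

lemma conn_torsion_free:
  fixes f :: "'a \<Rightarrow> real"
  assumes c: "(V, \<phi>) \<in> A" and U: "open U" "U \<subseteq> - bdry A" "p \<in> U" "p \<in> V"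
    and \<xi>: "\<xi> \<in> vector_fields A U" and \<eta>: "\<eta> \<in> vector_fields A U" and f: "smooth_fun A U f"
  shows "dd A f p (conn V \<phi> \<xi> \<eta> p - conn V \<phi> \<eta> \<xi> p) =
     dd A (\<lambda>q. dd A f q (\<eta> q)) p (\<xi> p) - dd A (\<lambda>q. dd A f q (\<xi> q)) p (\<eta> p)"
proof -
  note rX = interior_rep_vf[OF c U(1,2) \<xi>] and rY = interior_rep_vf[OF c U(1,2) \<eta>]
  have "smooth_fun A (U \<inter> V) f" by (rule smooth_fun_subset[OF f U(1)]) auto
  note rF = interior_rep[OF c U(1,2) this]
  let ?F = "cexp V \<phi> f" and ?X = "cexp V \<phi> (comps \<phi> \<xi>)" and ?Y = "cexp V \<phi> (comps \<phi> \<eta>)" and ?x = "\<phi> p"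
  have x: "?x \<in> \<phi> ` (U \<inter> V)" and xi: "?x \<in> interior_img V \<phi>" using U by auto
  have Xp: "dd A \<phi> p (\<xi> p) = ?X ?x" and Yp: "dd A \<phi> p (\<eta> p) = ?Y ?x"
    using chart_inv[OF c U(4)] by simp_all
  have second: "dd A (\<lambda>q. dd A f q (\<zeta> q)) p v = fd (\<lambda>y. fd ?F y (Z ?x)) ?x (dd A \<phi> p v) + fd ?F ?x (fd Z ?x (dd A \<phi> p v))"
    if rZ: "rep V \<phi> (\<phi> ` (U \<inter> V)) (comps \<phi> \<zeta>) Z" for \<zeta> Z v
    unfolding dd_rep[OF c U(4) rep_dd[OF c rF rZ] x] by (rule fd_fd_field[OF rep_Cinf[OF rF] rep_Cinf[OF rZ] x])
  have lin: "linear (dd A \<phi> p)" "linear (fd ?F ?x)"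
    using chart_dd_linear[OF c U(4)] fd_linear[OF rep_Cinf[OF rF] x] by auto
  have chr: "christoffel (G V \<phi>) ?x (?X ?x) (?Y ?x) = christoffel (G V \<phi>) ?x (?Y ?x) (?X ?x)"
    by (rule christoffel_sym[OF G_Cinf[OF c] xi G_props(1)[OF c] G_props(2)[OF c xi]])
  have "dd A \<phi> p (conn V \<phi> \<xi> \<eta> p - conn V \<phi> \<eta> \<xi> p) = fd ?Y ?x (?X ?x) - fd ?X ?x (?Y ?x)"
    unfolding linear_diff[OF lin(1)] conn_comps[OF c U \<eta> rY x] conn_comps[OF c U \<xi> rX x] Xp Yp chr by simp
  then have "dd A f p (conn V \<phi> \<xi> \<eta> p - conn V \<phi> \<eta> \<xi> p) = fd ?F ?x (fd ?Y ?x (?X ?x)) - fd ?F ?x (fd ?X ?x (?Y ?x))"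
    using dd_rep[OF c U(4) rF x] linear_diff[OF lin(2)] by simp
  then show ?thesis
    unfolding second[OF rX] second[OF rY] Xp Yp
    using fd_fd_sym[OF rep_Cinf[OF rF] x, of "?X ?x" "?Y ?x"] by simp
qed

end

context manifold_with_boundary begin

lemma vf_add:
  assumes "\<xi> \<in> vector_fields A U" "\<eta> \<in> vector_fields A U" and U: "open U"
  shows "(\<lambda>q. \<xi> q + \<eta> q) \<in> vector_fields A U"
proof (rule vfI)
  fix p assume p: "p \<in> U"
  obtain V \<phi> where c: "(V, \<phi>) \<in> A" "p \<in> V" using chart_cover by blast
  obtain W1 X where X: "\<phi> p \<in> W1" "rep V \<phi> W1 (comps \<phi> \<xi>) X" using vf_rep[OF assms(1) U c(1) p c(2)] by metis
  obtain W2 Y where Y: "\<phi> p \<in> W2" "rep V \<phi> W2 (comps \<phi> \<eta>) Y" using vf_rep[OF assms(2) U c(1) p c(2)] by metis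
  have op: "open (W1 \<inter> W2)" using rep_open[OF X(2)] rep_open[OF Y(2)] by auto
  have "Cinf_on (W1 \<inter> W2) (\<lambda>x. X x + Y x)"
    by (intro Cinf_on_add Cinf_on_subset[OF rep_Cinf[OF X(2)] op] Cinf_on_subset[OF rep_Cinf[OF Y(2)] op]) auto
  then show "vf_near U (\<lambda>q. \<xi> q + \<eta> q) p"
    using c X Y linear_add[OF chart_dd_linear[OF c(1)]]
    by (intro exI[of _ V] exI[of _ \<phi>] exI[of _ "W1 \<inter> W2"] exI[of _ "\<lambda>x. X x + Y x"]) (auto simp: rep_def)
qed

lemma vf_scale:
  assumes "smooth_fun A U f" "\<eta> \<in> vector_fields A U" and U: "open U"
  shows "(\<lambda>q. f q *\<^sub>R \<eta> q) \<in> vector_fields A U"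
proof (rule vfI)
  fix p assume p: "p \<in> U"
  obtain V \<phi> where c: "(V, \<phi>) \<in> A" "p \<in> V" using chart_cover by blast
  obtain W1 X where X: "\<phi> p \<in> W1" "rep V \<phi> W1 f X" using smooth_fun_rep[OF assms(1) U c(1) p c(2)] by metis
  obtain W2 Y where Y: "\<phi> p \<in> W2" "rep V \<phi> W2 (comps \<phi> \<eta>) Y" using vf_rep[OF assms(2) U c(1) p c(2)] by metis
  have op: "open (W1 \<inter> W2)" using rep_open[OF X(2)] rep_open[OF Y(2)] by auto
  have "Cinf_on (W1 \<inter> W2) (\<lambda>x. X x *\<^sub>R Y x)"
    by (intro Cinf_on_scaleR Cinf_on_subset[OF rep_Cinf[OF X(2)] op] Cinf_on_subset[OF rep_Cinf[OF Y(2)] op]) auto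
  then show "vf_near U (\<lambda>q. f q *\<^sub>R \<eta> q) p"
    using c X Y linear_scale[OF chart_dd_linear[OF c(1)]]
    by (intro exI[of _ V] exI[of _ \<phi>] exI[of _ "W1 \<inter> W2"] exI[of _ "\<lambda>x. X x *\<^sub>R Y x"]) (auto simp: rep_def)
qed

end

context pseudo_riemannian_interior begin

lemma conn_metric:
  assumes c: "(V, \<phi>) \<in> A" and U: "open U" "U \<subseteq> - bdry A" "p \<in> U" "p \<in> V"
    and \<eta>: "\<eta> \<in> vector_fields A U" and \<zeta>: "\<zeta> \<in> vector_fields A U"
  shows "dd A (\<lambda>q. g q (\<eta> q) (\<zeta> q)) p (\<xi> p) = g p (conn V \<phi> \<xi> \<eta> p) (\<zeta> p) + g p (\<eta> p) (conn V \<phi> \<xi> \<zeta> p)"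
proof -
  note rY = interior_rep_vf[OF c U(1,2) \<eta>] and rZ = interior_rep_vf[OF c U(1,2) \<zeta>]
  let ?S = "\<phi> ` (U \<inter> V)" and ?Y = "cexp V \<phi> (comps \<phi> \<eta>)" and ?Z = "cexp V \<phi> (comps \<phi> \<zeta>)" and ?x = "\<phi> p"
    and ?u = "dd A \<phi> p (\<xi> p)"
  have x: "?x \<in> ?S" and xi: "?x \<in> interior_img V \<phi>" using U by auto
  have GS: "Cinf_on ?S (G V \<phi>)" by (rule Cinf_on_subset[OF G_Cinf[OF c] rep_open[OF rY]]) (use U in auto)
  have "rep V \<phi> ?S (\<lambda>q. g q (\<eta> q) (\<zeta> q)) (\<lambda>x. ?Y x \<bullet> (G V \<phi> x *v ?Z x))"
  proof -
    have "Cinf_on ?S (\<lambda>x. ?Y x \<bullet> (G V \<phi> x *v ?Z x))"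
      by (intro Cinf_on_inner Cinf_on_mv rep_Cinf[OF rY] rep_Cinf[OF rZ] GS)
    moreover have "g q (\<eta> q) (\<zeta> q) = ?Y (\<phi> q) \<bullet> (G V \<phi> (\<phi> q) *v ?Z (\<phi> q))" if "q \<in> V" "\<phi> q \<in> ?S" for q
    proof -
      have "q \<in> U" using that chart_inj[OF c] by (auto dest: inj_onD)
      then show ?thesis using g_gram[OF c, of q] that U(2) chart_inv[OF c that(1)] by auto
    qed
    ultimately show ?thesis using rY by (simp add: rep_def)
  qed
  from dd_rep[OF c U(4) this x]
  have "dd A (\<lambda>q. g q (\<eta> q) (\<zeta> q)) p (\<xi> p) = fd (\<lambda>x. ?Y x \<bullet> (G V \<phi> x *v ?Z x)) ?x ?u" .
  also have "fd (\<lambda>x. ?Y x \<bullet> (G V \<phi> x *v ?Z x)) ?x = (\<lambda>u. ?Y ?x \<bullet> (G V \<phi> ?x *v fd ?Z ?x u + fd (G V \<phi>) ?x u *v ?Z ?x) + fd ?Y ?x u \<bullet> (G V \<phi> ?x *v ?Z ?x))"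
    by (rule fd_eq, rule bounded_bilinear.FDERIV[OF bounded_bilinear_inner Cinf_on_has_derivative[OF rep_Cinf[OF rY] x]
          bounded_bilinear.FDERIV[OF bounded_bilinear_mv Cinf_on_has_derivative[OF GS x] Cinf_on_has_derivative[OF rep_Cinf[OF rZ] x]]])
  finally have 1: "dd A (\<lambda>q. g q (\<eta> q) (\<zeta> q)) p (\<xi> p) =
     ?Y ?x \<bullet> (G V \<phi> ?x *v fd ?Z ?x ?u + fd (G V \<phi>) ?x ?u *v ?Z ?x) + fd ?Y ?x ?u \<bullet> (G V \<phi> ?x *v ?Z ?x)" .
  have Yp: "dd A \<phi> p (\<eta> p) = ?Y ?x" and Zp: "dd A \<phi> p (\<zeta> p) = ?Z ?x" and Gp: "gram g \<phi> p = G V \<phi> ?x"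
    using chart_inv[OF c U(4)] by simp_all
  have pV: "p \<in> V - bdry A" using U by auto
  have 2: "g p (conn V \<phi> \<xi> \<eta> p) (\<zeta> p) + g p (\<eta> p) (conn V \<phi> \<xi> \<zeta> p) =
     (fd ?Y ?x ?u + christoffel (G V \<phi>) ?x ?u (?Y ?x)) \<bullet> (G V \<phi> ?x *v ?Z ?x) +
     ?Y ?x \<bullet> (G V \<phi> ?x *v (fd ?Z ?x ?u + christoffel (G V \<phi>) ?x ?u (?Z ?x)))"
    unfolding g_gram[OF c pV] conn_comps[OF c U \<eta> rY x] conn_comps[OF c U \<zeta> rZ x] Yp Zp Gp by simp
  have 3: "christoffel (G V \<phi>) ?x ?u (?Y ?x) \<bullet> (G V \<phi> ?x *v ?Z ?x) + ?Y ?x \<bullet> (G V \<phi> ?x *v christoffel (G V \<phi>) ?x ?u (?Z ?x))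
      = ?Y ?x \<bullet> (fd (G V \<phi>) ?x ?u *v ?Z ?x)"
    by (rule christoffel_metric[OF G_Cinf[OF c] xi G_props(1)[OF c] G_props(2)[OF c xi]])
  show ?thesis unfolding 1 2
    using 3 by (simp add: inner_add_left inner_add_right matrix_vector_right_distrib)
qed

text \<open>Two torsion-free metric connections differ by a tensor \<open>b(\<xi>, \<eta>, \<zeta>)\<close> that is symmetric in the first
  two and skew in the last two arguments, hence zero. So the chart connections agree on overlaps.\<close>

lemma conn_independent:
  assumes c: "(V, \<phi>) \<in> A" "p \<in> V" and c': "(V', \<phi>') \<in> A" "p \<in> V'"
    and U: "open U" "U \<subseteq> - bdry A" "p \<in> U" and \<xi>: "\<xi> \<in> vector_fields A U" and \<eta>: "\<eta> \<in> vector_fields A U"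
  shows "conn V \<phi> \<xi> \<eta> p = conn V' \<phi>' \<xi> \<eta> p"
proof -
  let ?O = "U \<inter> V"
  have O: "open ?O" "?O \<subseteq> - bdry A" "p \<in> ?O" using U c chart_open[OF c(1)] by auto
  have pM: "p \<notin> bdry A" using U by auto
  define B where "B \<xi> \<eta> = conn V \<phi> \<xi> \<eta> p - conn V' \<phi>' \<xi> \<eta> p" for \<xi> \<eta>
  let ?vf = "vector_fields A ?O"
  have sym: "B \<xi> \<eta> = B \<eta> \<xi>" if "\<xi> \<in> ?vf" "\<eta> \<in> ?vf" for \<xi> \<eta>
  proof -
    have "dd A \<phi> p (B \<xi> \<eta> - B \<eta> \<xi>) $ i = 0" for i
    proof -
      have f: "smooth_fun A ?O (\<lambda>q. \<phi> q $ i)" "smooth_fun A ?O \<phi>"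
        using smooth_fun_compose[OF smooth_fun_chart[OF c(1)] chart_open[OF c(1)] Cinf_on_bounded_linear[OF bounded_linear_vec_nth Cinf_on_ident[OF open_UNIV]]]
          smooth_fun_chart[OF c(1)] smooth_fun_subset chart_open[OF c(1)] by (metis UNIV_I inf_le2)+
      have lin: "linear (dd A (\<lambda>q. \<phi> q $ i) p)" by (rule dd_linear[OF f(1) O(1,3)])
      have "B \<xi> \<eta> - B \<eta> \<xi> = (conn V \<phi> \<xi> \<eta> p - conn V \<phi> \<eta> \<xi> p) - (conn V' \<phi>' \<xi> \<eta> p - conn V' \<phi>' \<eta> \<xi> p)"
        by (simp add: B_def)
      then have "dd A (\<lambda>q. \<phi> q $ i) p (B \<xi> \<eta> - B \<eta> \<xi>) = 0"
        using conn_torsion_free[OF c(1) O c(2) that f(1)] conn_torsion_free[OF c'(1) O c'(2) that f(1)]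
        by (simp add: linear_diff[OF lin])
      then show ?thesis using dd_bounded_linear[OF f(2) O(1,3) bounded_linear_vec_nth] by metis
    qed
    then have "dd A \<phi> p (B \<xi> \<eta> - B \<eta> \<xi>) = dd A \<phi> p 0"
      using linear_0[OF chart_dd_linear[OF c]] by (simp add: vec_eq_iff)
    then show ?thesis using dd_chart_cancel[OF c] by simp
  qed
  note bl = g_bilinear[OF pM]
  have skew: "g p (B \<xi> \<eta>) (\<zeta> p) = - g p (B \<xi> \<zeta>) (\<eta> p)" if "\<eta> \<in> ?vf" "\<zeta> \<in> ?vf" for \<xi> \<eta> \<zeta>
    using conn_metric[OF c(1) O c(2) that, of \<xi>] conn_metric[OF c'(1) O c'(2) that, of \<xi>] g_sym[OF pM]
    unfolding B_def bilinear_lsub[OF bl] by (simp add: algebra_simps)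
  have \<xi>O: "\<xi> \<in> ?vf" and \<eta>O: "\<eta> \<in> ?vf" using vf_subset[OF \<xi> U(1)] vf_subset[OF \<eta> U(1)] by auto
  have "g p (B \<xi> \<eta>) w = 0" for w
  proof -
    let ?\<zeta> = "\<lambda>q. from_coords \<phi> q (dd A \<phi> p w)"
    have \<zeta>: "?\<zeta> \<in> ?vf"
      by (rule vf_subset[OF vf_of_coords[OF c(1) Cinf_on_const[OF open_UNIV]]]) (auto simp: chart_open[OF c(1)])
    have "g p (B \<xi> \<eta>) (?\<zeta> p) = - g p (B ?\<zeta> \<xi>) (\<eta> p)"
      using skew[OF \<eta>O \<zeta>, of \<xi>] sym[OF \<xi>O \<zeta>] by simp
    also have "\<dots> = g p (B \<eta> ?\<zeta>) (\<xi> p)"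
      using skew[OF \<xi>O \<eta>O, of ?\<zeta>] sym[OF \<zeta> \<eta>O] by simp
    also have "\<dots> = - g p (B \<xi> \<eta>) (?\<zeta> p)"
      using skew[OF \<zeta> \<xi>O, of \<eta>] sym[OF \<xi>O \<eta>O] by simp
    finally show ?thesis by (simp add: from_coords_dd[OF c])
  qed
  then have "B \<xi> \<eta> = 0" using g_nondeg[OF pM] by blast
  then show ?thesis by (simp add: B_def)
qed

text \<open>Each point uses the chart that represents its tangent vectors. The choice is immaterial, but it
  varies from point to point, and smoothness rests on the independence of charts.\<close>

definition LC :: "('a, 'n) connection" where
  "LC \<xi> \<eta> p = conn (fst (chart_at A p)) (snd (chart_at A p)) \<xi> \<eta> p"

lemma LC_conn:
  assumes "(V, \<phi>) \<in> A" "p \<in> V" "open U" "U \<subseteq> - bdry A" "p \<in> U" "\<xi> \<in> vector_fields A U" "\<eta> \<in> vector_fields A U"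
  shows "LC \<xi> \<eta> p = conn V \<phi> \<xi> \<eta> p"
proof -
  obtain V' \<phi>' where c': "chart_at A p = (V', \<phi>')" by (cases "chart_at A p")
  show ?thesis unfolding LC_def c' fst_conv snd_conv
    by (rule conn_independent[OF chart_at[OF c'] assms])
qed

lemma LC_comps:
  assumes c: "(V, \<phi>) \<in> A" "p \<in> V" and U: "open U" "U \<subseteq> - bdry A" "p \<in> U"
    and \<xi>: "\<xi> \<in> vector_fields A U" and \<eta>: "\<eta> \<in> vector_fields A U"
    and Y: "rep V \<phi> W (comps \<phi> \<eta>) Y" "\<phi> p \<in> W"
  shows "dd A \<phi> p (LC \<xi> \<eta> p) = fd Y (\<phi> p) (dd A \<phi> p (\<xi> p)) +
     christoffel (G V \<phi>) (\<phi> p) (dd A \<phi> p (\<xi> p)) (dd A \<phi> p (\<eta> p))"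
  using LC_conn[OF c U \<xi> \<eta>] conn_comps[OF c(1) U c(2) \<eta> Y] by simp

lemma LC_vf:
  assumes "open U" "U \<subseteq> - bdry A" "\<xi> \<in> vector_fields A U" "\<eta> \<in> vector_fields A U"
  shows "LC \<xi> \<eta> \<in> vector_fields A U"
proof (rule vf_local)
  fix p assume p: "p \<in> U"
  obtain V \<phi> where c: "(V, \<phi>) \<in> A" "p \<in> V" using chart_cover by blast
  show "\<exists>O' \<xi>'. open O' \<and> p \<in> O' \<and> \<xi>' \<in> vector_fields A O' \<and> (\<forall>q\<in>O' \<inter> U. \<xi>' q = LC \<xi> \<eta> q)"
    using conn_vf[OF c(1) assms] chart_open[OF c(1)] c p assms(1) LC_conn[OF c(1) _ assms(1,2) _ assms(3,4)]
    by (intro exI[of _ "U \<inter> V"] exI[of _ "conn V \<phi> \<xi> \<eta>"]) auto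
qed

lemma christoffel_lin:
  assumes "(V, \<phi>) \<in> A" "p \<in> V - bdry A"
  shows "linear (christoffel (G V \<phi>) (\<phi> p) u)" "linear (\<lambda>u. christoffel (G V \<phi>) (\<phi> p) u v)"
proof -
  have x: "\<phi> p \<in> interior_img V \<phi>" using assms(2) by blast
  show "linear (christoffel (G V \<phi>) (\<phi> p) u)" "linear (\<lambda>u. christoffel (G V \<phi>) (\<phi> p) u v)"
    by (rule christoffel_linear[OF G_Cinf[OF assms(1)] x G_props(1)[OF assms(1)] G_props(2)[OF assms(1) x]], assumption)+
qed

lemma LC_cong:
  assumes U: "open U" "U \<subseteq> - bdry A" "p \<in> U"
    and vf: "\<xi> \<in> vector_fields A U" "\<xi>' \<in> vector_fields A U" "\<eta> \<in> vector_fields A U" "\<eta>' \<in> vector_fields A U"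
    and eq: "\<And>q. q \<in> U \<Longrightarrow> \<xi> q = \<xi>' q \<and> \<eta> q = \<eta>' q"
  shows "LC \<xi> \<eta> p = LC \<xi>' \<eta>' p"
proof -
  obtain V \<phi> where c: "(V, \<phi>) \<in> A" "p \<in> V" using chart_cover by blast
  have x: "\<phi> p \<in> \<phi> ` (U \<inter> V)" using c U by blast
  note r = interior_rep_vf[OF c(1) U(1,2) vf(3)]
  have r': "rep V \<phi> (\<phi> ` (U \<inter> V)) (comps \<phi> \<eta>') (cexp V \<phi> (comps \<phi> \<eta>))"
  proof -
    have "q \<in> U" if "q \<in> V" "\<phi> q \<in> \<phi> ` (U \<inter> V)" for q
      using that chart_inj[OF c(1)] by (auto dest: inj_onD)
    then show ?thesis using r eq by (auto simp: rep_def)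
  qed
  have "dd A \<phi> p (LC \<xi> \<eta> p) = dd A \<phi> p (LC \<xi>' \<eta>' p)"
    unfolding LC_comps[OF c U vf(1,3) r x] LC_comps[OF c U vf(2,4) r' x] using eq[OF U(3)] by simp
  then show ?thesis using dd_chart_cancel[OF c] by simp
qed

lemma LC_add_left:
  assumes U: "open U" "U \<subseteq> - bdry A" "p \<in> U"
    and vf: "\<xi> \<in> vector_fields A U" "\<xi>' \<in> vector_fields A U" "\<eta> \<in> vector_fields A U"
  shows "LC (\<lambda>q. \<xi> q + \<xi>' q) \<eta> p = LC \<xi> \<eta> p + LC \<xi>' \<eta> p"
proof -
  obtain V \<phi> where c: "(V, \<phi>) \<in> A" "p \<in> V" using chart_cover by blast
  have x: "\<phi> p \<in> \<phi> ` (U \<inter> V)" and pV: "p \<in> V - bdry A" using c U by auto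
  note r = interior_rep_vf[OF c(1) U(1,2) vf(3)]
  note lin = linear_add[OF chart_dd_linear[OF c]] linear_add[OF christoffel_lin(2)[OF c(1) pV]] linear_add[OF fd_linear[OF rep_Cinf[OF r] x]]
  have "dd A \<phi> p (LC (\<lambda>q. \<xi> q + \<xi>' q) \<eta> p) = dd A \<phi> p (LC \<xi> \<eta> p + LC \<xi>' \<eta> p)"
    unfolding lin(1) LC_comps[OF c U vf_add[OF vf(1,2) U(1)] vf(3) r x] LC_comps[OF c U vf(1,3) r x] LC_comps[OF c U vf(2,3) r x] lin
    by simp
  then show ?thesis using dd_chart_cancel[OF c] by simp
qed

lemma LC_scale_left:
  assumes U: "open U" "U \<subseteq> - bdry A" "p \<in> U" and f: "smooth_fun A U f"
    and vf: "\<xi> \<in> vector_fields A U" "\<eta> \<in> vector_fields A U"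
  shows "LC (\<lambda>q. f q *\<^sub>R \<xi> q) \<eta> p = f p *\<^sub>R LC \<xi> \<eta> p"
proof -
  obtain V \<phi> where c: "(V, \<phi>) \<in> A" "p \<in> V" using chart_cover by blast
  have x: "\<phi> p \<in> \<phi> ` (U \<inter> V)" and pV: "p \<in> V - bdry A" using c U by auto
  note r = interior_rep_vf[OF c(1) U(1,2) vf(2)]
  note lin = linear_scale[OF chart_dd_linear[OF c]] linear_scale[OF christoffel_lin(2)[OF c(1) pV]] linear_scale[OF fd_linear[OF rep_Cinf[OF r] x]]
  have "dd A \<phi> p (LC (\<lambda>q. f q *\<^sub>R \<xi> q) \<eta> p) = dd A \<phi> p (f p *\<^sub>R LC \<xi> \<eta> p)"
    unfolding lin(1) LC_comps[OF c U vf_scale[OF f vf(1) U(1)] vf(2) r x] LC_comps[OF c U vf r x] lin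
    by (simp add: scaleR_add_right)
  then show ?thesis using dd_chart_cancel[OF c] by simp
qed

lemma LC_add_right:
  assumes U: "open U" "U \<subseteq> - bdry A" "p \<in> U"
    and vf: "\<xi> \<in> vector_fields A U" "\<eta> \<in> vector_fields A U" "\<eta>' \<in> vector_fields A U"
  shows "LC \<xi> (\<lambda>q. \<eta> q + \<eta>' q) p = LC \<xi> \<eta> p + LC \<xi> \<eta>' p"
proof -
  obtain V \<phi> where c: "(V, \<phi>) \<in> A" "p \<in> V" using chart_cover by blast
  have x: "\<phi> p \<in> \<phi> ` (U \<inter> V)" and pV: "p \<in> V - bdry A" using c U by auto
  note r = interior_rep_vf[OF c(1) U(1,2) vf(2)] and r' = interior_rep_vf[OF c(1) U(1,2) vf(3)]
  have rs: "rep V \<phi> (\<phi> ` (U \<inter> V)) (comps \<phi> (\<lambda>q. \<eta> q + \<eta>' q)) (\<lambda>x. cexp V \<phi> (comps \<phi> \<eta>) x + cexp V \<phi> (comps \<phi> \<eta>') x)"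
    using r r' linear_add[OF chart_dd_linear[OF c(1)]] by (auto simp: rep_def intro: Cinf_on_add)
  note lin = linear_add[OF chart_dd_linear[OF c]] linear_add[OF christoffel_lin(1)[OF c(1) pV]]
  have "dd A \<phi> p (LC \<xi> (\<lambda>q. \<eta> q + \<eta>' q) p) = dd A \<phi> p (LC \<xi> \<eta> p + LC \<xi> \<eta>' p)"
    unfolding lin(1) LC_comps[OF c U vf(1) vf_add[OF vf(2,3) U(1)] rs x] LC_comps[OF c U vf(1,2) r x] LC_comps[OF c U vf(1,3) r' x] lin
      fd_eq[OF has_derivative_add[OF Cinf_on_has_derivative[OF rep_Cinf[OF r] x] Cinf_on_has_derivative[OF rep_Cinf[OF r'] x]]]
    by simp
  then show ?thesis using dd_chart_cancel[OF c] by simp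
qed

lemma LC_scale_right:
  assumes U: "open U" "U \<subseteq> - bdry A" "p \<in> U" and f: "smooth_fun A U f"
    and vf: "\<xi> \<in> vector_fields A U" "\<eta> \<in> vector_fields A U"
  shows "LC \<xi> (\<lambda>q. f q *\<^sub>R \<eta> q) p = f p *\<^sub>R LC \<xi> \<eta> p + dd A f p (\<xi> p) *\<^sub>R \<eta> p"
proof -
  obtain V \<phi> where c: "(V, \<phi>) \<in> A" "p \<in> V" using chart_cover by blast
  have x: "\<phi> p \<in> \<phi> ` (U \<inter> V)" and pV: "p \<in> V - bdry A" using c U by auto
  have "smooth_fun A (U \<inter> V) f" by (rule smooth_fun_subset[OF f U(1)]) auto
  note r = interior_rep_vf[OF c(1) U(1,2) vf(2)] and rf = interior_rep[OF c(1) U(1,2) this]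
  have rs: "rep V \<phi> (\<phi> ` (U \<inter> V)) (comps \<phi> (\<lambda>q. f q *\<^sub>R \<eta> q)) (\<lambda>x. cexp V \<phi> f x *\<^sub>R cexp V \<phi> (comps \<phi> \<eta>) x)"
    using r rf linear_scale[OF chart_dd_linear[OF c(1)]] by (auto simp: rep_def intro: Cinf_on_scaleR)
  note lin = linear_add[OF chart_dd_linear[OF c]] linear_scale[OF chart_dd_linear[OF c]] linear_scale[OF christoffel_lin(1)[OF c(1) pV]]
  have "dd A \<phi> p (LC \<xi> (\<lambda>q. f q *\<^sub>R \<eta> q) p) = dd A \<phi> p (f p *\<^sub>R LC \<xi> \<eta> p + dd A f p (\<xi> p) *\<^sub>R \<eta> p)"
    unfolding lin(1,2) LC_comps[OF c U vf(1) vf_scale[OF f vf(2) U(1)] rs x] LC_comps[OF c U vf r x] lin dd_rep[OF c rf x]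
      fd_eq[OF bounded_bilinear.FDERIV[OF bounded_bilinear_scaleR Cinf_on_has_derivative[OF rep_Cinf[OF rf] x] Cinf_on_has_derivative[OF rep_Cinf[OF r] x]]]
    using chart_inv[OF c] by (simp add: scaleR_add_right)
  then show ?thesis using dd_chart_cancel[OF c] by simp
qed

lemma LC_linear_connection: "linear_connection A (- bdry A) LC"
  unfolding linear_connection_def
  by (intro allI impI conjI ballI; elim conjE)
    (auto intro: LC_vf LC_cong LC_add_left LC_add_right LC_scale_left LC_scale_right)

lemma LC_torsion_free: "torsion_free A (- bdry A) LC"
  unfolding torsion_free_def
proof (intro allI impI ballI; elim conjE)
  fix U \<xi> \<eta> p and f :: "'a \<Rightarrow> real"
  assume *: "\<xi> \<in> vector_fields A U" "\<eta> \<in> vector_fields A U" "smooth_fun A U f" "p \<in> U" "open U" "U \<subseteq> - bdry A"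
  obtain V \<phi> where c: "(V, \<phi>) \<in> A" "p \<in> V" using chart_cover by blast
  show "dd A f p (LC \<xi> \<eta> p - LC \<eta> \<xi> p) = dd A (\<lambda>q. dd A f q (\<eta> q)) p (\<xi> p) - dd A (\<lambda>q. dd A f q (\<xi> q)) p (\<eta> p)"
    unfolding LC_conn[OF c *(5,6,4,1,2)] LC_conn[OF c *(5,6,4,2,1)]
    by (rule conn_torsion_free[OF c(1) *(5,6,4) c(2) *(1,2,3)])
qed

lemma LC_metric:
  assumes "open U" "U \<subseteq> - bdry A" "p \<in> U" "\<xi> \<in> vector_fields A U" "\<eta> \<in> vector_fields A U" "\<zeta> \<in> vector_fields A U"
  shows "dd A (\<lambda>q. g q (\<eta> q) (\<zeta> q)) p (\<xi> p) = g p (LC \<xi> \<eta> p) (\<zeta> p) + g p (\<eta> p) (LC \<xi> \<zeta> p)"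
proof -
  obtain V \<phi> where c: "(V, \<phi>) \<in> A" "p \<in> V" using chart_cover by blast
  show ?thesis
    unfolding LC_conn[OF c assms(1,2,3,4,5)] LC_conn[OF c assms(1,2,3,4,6)]
    by (rule conn_metric[OF c(1) assms(1,2,3) c(2) assms(5,6)])
qed

lemma LC_levi_civita: "levi_civita A (- bdry A) g LC"
  unfolding levi_civita_def using LC_linear_connection LC_torsion_free LC_metric by blast

section \<open>The Riemannian density\<close>

definition gram_frame :: "'a \<Rightarrow> ('n \<Rightarrow> real^'n) \<Rightarrow> real^'n^'n" where
  "gram_frame p v = (\<chi> i j. g p (v i) (v j))"

definition density :: "'a \<Rightarrow> ('n \<Rightarrow> real^'n) \<Rightarrow> real" where
  "density p v = sqrt \<bar>det (gram_frame p v)\<bar>"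

lemma bilinear_sums:
  fixes b :: "real^'n \<Rightarrow> real^'n \<Rightarrow> real"
  assumes "bilinear b"
  shows "b (\<Sum>i\<in>UNIV. x i *\<^sub>R v i) (\<Sum>j\<in>UNIV. y j *\<^sub>R w j) = (\<Sum>i\<in>UNIV. x i * (\<Sum>j\<in>UNIV. y j * b (v i) (w j)))"
proof -
  have l: "linear (\<lambda>u. b u z)" "linear (b z)" for z using assms by (auto simp: bilinear_def)
  have 1: "b (\<Sum>i\<in>UNIV. x i *\<^sub>R v i) z = (\<Sum>i\<in>UNIV. x i * b (v i) z)" for z
    by (simp add: linear_sum[OF l(1)] linear_scale[OF l(1)])
  have 2: "b u (\<Sum>j\<in>UNIV. y j *\<^sub>R w j) = (\<Sum>j\<in>UNIV. y j * b u (w j))" for u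
    by (simp add: linear_sum[OF l(2)] linear_scale[OF l(2)])
  show ?thesis unfolding 1 unfolding 2 ..
qed

text \<open>A kernel vector of the Gram matrix is the coordinate vector of a tangent vector that is orthogonal to
  the whole frame.\<close>

lemma gram_frame_det:
  assumes p: "p \<notin> bdry A" and v: "is_frame v"
  shows "det (gram_frame p v) \<noteq> 0"
proof
  assume "det (gram_frame p v) = 0"
  then obtain x where x: "x \<noteq> 0" "gram_frame p v *v x = 0"
    by (metis invertible_det_nz invertible_left_inverse matrix_left_invertible_ker)
  note bl = g_bilinear[OF p]
  define L :: "real^'n \<Rightarrow> real^'n" where "L y = (\<Sum>j\<in>UNIV. y $ j *\<^sub>R v j)" for y
  have L: "linear L" unfolding L_def
    by (rule linearI) (simp_all add: scaleR_add_left sum.distrib scaleR_sum_right)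
  have "v i \<in> range L" for i
  proof -
    have "v i = L (axis i 1)" by (simp add: L_def axis_def if_distrib if_distribR cong: if_cong)
    then show ?thesis by blast
  qed
  then have "span (range v) \<subseteq> range L"
    using linear_subspace_image[OF L subspace_UNIV] by (intro span_minimal) auto
  then have "surj L" using v unfolding is_frame_def by auto
  then have inj: "inj L" using linear_surjective_imp_injective[OF L] by blast
  have "g p (L x) w = 0" for w
  proof -
    obtain y where y: "w = L y" using \<open>surj L\<close> by blast
    have "g p w (L x) = (\<Sum>i\<in>UNIV. y $ i * (\<Sum>j\<in>UNIV. x $ j * g p (v i) (v j)))"
      unfolding y L_def
      by (rule bilinear_sums[OF bl])
    also have "\<dots> = (\<Sum>i\<in>UNIV. y $ i * (gram_frame p v *v x) $ i)"
      by (simp add: gram_frame_def matrix_vector_mult_def mult.commute)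
    finally show ?thesis using x(2) g_sym[OF p] by simp
  qed
  then have "L x = 0" using g_nondeg[OF p] by blast
  then show False using inj linear_0[OF L] x(1) by (metis injD)
qed

lemma gram_frame_transform:
  assumes p: "p \<notin> bdry A"
  shows "gram_frame p (\<lambda>i. \<Sum>j\<in>UNIV. a $ i $ j *\<^sub>R v j) = a ** gram_frame p v ** transpose a"
proof -
  note bl = g_bilinear[OF p]
  show ?thesis
    by (simp add: gram_frame_def vec_eq_iff matrix_matrix_mult_def transpose_def bilinear_sums[OF bl]
        sum_distrib_left sum_distrib_right, subst sum.swap, simp add: mult_ac)
qed

lemma gram_frame_smooth:
  assumes "open U" "U \<subseteq> - bdry A" "\<And>i. X i \<in> vector_fields A U"
  shows "smooth_fun A U (\<lambda>q. gram_frame q (\<lambda>i. X i q))"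
  unfolding gram_frame_def
  by (intro smooth_fun_vec assms(1)) (use g_smooth assms in \<open>auto simp: smooth_sym_tensor_def\<close>)

lemma density_volume_density: "volume_density A (- bdry A) density"
  unfolding volume_density_def
proof (intro conjI ballI allI impI; (elim conjE)?)
  fix p v and a :: "real^'n^'n" assume "p \<in> - bdry A"
  then show "density p (\<lambda>i. \<Sum>j\<in>UNIV. a $ i $ j *\<^sub>R v j) = \<bar>det a\<bar> * density p v"
    by (simp add: density_def gram_frame_transform det_mul det_transpose abs_mult real_sqrt_mult)
next
  fix p v assume "p \<in> - bdry A" "is_frame (v :: 'n \<Rightarrow> real^'n)"
  then show "density p v \<noteq> 0" using gram_frame_det by (simp add: density_def)
next
  fix U X assume U: "open U" "U \<subseteq> - bdry A" and X: "X \<in> frame_fields A U"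
  show "smooth_fun A U (\<lambda>p. density p (\<lambda>i. X i p))"
    unfolding density_def
    by (rule smooth_fun_compose[OF gram_frame_smooth[OF U] U(1) Cinf_on_sqrt_abs_det])
      (use X U gram_frame_det in \<open>auto simp: frame_fields_def\<close>)
qed

text \<open>If \<open>a\<close> is the connection matrix in a frame, metricity says that the Gram matrix \<open>M\<close> of the frame has
  derivative \<open>a M + M a\<^sup>T\<close>.\<close>

lemma LC_preserves_density: "preserves_density A (- bdry A) LC density"
  unfolding preserves_density_def
proof (intro allI impI ballI; elim conjE)
  fix U X \<xi> p and a :: "real^'n^'n"
  assume U: "open U" "U \<subseteq> - bdry A" and X: "X \<in> frame_fields A U" and \<xi>: "\<xi> \<in> vector_fields A U" and p: "p \<in> U"
    and a: "\<forall>i. LC \<xi> (X i) p = (\<Sum>j\<in>UNIV. a $ i $ j *\<^sub>R X j p)"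
  let ?G = "\<lambda>q. gram_frame q (\<lambda>i. X i q)"
  have vf: "X i \<in> vector_fields A U" for i using X by (simp add: frame_fields_def)
  have pM: "p \<notin> bdry A" using U p by auto
  note bl = g_bilinear[OF pM] and sm = gram_frame_smooth[OF U vf]
  have nz: "det (?G p) \<noteq> 0" by (rule gram_frame_det[OF pM]) (use X p in \<open>simp add: frame_fields_def\<close>)
  have "dd A ?G p (\<xi> p) $ i $ j = (a ** ?G p + ?G p ** transpose a) $ i $ j" for i j
  proof -
    have "dd A ?G p (\<xi> p) $ i $ j = dd A (\<lambda>q. ?G q $ i $ j) p (\<xi> p)"
      by (rule dd_bounded_linear[OF sm U(1) p bounded_linear_compose[OF bounded_linear_vec_nth bounded_linear_vec_nth], symmetric])
    also have "\<dots> = dd A (\<lambda>q. g q (X i q) (X j q)) p (\<xi> p)" by (simp add: gram_frame_def)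
    also have "\<dots> = g p (LC \<xi> (X i) p) (X j p) + g p (X i p) (LC \<xi> (X j) p)" by (rule LC_metric[OF U p \<xi> vf vf])
    also have "\<dots> = (a ** ?G p + ?G p ** transpose a) $ i $ j"
    proof -
      have l: "linear (\<lambda>u. g p u z)" "linear (g p z)" for z using bl by (auto simp: bilinear_def)
      show ?thesis
        using a by (simp add: matrix_matrix_mult_def transpose_def gram_frame_def linear_sum[OF l(1)] linear_sum[OF l(2)]
          linear_scale[OF l(1)] linear_scale[OF l(2)] mult.commute)
    qed
    finally show ?thesis .
  qed
  then have "dd A ?G p (\<xi> p) = a ** ?G p + ?G p ** transpose a" by (simp add: vec_eq_iff)
  then have "dd A (\<lambda>q. density q (\<lambda>i. X i q)) p (\<xi> p) = fd (\<lambda>M. sqrt \<bar>det M\<bar>) (?G p) (a ** ?G p + ?G p ** transpose a)"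
    unfolding density_def using dd_chain[OF sm U(1) p Cinf_on_sqrt_abs_det] nz by simp
  then show "dd A (\<lambda>q. density q (\<lambda>i. X i q)) p (\<xi> p) = trace a * density p (\<lambda>i. X i p)"
    using fd_sqrt_abs_det[OF nz] by (simp add: density_def)
qed

lemma LC_special: "special_connection A (- bdry A) LC"
  unfolding special_connection_def
  using LC_linear_connection LC_torsion_free density_volume_density LC_preserves_density by blast

end

section \<open>The asymptotic identity\<close>

text \<open>The situation near a boundary point \<open>x0\<close> in coordinates: \<open>\<rho>\<close>, \<open>C\<close> and \<open>h\<close> are smooth across the boundary,
  whereas the matrix \<open>G\<close> of the metric lives on the interior part \<open>Wp\<close> only. The direction \<open>e\<close> is
  transversal to the boundary.\<close>

locale asymptotic_coords =
  fixes W :: "(real^'n::finite) set" and x0 :: "real^'n" and \<rho> C :: "real^'n \<Rightarrow> real"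
    and h G :: "real^'n \<Rightarrow> real^'n^'n" and e :: "real^'n" and Wp :: "(real^'n) set"
  assumes x0: "x0 \<in> W" "\<rho> x0 = 0"
    and \<rho>: "Cinf_on W \<rho>" and C: "Cinf_on W C" and h: "Cinf_on W h"
    and C_nz: "\<And>x. x \<in> W \<Longrightarrow> C x \<noteq> 0" and e_nz: "\<And>x. x \<in> W \<Longrightarrow> fd \<rho> x e \<noteq> 0"
    and Wp: "Wp \<subseteq> W" and G: "Cinf_on Wp G"
    and G_sym: "\<And>x. x \<in> Wp \<Longrightarrow> transpose (G x) = G x" and G_det: "\<And>x. x \<in> Wp \<Longrightarrow> det (G x) \<noteq> 0"
    and \<rho>_nz: "\<And>x. x \<in> Wp \<Longrightarrow> \<rho> x \<noteq> 0"
    and form: "\<And>x v w. x \<in> Wp \<Longrightarrow> \<rho> x ^ 4 * (v \<bullet> (G x *v w)) = \<rho> x ^ 2 * (v \<bullet> (h x *v w)) + C x * (fd \<rho> x v * fd \<rho> x w)"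
    and nondeg: "\<And>v. fd \<rho> x0 v = 0 \<Longrightarrow> (\<And>w. fd \<rho> x0 w = 0 \<Longrightarrow> v \<bullet> (h x0 *v w) = 0) \<Longrightarrow> v = 0"
begin

abbreviation r :: "real^'n \<Rightarrow> real^'n \<Rightarrow> real" where "r x \<equiv> fd \<rho> x"
abbreviation rr :: "real^'n \<Rightarrow> real^'n \<Rightarrow> real^'n \<Rightarrow> real" where "rr x u v \<equiv> fd (\<lambda>y. fd \<rho> y v) x u"

lemma r_lin: "x \<in> W \<Longrightarrow> linear (r x)" by (rule fd_linear[OF \<rho>])

text \<open>The coefficients of \<open>\<nabla>\<^sup>\<rho>\<close>, just as the Christoffel vectors are those of the Levi-Civita
  connection.\<close>

definition N :: "real^'n \<Rightarrow> real^'n \<Rightarrow> real^'n \<Rightarrow> real^'n" where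
  "N x u v = christoffel G x u v + (r x u / \<rho> x) *\<^sub>R v + (r x v / \<rho> x) *\<^sub>R u"

text \<open>The smooth right-hand side in \<open>asymptotic_identity\<close>.\<close>

definition R :: "real^'n \<Rightarrow> real^'n \<Rightarrow> real^'n \<Rightarrow> real^'n \<Rightarrow> real" where
  "R x u v w = \<rho> x ^ 2 / 2 * koszul h x u v w + \<rho> x * r x w * (u \<bullet> (h x *v v))
     + (fd C x u * r x v * r x w + fd C x v * r x u * r x w - fd C x w * r x u * r x v) / 2 + C x * rr x u v * r x w"

text \<open>Differentiating \<open>\<rho>\<^sup>4 G = \<rho>\<^sup>2 h + C r r\<close> instead of solving for \<open>G\<close> first keeps the Koszul formula free of
  denominators.\<close>

lemma form_derivative:
  assumes x: "x \<in> Wp"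
  shows "4 * \<rho> x ^ 3 * r x u * (v \<bullet> (G x *v w)) + \<rho> x ^ 4 * (v \<bullet> (fd G x u *v w)) =
    2 * \<rho> x * r x u * (v \<bullet> (h x *v w)) + \<rho> x ^ 2 * (v \<bullet> (fd h x u *v w)) + fd C x u * r x v * r x w
      + C x * (rr x u v * r x w + r x v * rr x u w)"
proof -
  have xW: "x \<in> W" using x Wp by auto
  have d\<rho>: "(\<rho> has_derivative r x) (at x)" and dC: "(C has_derivative fd C x) (at x)"
    and dr: "((\<lambda>y. r y v) has_derivative (\<lambda>u. rr x u v)) (at x)" for v
    using Cinf_on_has_derivative[OF \<rho> xW] Cinf_on_has_derivative[OF C xW]
      Cinf_on_has_derivative[OF Cinf_on_fd_const[OF \<rho>] xW] by auto
  have mv: "((\<lambda>y. v \<bullet> (M y *v w)) has_derivative (\<lambda>u. v \<bullet> (fd M x u *v w))) (at x)"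
    if "Cinf_on T M" "x \<in> T" for M :: "real^'n \<Rightarrow> real^'n^'n" and T
    by (rule bounded_linear.has_derivative[OF bounded_linear_compose[OF bounded_linear_inner_right
          bounded_bilinear.bounded_linear_left[OF bounded_bilinear_mv]] Cinf_on_has_derivative[OF that]])
  let ?L = "\<lambda>y. \<rho> y ^ 4 * (v \<bullet> (G y *v w))"
  have 1: "(?L has_derivative (\<lambda>u. 4 * \<rho> x ^ 3 * r x u * (v \<bullet> (G x *v w)) + \<rho> x ^ 4 * (v \<bullet> (fd G x u *v w)))) (at x)"
    by (rule has_derivative_eq_rhs[OF has_derivative_mult[OF has_derivative_power[OF d\<rho>] mv[OF G x]]])
      (simp add: fun_eq_iff algebra_simps)
  have 2: "((\<lambda>y. \<rho> y ^ 2 * (v \<bullet> (h y *v w)) + C y * (r y v * r y w)) has_derivative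
     (\<lambda>u. 2 * \<rho> x * r x u * (v \<bullet> (h x *v w)) + \<rho> x ^ 2 * (v \<bullet> (fd h x u *v w)) + fd C x u * r x v * r x w
      + C x * (rr x u v * r x w + r x v * rr x u w))) (at x)"
    by (rule has_derivative_eq_rhs[OF has_derivative_add[OF has_derivative_mult[OF has_derivative_power[OF d\<rho>] mv[OF h xW]]
        has_derivative_mult[OF dC has_derivative_mult[OF dr dr]]]])
      (simp add: fun_eq_iff algebra_simps)
  have "(?L has_derivative (\<lambda>u. 2 * \<rho> x * r x u * (v \<bullet> (h x *v w)) + \<rho> x ^ 2 * (v \<bullet> (fd h x u *v w)) + fd C x u * r x v * r x w
      + C x * (rr x u v * r x w + r x v * rr x u w))) (at x)"
    by (rule has_derivative_transform_within_open[OF 2 Cinf_on_open[OF G] x]) (simp add: form)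
  from fun_cong[OF has_derivative_unique[OF 1 this], of u] show ?thesis .
qed

text \<open>The terms \<open>r(u) v / \<rho>\<close> and \<open>r(v) u / \<rho>\<close> in \<open>N\<close> cancel the terms in which the Koszul formula
  differentiates powers of \<open>\<rho>\<close> in direction \<open>u\<close> or \<open>v\<close>, up to a multiple of \<open>r(u) r(v) r(w)\<close>. This
  multiple cancels against the one from direction \<open>w\<close>, of which only \<open>\<rho> r(w) h(u, v)\<close> is left.\<close>

lemma asymptotic_identity:
  assumes x: "x \<in> Wp"
  shows "\<rho> x ^ 2 * (N x u v \<bullet> (h x *v w)) + C x * r x (N x u v) * r x w = R x u v w"
proof -
  have xW: "x \<in> W" using x Wp by auto
  have nz: "\<rho> x \<noteq> 0" by (rule \<rho>_nz[OF x])
  define c' where "c' = C x / \<rho> x"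
  have cc: "C x = \<rho> x * c'" using nz by (simp add: c'_def)
  have t: "\<rho> x ^ 3 * (a \<bullet> (G x *v b)) = \<rho> x * (a \<bullet> (h x *v b)) + c' * (r x a * r x b)" for a b
  proof -
    have "\<rho> x * (\<rho> x ^ 3 * (a \<bullet> (G x *v b))) = \<rho> x * (\<rho> x * (a \<bullet> (h x *v b)) + c' * (r x a * r x b))"
      using form[OF x, of a b] by (simp add: cc algebra_simps power2_eq_square power3_eq_cube power4_eq_xxxx)
    then show ?thesis using nz by simp
  qed
  let ?K = "\<lambda>u v w. \<rho> x ^ 4 * (v \<bullet> (fd G x u *v w))"
  have K: "?K u v w = 2 * \<rho> x * r x u * (v \<bullet> (h x *v w)) + \<rho> x ^ 2 * (v \<bullet> (fd h x u *v w)) + fd C x u * r x v * r x w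
      + C x * (rr x u v * r x w + r x v * rr x u w) - 4 * r x u * (\<rho> x * (v \<bullet> (h x *v w)) + c' * (r x v * r x w))" for u v w
    using form_derivative[OF x, of u v w] t[of v w] by (simp add: algebra_simps)
  have chr: "2 * (christoffel G x u v \<bullet> (G x *v w)) = koszul G x u v w"
    by (rule christoffel_koszul[OF fd_linear[OF G x] G_sym[OF x] G_det[OF x]])
  have rr_sym: "rr x a b = rr x b a" for a b by (rule fd_fd_sym[OF \<rho> xW])
  have "\<rho> x ^ 2 * (N x u v \<bullet> (h x *v w)) + C x * r x (N x u v) * r x w = \<rho> x ^ 4 * (N x u v \<bullet> (G x *v w))"
    using form[OF x, of "N x u v" w] by (simp add: mult.assoc)
  also have "\<dots> = \<rho> x ^ 4 * (christoffel G x u v \<bullet> (G x *v w)) + r x u * (\<rho> x ^ 3 * (v \<bullet> (G x *v w))) + r x v * (\<rho> x ^ 3 * (u \<bullet> (G x *v w)))"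
    using nz by (simp add: N_def inner_add_left power4_eq_xxxx power3_eq_cube field_simps)
  also have "\<rho> x ^ 4 * (christoffel G x u v \<bullet> (G x *v w)) = (?K u v w + ?K v u w - ?K w u v) / 2"
  proof -
    have "\<rho> x ^ 4 * (2 * (christoffel G x u v \<bullet> (G x *v w))) = ?K u v w + ?K v u w - ?K w u v"
      unfolding chr koszul_def by (simp add: algebra_simps)
    then show ?thesis by simp
  qed
  also have "(?K u v w + ?K v u w - ?K w u v) / 2 + r x u * (\<rho> x ^ 3 * (v \<bullet> (G x *v w))) + r x v * (\<rho> x ^ 3 * (u \<bullet> (G x *v w))) = R x u v w"
    unfolding t K R_def koszul_def rr_sym[of v u] rr_sym[of w u] rr_sym[of w v] by (simp add: field_simps)
  finally show ?thesis .
qed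

definition proj :: "real^'n \<Rightarrow> real^'n \<Rightarrow> real^'n" where
  "proj x w = w - (r x w / r x e) *\<^sub>R e"

lemma r_proj: "x \<in> W \<Longrightarrow> r x (proj x w) = 0"
  using e_nz[of x] by (simp add: proj_def linear_diff[OF r_lin] linear_scale[OF r_lin])

lemma Cinf_on_proj:
  assumes "Cinf_on W Z"
  shows "Cinf_on W (\<lambda>x. proj x (Z x))"
  unfolding proj_def
  by (intro Cinf_on_diff Cinf_on_scaleR Cinf_on_divide Cinf_on_fd \<rho> assms Cinf_on_const Cinf_on_open[OF \<rho>] e_nz)

text \<open>Row \<open>i\<close> is the sum of the two test functionals: \<open>h(z, proj w)\<close> and \<open>r(w)\<close> times the left-hand side of
  \<open>asymptotic_identity\<close> at \<open>e\<close>, for the basis vector \<open>w\<close> with index \<open>i\<close>.\<close>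

definition Q :: "real^'n \<Rightarrow> real^'n^'n" where
  "Q x = (\<chi> i k. (h x *v proj x (axis i 1)) $ k
     + r x (axis i 1) * (\<rho> x ^ 2 * (h x *v e) $ k + C x * r x (axis k 1) * r x e))"

lemma Q_mult:
  assumes "x \<in> W"
  shows "(Q x *v z) $ i = z \<bullet> (h x *v proj x (axis i 1)) + r x (axis i 1) * (\<rho> x ^ 2 * (z \<bullet> (h x *v e)) + C x * r x z * r x e)"
proof -
  have "r x z = (\<Sum>k\<in>UNIV. r x (axis k 1) * z $ k)"
    using linear_axis_inner[OF r_lin[OF assms], of z] by (simp add: inner_vec_def)
  then show ?thesis
    by (simp add: Q_def matrix_vector_mult_def inner_vec_def distrib_left distrib_right sum.distrib
        sum_distrib_left sum_distrib_right mult_ac)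
qed

lemma Cinf_on_Q: "Cinf_on W Q"
proof -
  have const: "Cinf_on W (\<lambda>x. v)" for v :: "real^'n" by (rule Cinf_on_const[OF Cinf_on_open[OF \<rho>]])
  show ?thesis
    unfolding Q_def
    by (intro Cinf_on_vec_lambda Cinf_on_add Cinf_on_mult Cinf_on_vec_nth[OF Cinf_on_mv] Cinf_on_power
        Cinf_on_proj Cinf_on_fd const \<rho> h C)
qed

text \<open>For a kernel vector \<open>z\<close> at the boundary, testing against \<open>e\<close> gives \<open>r(z) = 0\<close>; then \<open>z\<close> is
  orthogonal to the kernel of \<open>r\<close> with respect to \<open>h\<close>.\<close>

lemma det_Q: "det (Q x0) \<noteq> 0"
proof
  assume "det (Q x0) = 0"
  then obtain z where z: "z \<noteq> 0" "Q x0 *v z = 0"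
    by (metis invertible_det_nz invertible_left_inverse matrix_left_invertible_ker)
  have lin: "linear (r x0)" by (rule r_lin[OF x0(1)])
  have eq: "z \<bullet> (h x0 *v proj x0 (axis i 1)) + r x0 (axis i 1) * (C x0 * r x0 z * r x0 e) = 0" for i
    using Q_mult[OF x0(1), of z i] z(2) x0(2) by simp
  have all: "z \<bullet> (h x0 *v proj x0 w) + r x0 w * (C x0 * r x0 z * r x0 e) = 0" (is "?f w = 0") for w
  proof -
    have projlin: "proj x0 (a + b) = proj x0 a + proj x0 b" "proj x0 (k *\<^sub>R a) = k *\<^sub>R proj x0 a" for a b k
      by (simp_all add: proj_def linear_add[OF lin] linear_scale[OF lin] add_divide_distrib algebra_simps)
    have "linear ?f"
      by (rule linearI) (simp_all add: projlin linear_add[OF lin] linear_scale[OF lin] matrix_vector_right_distrib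
        matrix_vector_mult_scaleR inner_add_right algebra_simps)
    note f = linear_axis_inner[OF this, of w]
    have "(\<chi> i. ?f (axis i 1)) = 0" by (simp add: eq vec_eq_iff)
    with f show ?thesis by (simp only: inner_zero_left)
  qed
  have "proj x0 e = 0" using e_nz[OF x0(1)] by (simp add: proj_def)
  then have "r x0 z = 0" using all[of e] e_nz[OF x0(1)] C_nz[OF x0(1)] by simp
  moreover have "z \<bullet> (h x0 *v w) = 0" if "r x0 w = 0" for w
    using all[of w] that \<open>r x0 z = 0\<close> by (simp add: proj_def)
  ultimately show False using nondeg z(1) by blast
qed

lemma Cinf_on_R:
  assumes "Cinf_on W X" "Cinf_on W Y" "Cinf_on W Z"
  shows "Cinf_on W (\<lambda>x. R x (X x) (Y x) (Z x))"
  unfolding R_def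
  by (intro Cinf_on_add Cinf_on_diff Cinf_on_mult Cinf_on_divide Cinf_on_inner Cinf_on_mv Cinf_on_power
      Cinf_on_koszul Cinf_on_fd Cinf_on_fd_fd \<rho> C h assms Cinf_on_const Cinf_on_open[OF \<rho>]) auto

text \<open>Division by \<open>\<rho>\<^sup>2\<close> in the test against \<open>proj w\<close> is possible up to the factor \<open>s\<close>, which will be
  \<open>1\<close> or \<open>\<rho>\<close> depending on the decay of \<open>C\<close>.\<close>

lemma scaled_extension:
  assumes X: "Cinf_on W X" and Y: "Cinf_on W Y" and s: "Cinf_on W s" and \<beta>: "\<And>i. Cinf_on W (\<lambda>x. \<beta> x i)"
    and eq: "\<And>x i. x \<in> Wp \<Longrightarrow> \<rho> x ^ 2 * \<beta> x i = s x * (fd C x (proj x (axis i 1)) * r x (X x) * r x (Y x))"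
  obtains W' P where "x0 \<in> W'" "W' \<subseteq> W" "Cinf_on W' P" "\<And>x. x \<in> W' \<inter> Wp \<Longrightarrow> P x = s x *\<^sub>R N x (X x) (Y x)"
proof -
  define b where "b x = (\<chi> i. s x / 2 * koszul h x (X x) (Y x) (proj x (axis i 1)) - \<beta> x i / 2
     + s x * r x (axis i 1) * R x (X x) (Y x) e)" for x
  have const: "Cinf_on W (\<lambda>x. v)" for v :: "real^'n" by (rule Cinf_on_const[OF Cinf_on_open[OF \<rho>]])
  have const': "Cinf_on W (\<lambda>x. 2 :: real)" by (rule Cinf_on_const[OF Cinf_on_open[OF \<rho>]])
  have b: "Cinf_on W b"
    unfolding b_def
    by (intro Cinf_on_vec_lambda Cinf_on_add Cinf_on_diff Cinf_on_mult Cinf_on_divide Cinf_on_koszul Cinf_on_proj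
        Cinf_on_R Cinf_on_fd const const' \<rho> h X Y s \<beta>) auto
  define W' where "W' = W \<inter> (\<lambda>x. det (Q x)) -` (- {0})"
  have "open W'"
    unfolding W'_def by (rule continuous_open_preimage[OF Cinf_on_continuous[OF Cinf_on_det[OF Cinf_on_Q]] Cinf_on_open[OF \<rho>]]) auto
  then have "Cinf_on W' Q" "Cinf_on W' b"
    using Cinf_on_subset[OF Cinf_on_Q] Cinf_on_subset[OF b] by (auto simp: W'_def)
  then obtain P where P: "Cinf_on W' P" "\<And>x y. x \<in> W' \<Longrightarrow> Q x *v y = b x \<longleftrightarrow> y = P x"
    using Cinf_on_linear_solve[of W' Q b] by (auto simp: W'_def)
  show thesis
  proof (rule that[OF _ _ P(1)])
    show "x0 \<in> W'" using x0 det_Q by (simp add: W'_def)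
    show "W' \<subseteq> W" by (simp add: W'_def)
    fix x assume "x \<in> W' \<inter> Wp"
    then have x: "x \<in> W'" "x \<in> Wp" and xW: "x \<in> W" using Wp by auto
    have nz: "\<rho> x ^ 2 \<noteq> 0" using \<rho>_nz[OF x(2)] by simp
    let ?N = "N x (X x) (Y x)"
    have "(Q x *v (s x *\<^sub>R ?N)) $ i = b x $ i" for i
    proof -
      let ?w = "proj x (axis i 1)"
      have "\<rho> x ^ 2 * (?N \<bullet> (h x *v ?w)) = R x (X x) (Y x) ?w"
        using asymptotic_identity[OF x(2), of "X x" "Y x" ?w] by (simp add: r_proj[OF xW])
      also have "\<dots> = \<rho> x ^ 2 / 2 * koszul h x (X x) (Y x) ?w - fd C x ?w * r x (X x) * r x (Y x) / 2"
        by (simp add: R_def r_proj[OF xW])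
      finally have "s x * (\<rho> x ^ 2 * (?N \<bullet> (h x *v ?w))) =
          s x * (\<rho> x ^ 2 / 2 * koszul h x (X x) (Y x) ?w - fd C x ?w * r x (X x) * r x (Y x) / 2)"
        by (simp only:)
      also have "\<dots> = \<rho> x ^ 2 * (s x / 2 * koszul h x (X x) (Y x) ?w) - (\<rho> x ^ 2 * \<beta> x i) / 2"
        unfolding eq[OF x(2)] by (simp add: algebra_simps)
      finally have "\<rho> x ^ 2 * (s x * (?N \<bullet> (h x *v ?w))) = \<rho> x ^ 2 * (s x / 2 * koszul h x (X x) (Y x) ?w - \<beta> x i / 2)"
        by (simp add: algebra_simps)
      then have 1: "s x * (?N \<bullet> (h x *v ?w)) = s x / 2 * koszul h x (X x) (Y x) ?w - \<beta> x i / 2"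
        using nz by simp
      have 2: "\<rho> x ^ 2 * (?N \<bullet> (h x *v e)) + C x * r x ?N * r x e = R x (X x) (Y x) e"
        by (rule asymptotic_identity[OF x(2)])
      have "(Q x *v (s x *\<^sub>R ?N)) $ i = s x * (Q x *v ?N) $ i" by (simp add: matrix_vector_mult_scaleR)
      also have "\<dots> = s x * (?N \<bullet> (h x *v ?w)) + s x * r x (axis i 1) * R x (X x) (Y x) e"
        unfolding Q_mult[OF xW] 2[symmetric] by (simp add: algebra_simps)
      finally show ?thesis unfolding 1 by (simp add: b_def)
    qed
    then show "P x = s x *\<^sub>R ?N" using P(2)[OF x(1)] by (metis vec_eq_iff)
  qed
qed

text \<open>\<open>asymptotic_identity\<close> at \<open>e\<close>, solved for \<open>r(N)\<close> with \<open>\<rho> N\<close> replaced by its extension \<open>P\<close>.\<close>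

definition normal_part :: "(real^'n \<Rightarrow> real^'n) \<Rightarrow> (real^'n \<Rightarrow> real^'n) \<Rightarrow> (real^'n \<Rightarrow> real^'n) \<Rightarrow> real^'n \<Rightarrow> real" where
  "normal_part X Y P x = (R x (X x) (Y x) e - \<rho> x * (P x \<bullet> (h x *v e))) / (C x * r x e)"

lemma normal_part_eq:
  assumes x: "x \<in> Wp" and P: "P x = \<rho> x *\<^sub>R N x (X x) (Y x)"
  shows "normal_part X Y P x = r x (N x (X x) (Y x))"
proof -
  have xW: "x \<in> W" using x Wp by auto
  have "R x (X x) (Y x) e - \<rho> x * (P x \<bullet> (h x *v e)) = C x * r x (N x (X x) (Y x)) * r x e"
    using asymptotic_identity[OF x, of "X x" "Y x" e] by (simp add: P power2_eq_square)
  then show ?thesis using C_nz[OF xW] e_nz[OF xW] by (simp add: normal_part_def)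
qed

lemma Cinf_on_normal_part:
  assumes "Cinf_on W X" "Cinf_on W Y" "Cinf_on W' P" "W' \<subseteq> W"
  shows "Cinf_on W' (normal_part X Y P)"
proof -
  have op: "open W'" by (rule Cinf_on_open[OF assms(3)])
  note sub = Cinf_on_subset[OF _ op assms(4)]
  have const: "Cinf_on W (\<lambda>x. e)" by (rule Cinf_on_const[OF Cinf_on_open[OF \<rho>]])
  have "Cinf_on W' (\<lambda>x. normal_part X Y P x)"
    unfolding normal_part_def
    by (intro Cinf_on_divide Cinf_on_diff Cinf_on_mult Cinf_on_inner sub[OF Cinf_on_R[OF assms(1,2) const]] sub[OF \<rho>]
        sub[OF C] sub[OF Cinf_on_mv[OF h const]] assms(3) sub[OF Cinf_on_fd_const[OF \<rho>]])
      (use C_nz e_nz assms(4) in auto)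
  then show ?thesis by simp
qed

lemma normal_part_bdry:
  assumes "x \<in> W" "\<rho> x = 0" "r x (X x) = 0" "r x (Y x) = 0"
  shows "normal_part X Y P x = rr x (X x) (Y x)"
  using assms C_nz[of x] e_nz[of x] by (simp add: normal_part_def R_def)

end

section \<open>Coordinates adapted to the asymptotic form\<close>

lemma asymptotic_coords_restrict:
  assumes "asymptotic_coords W x0 \<rho> C h G e Wp" "open W'" "W' \<subseteq> W" "x0 \<in> W'"
  shows "asymptotic_coords W' x0 \<rho> C h G e (W' \<inter> Wp)"
proof -
  interpret asymptotic_coords W x0 \<rho> C h G e Wp by fact
  have "open (W' \<inter> Wp)" using assms(2) Cinf_on_open[OF G] by auto
  then show ?thesis
    using assms(3,4) x0(2) C_nz e_nz G_sym G_det \<rho>_nz form nondeg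
    by unfold_locales (auto intro: Cinf_on_subset[OF \<rho> assms(2,3)] Cinf_on_subset[OF C assms(2,3)]
        Cinf_on_subset[OF h assms(2,3)] Cinf_on_subset[OF G])
qed

context manifold_with_boundary begin

lemma smooth_fun_dd:
  assumes f: "smooth_fun A U f" and U: "open U" and \<xi>: "\<xi> \<in> vector_fields A U"
  shows "smooth_fun A U (\<lambda>q. dd A f q (\<xi> q))"
proof (rule smooth_funI)
  fix p assume p: "p \<in> U"
  obtain V \<phi> where c: "(V, \<phi>) \<in> A" "p \<in> V" using chart_cover by blast
  obtain W1 F where F: "\<phi> p \<in> W1" "rep V \<phi> W1 f F" using smooth_fun_rep[OF f U c(1) p c(2)] by metis
  obtain W2 X where X: "\<phi> p \<in> W2" "rep V \<phi> W2 (comps \<phi> \<xi>) X" using vf_rep[OF \<xi> U c(1) p c(2)] by metis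
  have op: "open (W1 \<inter> W2)" using rep_open[OF F(2)] rep_open[OF X(2)] by auto
  have "rep V \<phi> (W1 \<inter> W2) (\<lambda>q. dd A f q (\<xi> q)) (\<lambda>x. fd F x (X x))"
    by (rule rep_dd[OF c(1) rep_restrict[OF F(2) op] rep_restrict[OF X(2) op]]) auto
  then show "smooth_near U (\<lambda>q. dd A f q (\<xi> q)) p"
    using c F(1) X(1)
    by (intro exI[of _ V] exI[of _ \<phi>] exI[of _ "W1 \<inter> W2"] exI[of _ "\<lambda>x. fd F x (X x)"]) (auto simp: rep_def)
qed

text \<open>An instance of Hadamard's lemma. As every defining function has this form, the quotient of any
  two of them is smooth and non-vanishing.\<close>

lemma defining_function_factor:
  assumes \<rho>: "local_defining_function A U \<rho>" and c: "(V, \<phi>) \<in> A" "p \<in> V" and p: "p \<in> U" "p \<in> bdry A"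
    and r0: "rep V \<phi> W \<rho> r0" "\<phi> p \<in> W" and inU: "\<And>q. q \<in> V \<Longrightarrow> \<phi> q \<in> W \<Longrightarrow> q \<in> U"
  obtains W' H where "\<phi> p \<in> W'" "W' \<subseteq> W" "Cinf_on W' H" "\<And>x. x \<in> W' \<Longrightarrow> H x \<noteq> 0"
    "\<And>x. x \<in> W' \<Longrightarrow> r0 x = x $ bidx * H x"
proof -
  have zero: "r0 x = 0" if "x \<in> W" "x \<bullet> axis bidx 1 = 0" for x
  proof -
    have x0: "x $ bidx = 0" using that(2) by (simp add: inner_axis)
    then obtain q where q: "x = \<phi> q" "q \<in> V" using rep_image[OF r0(1) \<open>x \<in> W\<close>] by (auto simp: halfspace_def)
    then have "q \<in> U \<inter> bdry A" using inU that(1) bdry_iff[OF c(1)] x0 by auto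
    then have "\<rho> q = 0" using \<rho> unfolding local_defining_function_def by blast
    then show ?thesis using rep_eq[OF r0(1) q(2)] q(1) that(1) by simp
  qed
  have x0: "\<phi> p $ bidx = 0" using bdry_iff[OF c] p by simp
  then have xe: "\<phi> p \<bullet> axis bidx 1 = 0" by (simp add: inner_axis)
  obtain W1 H where H: "\<phi> p \<in> W1" "W1 \<subseteq> W" "Cinf_on W1 H" "\<And>x. x \<in> W1 \<Longrightarrow> r0 x = (x \<bullet> axis bidx 1) * H x"
    using Hadamard[OF rep_Cinf[OF r0(1)] r0(2) xe norm_axis_1 zero] by metis
  have eq: "r0 x = x $ bidx * H x" if "x \<in> W1" for x using H(4)[OF that] by (simp add: inner_axis)
  obtain v where v: "dd A \<rho> p v \<noteq> 0" using \<rho> p unfolding local_defining_function_def by blast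
  have "((\<lambda>x. x $ bidx * H x) has_derivative (\<lambda>u. \<phi> p $ bidx * fd H (\<phi> p) u + u $ bidx * H (\<phi> p))) (at (\<phi> p))"
    by (rule has_derivative_mult[OF bounded_linear_imp_has_derivative[OF bounded_linear_vec_nth] Cinf_on_has_derivative[OF H(3,1)]])
  then have "(r0 has_derivative (\<lambda>u. \<phi> p $ bidx * fd H (\<phi> p) u + u $ bidx * H (\<phi> p))) (at (\<phi> p))"
    by (rule has_derivative_transform_within_open[OF _ Cinf_on_open[OF H(3)] H(1)]) (simp add: eq)
  then have "fd r0 (\<phi> p) (dd A \<phi> p v) = dd A \<phi> p v $ bidx * H (\<phi> p)" using x0 by (simp add: fd_eq)
  then have "H (\<phi> p) \<noteq> 0" using v dd_rep[OF c r0] by auto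
  show thesis
  proof
    have op: "open (W1 \<inter> H -` (- {0}))"
      by (rule continuous_open_preimage[OF Cinf_on_continuous[OF H(3)] Cinf_on_open[OF H(3)]]) auto
    show "Cinf_on (W1 \<inter> H -` (- {0})) H" by (rule Cinf_on_subset[OF H(3) op]) auto
  qed (use H(1,2) eq \<open>H (\<phi> p) \<noteq> 0\<close> in auto)
qed

end

lemma fd_factor_bdry:
  fixes r0 H :: "real^'n \<Rightarrow> real"
  assumes H: "Cinf_on W H" and x: "x \<in> W" "x $ bidx = 0" and eq: "\<And>x. x \<in> W \<Longrightarrow> r0 x = x $ bidx * H x"
  shows "fd r0 x v = v $ bidx * H x"
proof -
  have "((\<lambda>x. x $ bidx * H x) has_derivative (\<lambda>u. x $ bidx * fd H x u + u $ bidx * H x)) (at x)"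
    by (rule has_derivative_mult[OF bounded_linear_imp_has_derivative[OF bounded_linear_vec_nth] Cinf_on_has_derivative[OF H x(1)]])
  then have "(r0 has_derivative (\<lambda>u. x $ bidx * fd H x u + u $ bidx * H x)) (at x)"
    by (rule has_derivative_transform_within_open[OF _ Cinf_on_open[OF H] x(1)]) (simp add: eq)
  then show ?thesis using x(2) by (simp add: fd_eq)
qed

context pseudo_riemannian_interior begin

text \<open>The decay hypothesis speaks about vector fields on all of \<open>U\<close>. The local field \<open>Z\<close> is therefore multiplied
  by a bump function, and the result is divided by it again where it is positive.\<close>

lemma decay_in_coords:
  assumes \<rho>: "local_defining_function A U \<rho>" and C: "smooth_fun A U C" and decay: "tangential_decay A U \<rho> C k"
    and c: "(V, \<phi>) \<in> A" "p \<in> V" and p: "p \<in> U"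
    and r0: "rep V \<phi> W \<rho> r0" and C0: "rep V \<phi> W C C0" and W: "\<phi> p \<in> W"
    and Z: "Cinf_on W Z" and rZ: "\<And>x. x \<in> W \<Longrightarrow> fd r0 x (Z x) = 0"
  obtains W' \<beta> where "\<phi> p \<in> W'" "W' \<subseteq> W" "Cinf_on W' \<beta>" "\<And>q. q \<in> V \<Longrightarrow> \<phi> q \<in> W' \<Longrightarrow> fd C0 (\<phi> q) (Z (\<phi> q)) = r0 (\<phi> q) ^ k * \<beta> (\<phi> q)"
proof -
  have U: "open U" and sm: "smooth_fun A U \<rho>" using \<rho> by (auto simp: local_defining_function_def)
  obtain W1 b \<zeta> where \<zeta>: "\<phi> p \<in> W1" "W1 \<subseteq> W" "Cinf_on W1 b" "\<And>x. x \<in> W1 \<Longrightarrow> b x > (0::real)"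
    "\<zeta> \<in> vector_fields A U" "\<And>q. q \<in> V \<Longrightarrow> \<phi> q \<in> W1 \<Longrightarrow> q \<in> U \<and> dd A \<phi> q (\<zeta> q) = b (\<phi> q) *\<^sub>R Z (\<phi> q)"
    "\<And>q. \<not> (q \<in> V \<and> \<phi> q \<in> W1) \<Longrightarrow> \<zeta> q = 0"
    using cutoff_vf[OF c(1) U p c(2) Z W] by metis
  have "dd A \<rho> q (\<zeta> q) = 0" if q: "q \<in> U" for q
  proof (cases "q \<in> V \<and> \<phi> q \<in> W1")
    case True
    then have qW: "q \<in> V" "\<phi> q \<in> W" using \<zeta>(2) by auto
    have "dd A \<rho> q (\<zeta> q) = fd r0 (\<phi> q) (b (\<phi> q) *\<^sub>R Z (\<phi> q))"
      using dd_rep[OF c(1) qW(1) r0 qW(2), of "\<zeta> q"] \<zeta>(6)[of q] True by simp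
    then show ?thesis using rZ[OF qW(2)] linear_scale[OF fd_linear[OF rep_Cinf[OF r0] qW(2)]] by simp
  next
    case False
    then show ?thesis using \<zeta>(7)[of q] linear_0[OF dd_linear[OF sm U q]] by simp
  qed
  then have "bigO_pow A U \<rho> k (\<lambda>q. dd A C q (\<zeta> q))"
    using decay \<zeta>(5) unfolding tangential_decay_def by blast
  then obtain f1 where f1: "smooth_fun A U f1" "\<And>q. q \<in> U \<Longrightarrow> dd A C q (\<zeta> q) = \<rho> q ^ k * f1 q"
    unfolding bigO_pow_def by blast
  obtain W2 F1 where F1: "\<phi> p \<in> W2" "rep V \<phi> W2 f1 F1" using smooth_fun_rep[OF f1(1) U c(1) p c(2)] by metis
  have op: "open (W1 \<inter> W2)" using Cinf_on_open[OF \<zeta>(3)] rep_open[OF F1(2)] by auto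
  show thesis
  proof
    show "\<phi> p \<in> W1 \<inter> W2" "W1 \<inter> W2 \<subseteq> W" using \<zeta>(1,2) F1(1) by auto
    show "Cinf_on (W1 \<inter> W2) (\<lambda>x. F1 x / b x)"
      by (intro Cinf_on_divide Cinf_on_subset[OF \<zeta>(3) op] Cinf_on_subset[OF rep_Cinf[OF F1(2)] op]) (use \<zeta>(4) in force)+
    fix q assume q: "q \<in> V" "\<phi> q \<in> W1 \<inter> W2"
    then have qW: "\<phi> q \<in> W" "q \<in> U" using \<zeta>(2,6) by auto
    have "dd A C q (\<zeta> q) = fd C0 (\<phi> q) (b (\<phi> q) *\<^sub>R Z (\<phi> q))"
      using dd_rep[OF c(1) q(1) C0 qW(1), of "\<zeta> q"] \<zeta>(6)[of q] q by simp
    also have "\<dots> = b (\<phi> q) * fd C0 (\<phi> q) (Z (\<phi> q))"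
      using linear_scale[OF fd_linear[OF rep_Cinf[OF C0] qW(1)]] by simp
    finally have "b (\<phi> q) * fd C0 (\<phi> q) (Z (\<phi> q)) = r0 (\<phi> q) ^ k * F1 (\<phi> q)"
      using f1(2)[OF qW(2)] rep_eq[OF r0 q(1) qW(1)] rep_eq[OF F1(2) q(1)] q(2) by simp
    then show "fd C0 (\<phi> q) (Z (\<phi> q)) = r0 (\<phi> q) ^ k * (F1 (\<phi> q) / b (\<phi> q))"
      using \<zeta>(4)[of "\<phi> q"] q(2) by (simp add: field_simps)
  qed
qed

text \<open>The decay is applied to the projections of the coordinate fields along \<open>e\<close>, and the resulting
  quotients are the functions \<open>\<beta>\<close>.\<close>

lemma asymptotic_coords_exist:
  assumes asym: "asymptotic_form A g U \<rho> C" and decay: "tangential_decay A U \<rho> C k"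
    and c: "(V, \<phi>) \<in> A" "p \<in> V" and p: "p \<in> U" "p \<in> bdry A" and W0: "open W0" "\<phi> p \<in> W0"
  obtains W r0 C0 h0 e \<beta> H where "\<phi> p \<in> W" "W \<subseteq> W0" "rep V \<phi> W \<rho> r0" "\<And>q. q \<in> V \<Longrightarrow> \<phi> q \<in> W \<Longrightarrow> q \<in> U"
    "asymptotic_coords W (\<phi> p) r0 C0 h0 (G V \<phi>) e (W \<inter> interior_img V \<phi>)"
    "\<And>i. Cinf_on W (\<lambda>x. \<beta> x i)"
    "\<And>x i. x \<in> W \<inter> interior_img V \<phi> \<Longrightarrow>
       fd C0 x (axis i 1 - (fd r0 x (axis i 1) / fd r0 x e) *\<^sub>R e) = r0 x ^ k * \<beta> x i"
    "Cinf_on W H" "\<And>x. x \<in> W \<Longrightarrow> H x \<noteq> 0" "\<And>x. x \<in> W \<Longrightarrow> r0 x = x $ bidx * H x"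
proof -
  have \<rho>: "local_defining_function A U \<rho>" and C: "smooth_fun A U C" "\<And>p. p \<in> U \<Longrightarrow> C p \<noteq> 0"
    using asym by (auto simp: asymptotic_form_def)
  obtain h where h: "smooth_sym_tensor A U h"
    "\<And>p v w. p \<in> U - bdry A \<Longrightarrow> h p v w = \<rho> p ^ 2 * (g p v w - C p / \<rho> p ^ 4 * (dd A \<rho> p v * dd A \<rho> p w))"
    "\<And>p. p \<in> U \<inter> bdry A \<Longrightarrow> nondegenerate_on (tangent_bdry A p) (h p)"
    using asym unfolding asymptotic_form_def by blast
  have U: "open U" and sm: "smooth_fun A U \<rho>" and zero: "\<And>q. q \<in> U \<Longrightarrow> \<rho> q = 0 \<longleftrightarrow> q \<in> bdry A"
    using \<rho> by (auto simp: local_defining_function_def)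
  obtain W1 r0 where r1: "\<phi> p \<in> W1" "rep V \<phi> W1 \<rho> r0" "\<And>q. q \<in> V \<Longrightarrow> \<phi> q \<in> W1 \<Longrightarrow> q \<in> U"
    using smooth_fun_rep[OF sm U c(1) p(1) c(2)] by metis
  obtain W2 C0 where C2: "\<phi> p \<in> W2" "rep V \<phi> W2 C C0"
    using smooth_fun_rep[OF C(1) U c(1) p(1) c(2)] by metis
  obtain W3 h0 where h3: "\<phi> p \<in> W3" "rep V \<phi> W3 (gram h \<phi>) h0"
    using smooth_fun_rep[OF smooth_fun_gram[OF h(1) U c(1)] open_Int[OF U chart_open[OF c(1)]] c(1) IntI[OF p(1) c(2)] c(2)] by metis
  obtain W4 H where H4: "\<phi> p \<in> W4" "W4 \<subseteq> W1" "Cinf_on W4 H" "\<And>x. x \<in> W4 \<Longrightarrow> H x \<noteq> 0" "\<And>x. x \<in> W4 \<Longrightarrow> r0 x = x $ bidx * H x"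
    using defining_function_factor[OF \<rho> c p r1(2,1,3)] by metis
  obtain v where v: "dd A \<rho> p v \<noteq> 0" using \<rho> p unfolding local_defining_function_def by blast
  define e where "e = dd A \<phi> p v"
  have ep: "fd r0 (\<phi> p) e \<noteq> 0" using v dd_rep[OF c r1(2,1)] by (simp add: e_def)
  define W5 where "W5 = (W0 \<inter> W2 \<inter> W3 \<inter> W4) \<inter> (\<lambda>x. fd r0 x e * C0 x) -` (- {0})"
  have sub5: "W5 \<subseteq> W0" "W5 \<subseteq> W1" "W5 \<subseteq> W2" "W5 \<subseteq> W3" "W5 \<subseteq> W4" using H4(2) by (auto simp: W5_def)
  have op5: "open W5"
  proof -
    have o: "open (W0 \<inter> W2 \<inter> W3 \<inter> W4)"
      using W0 rep_open[OF C2(2)] rep_open[OF h3(2)] Cinf_on_open[OF H4(3)] by auto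
    have "Cinf_on (W0 \<inter> W2 \<inter> W3 \<inter> W4) (\<lambda>x. fd r0 x e * C0 x)"
      by (intro Cinf_on_mult Cinf_on_fd_const Cinf_on_subset[OF rep_Cinf[OF r1(2)] o] Cinf_on_subset[OF rep_Cinf[OF C2(2)] o])
        (use H4(2) in auto)
    then show ?thesis unfolding W5_def
      by (rule continuous_open_preimage[OF Cinf_on_continuous o]) auto
  qed
  have nz5: "fd r0 x e \<noteq> 0" "C0 x \<noteq> 0" if "x \<in> W5" for x using that by (auto simp: W5_def)
  have p5: "\<phi> p \<in> W5"
    using W0 C2(1) h3(1) H4(1) ep rep_eq[OF C2(2) c(2) C2(1)] C(2)[OF p(1)] by (simp add: W5_def)
  have r5: "rep V \<phi> W5 \<rho> r0" and C5: "rep V \<phi> W5 C C0" and h5: "rep V \<phi> W5 (gram h \<phi>) h0"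
    using rep_restrict r1(2) C2(2) h3(2) op5 sub5 by blast+
  have H5: "Cinf_on W5 H" by (rule Cinf_on_subset[OF H4(3) op5 sub5(5)])
  define Z where "Z i x = axis i 1 - (fd r0 x (axis i 1) / fd r0 x e) *\<^sub>R e" for i and x :: "real^'n"
  have Z: "Cinf_on W5 (Z i)" for i
  proof -
    have "Cinf_on W5 (\<lambda>x. axis i 1 - (fd r0 x (axis i 1) / fd r0 x e) *\<^sub>R e)"
      by (intro Cinf_on_diff Cinf_on_scaleR Cinf_on_divide Cinf_on_fd_const rep_Cinf[OF r5] Cinf_on_const op5 nz5)
    then show ?thesis by (simp add: Z_def[abs_def])
  qed
  have rZ: "fd r0 x (Z i x) = 0" if "x \<in> W5" for x i
    using nz5[OF that] linear_diff[OF fd_linear[OF rep_Cinf[OF r5] that]] linear_scale[OF fd_linear[OF rep_Cinf[OF r5] that]]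
    by (simp add: Z_def)
  have "\<exists>W' \<beta>. \<phi> p \<in> W' \<and> W' \<subseteq> W5 \<and> Cinf_on W' \<beta> \<and>
      (\<forall>q\<in>V. \<phi> q \<in> W' \<longrightarrow> fd C0 (\<phi> q) (Z i (\<phi> q)) = r0 (\<phi> q) ^ k * \<beta> (\<phi> q))" for i
    using decay_in_coords[OF \<rho> C(1) decay c p(1) r5 C5 p5 Z rZ, of i] by metis
  then obtain W6 \<beta> where W6: "\<And>i. \<phi> p \<in> W6 i" "\<And>i. W6 i \<subseteq> W5" "\<And>i. Cinf_on (W6 i) (\<beta> i)"
    "\<And>i q. q \<in> V \<Longrightarrow> \<phi> q \<in> W6 i \<Longrightarrow> fd C0 (\<phi> q) (Z i (\<phi> q)) = r0 (\<phi> q) ^ k * \<beta> i (\<phi> q)"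
    by metis
  define W where "W = (\<Inter>i. W6 i)"
  have opW: "open W" unfolding W_def using Cinf_on_open[OF W6(3)] by (intro open_INT) auto
  have sub: "W \<subseteq> W5" using W6(2) by (auto simp: W_def)
  have pW: "\<phi> p \<in> W" using W6(1) by (simp add: W_def)
  have rW: "rep V \<phi> W \<rho> r0" and CW: "rep V \<phi> W C C0" and hW: "rep V \<phi> W (gram h \<phi>) h0"
    using rep_restrict[OF _ opW sub] r5 C5 h5 by blast+
  have HW: "Cinf_on W H" by (rule Cinf_on_subset[OF H5 opW sub])
  have Hnz: "H x \<noteq> 0" "r0 x = x $ bidx * H x" if "x \<in> W" for x using H4(4,5) that sub sub5(5) by auto
  have inU: "q \<in> U" if "q \<in> V" "\<phi> q \<in> W" for q using r1(3) that sub sub5(2) by blast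
  have opI: "open (interior_img V \<phi>)" using Cinf_on_open[OF G_Cinf[OF c(1)]] .
  have hbl: "bilinear (h q)" if "q \<in> U" for q using h(1) that by (simp add: smooth_sym_tensor_def)
  show thesis
  proof (rule that[OF pW _ rW inU _ _ _ HW])
    show "asymptotic_coords W (\<phi> p) r0 C0 h0 (G V \<phi>) e (W \<inter> interior_img V \<phi>)"
    proof
      show "\<phi> p \<in> W" by (fact pW)
      show "r0 (\<phi> p) = 0" using rep_eq[OF rW c(2) pW] zero[OF p(1)] p(2) by simp
      show "Cinf_on W r0" "Cinf_on W C0" "Cinf_on W h0" using rep_Cinf rW CW hW by blast+
      show "C0 x \<noteq> 0" "fd r0 x e \<noteq> 0" if "x \<in> W" for x using nz5 that sub by blast+
      show "W \<inter> interior_img V \<phi> \<subseteq> W" by simp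
      show "Cinf_on (W \<inter> interior_img V \<phi>) (G V \<phi>)" by (rule Cinf_on_subset[OF G_Cinf[OF c(1)]]) (use opW opI in auto)
      fix x assume x: "x \<in> W \<inter> interior_img V \<phi>"
      show "transpose (G V \<phi> x) = G V \<phi> x" "det (G V \<phi> x) \<noteq> 0" using G_props[OF c(1)] x by auto
      obtain q where q: "x = \<phi> q" "q \<in> V" "q \<notin> bdry A" using x by blast
      then have qW: "\<phi> q \<in> W" "q \<in> U" using inU x by auto
      show nz: "r0 x \<noteq> 0" using rep_eq[OF rW q(2) qW(1)] zero[OF qW(2)] q by simp
      fix v w
      let ?v = "from_coords \<phi> q v" and ?w = "from_coords \<phi> q w"
      have "h q ?v ?w = r0 x ^ 2 * (g q ?v ?w - C0 x / r0 x ^ 4 * (fd r0 x v * fd r0 x w))"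
        using h(2)[of q ?v ?w] qW q rep_eq[OF rW q(2) qW(1)] rep_eq[OF CW q(2) qW(1)] dd_rep[OF c(1) q(2) rW qW(1)]
        by (simp add: dd_from_coords[OF c(1) q(2)])
      moreover have "h q ?v ?w = v \<bullet> (h0 x *v w)"
        using gram_eq[of h q, OF hbl[OF qW(2)] c(1) q(2), of ?v ?w] rep_eq[OF hW q(2) qW(1)] q(1) by (simp add: dd_from_coords[OF c(1) q(2)])
      moreover have "g q ?v ?w = v \<bullet> (G V \<phi> x *v w)"
        using g_gram[OF c(1), of q ?v ?w] q chart_inv[OF c(1) q(2)] by (simp add: dd_from_coords[OF c(1) q(2)])
      ultimately have eq: "v \<bullet> (h0 x *v w) = r0 x ^ 2 * (v \<bullet> (G V \<phi> x *v w) - C0 x / r0 x ^ 4 * (fd r0 x v * fd r0 x w))"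
        by simp
      have "r0 x ^ 2 * (v \<bullet> (h0 x *v w)) = r0 x ^ 4 * (v \<bullet> (G V \<phi> x *v w) - C0 x / r0 x ^ 4 * (fd r0 x v * fd r0 x w))"
        unfolding eq by (simp add: power2_eq_square power4_eq_xxxx)
      then show "r0 x ^ 4 * (v \<bullet> (G V \<phi> x *v w)) = r0 x ^ 2 * (v \<bullet> (h0 x *v w)) + C0 x * (fd r0 x v * fd r0 x w)"
        using nz by (simp add: right_diff_distrib)
    next
      fix v assume v: "fd r0 (\<phi> p) v = 0" and all: "\<And>w. fd r0 (\<phi> p) w = 0 \<Longrightarrow> v \<bullet> (h0 (\<phi> p) *v w) = 0"
      have xb: "\<phi> p $ bidx = 0" using bdry_iff[OF c] p by simp
      have ker: "fd r0 (\<phi> p) u = 0 \<longleftrightarrow> u $ bidx = 0" for u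
        using fd_factor_bdry[OF HW pW xb Hnz(2), of u] Hnz(1)[OF pW] by simp
      let ?v = "from_coords \<phi> p v"
      have vT: "?v \<in> tangent_bdry A p" using tangent_bdry_iff[OF c p(2)] v ker by (simp add: dd_from_coords[OF c])
      have "h p ?v w = 0" if "w \<in> tangent_bdry A p" for w
      proof -
        have "fd r0 (\<phi> p) (dd A \<phi> p w) = 0" using tangent_bdry_iff[OF c p(2)] that ker by simp
        then show ?thesis using gram_eq[of h p, OF hbl[OF p(1)] c, of ?v w] all rep_eq[OF hW c(2) pW] by (simp add: dd_from_coords[OF c])
      qed
      then have "?v = 0" using h(3)[of p] p vT unfolding nondegenerate_on_def by blast
      then show "v = 0" using dd_from_coords[OF c, of v] linear_0[OF chart_dd_linear[OF c]] by simp
    qed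
    show "Cinf_on W (\<lambda>x. \<beta> i x)" for i
      by (rule Cinf_on_subset[OF W6(3) opW]) (auto simp: W_def)
    show "fd C0 x (axis i 1 - (fd r0 x (axis i 1) / fd r0 x e) *\<^sub>R e) = r0 x ^ k * \<beta> i x" if "x \<in> W \<inter> interior_img V \<phi>" for x i
      using W6(4)[of _ i] that by (auto simp: Z_def W_def)
  qed (use Hnz sub sub5 in auto)
qed

end

section \<open>Extension of the connection to the boundary\<close>

context manifold_with_boundary begin

lemma vf_extends_from_bdry:
  assumes U: "open U" and \<xi>: "\<xi> \<in> vector_fields A (U - bdry A)"
    and bd: "\<And>p. p \<in> U \<Longrightarrow> p \<in> bdry A \<Longrightarrow> vf_extends_near U \<xi> p"
  shows "vector_field_extends A U \<xi>"
proof (rule vf_extendsI[OF _ U])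
  fix p assume p: "p \<in> U"
  show "vf_extends_near U \<xi> p"
  proof (cases "p \<in> bdry A")
    case False
    obtain V \<phi> where c: "(V, \<phi>) \<in> A" "p \<in> V" using chart_cover by blast
    have M: "open (U - bdry A)" "p \<in> U - bdry A" using U open_interior p False by (auto simp: Diff_eq open_Int)
    then obtain W X where "\<phi> p \<in> W" "rep V \<phi> W (comps \<phi> \<xi>) X"
      using vf_rep[OF \<xi> M(1) c(1) M(2) c(2)] by metis
    then show ?thesis using c
      by (intro exI[of _ V] exI[of _ \<phi>] exI[of _ W] exI[of _ X]) (auto simp: rep_def)
  qed (use bd p in simp)
qed

lemma fun_extends_from_bdry:
  fixes f :: "'a \<Rightarrow> 'b::real_normed_vector"
  assumes U: "open U" and f: "smooth_fun A (U - bdry A) f"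
    and bd: "\<And>p. p \<in> U \<Longrightarrow> p \<in> bdry A \<Longrightarrow> fun_extends_near Q U f p"
  shows "\<exists>F. smooth_fun A U F \<and> (\<forall>q\<in>U - bdry A. F q = f q) \<and> (\<forall>q\<in>U \<inter> bdry A. Q (F q))"
proof (rule fun_extendsI[OF _ U])
  fix p assume p: "p \<in> U"
  show "fun_extends_near Q U f p"
  proof (cases "p \<in> bdry A")
    case False
    obtain V \<phi> where c: "(V, \<phi>) \<in> A" "p \<in> V" using chart_cover by blast
    have M: "open (U - bdry A)" "p \<in> U - bdry A" using U open_interior p False by (auto simp: Diff_eq open_Int)
    then obtain W F where "\<phi> p \<in> W" "rep V \<phi> W f F" "\<And>q. q \<in> V \<Longrightarrow> \<phi> q \<in> W \<Longrightarrow> q \<in> U - bdry A"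
      using smooth_fun_rep[OF f M(1) c(1) M(2) c(2)] by metis
    then show ?thesis using c
      by (intro exI[of _ V] exI[of _ \<phi>] exI[of _ W] exI[of _ F]) (auto simp: rep_def)
  qed (use bd p in simp)
qed

end

context pseudo_riemannian_interior begin

lemma nabla_rho_interior:
  assumes \<rho>: "local_defining_function A U \<rho>" and \<xi>: "\<xi> \<in> vector_fields A U" and \<eta>: "\<eta> \<in> vector_fields A U"
  shows "nabla_rho A LC \<rho> \<xi> \<eta> \<in> vector_fields A (U - bdry A)"
proof -
  have U: "open U" and sm: "smooth_fun A U \<rho>" and nz: "\<And>q. q \<in> U - bdry A \<Longrightarrow> \<rho> q \<noteq> 0"
    using \<rho> by (auto simp: local_defining_function_def)
  let ?M = "U - bdry A"
  have M: "open ?M" "?M \<subseteq> - bdry A" using U open_interior by (auto simp: Diff_eq open_Int)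
  have \<rho>M: "smooth_fun A ?M \<rho>" and \<xi>M: "\<xi> \<in> vector_fields A ?M" and \<eta>M: "\<eta> \<in> vector_fields A ?M"
    using smooth_fun_subset[OF sm U] vf_subset[OF \<xi> U] vf_subset[OF \<eta> U] by auto
  have "Cinf_on (- {0}) (\<lambda>x::real. inverse x)" by (intro Cinf_on_inverse Cinf_on_ident) auto
  then have inv: "smooth_fun A ?M (\<lambda>q. inverse (\<rho> q))" by (rule smooth_fun_compose[OF \<rho>M M(1)]) (use nz in auto)
  have "(\<lambda>q. LC \<xi> \<eta> q + inverse (\<rho> q) *\<^sub>R dd A \<rho> q (\<xi> q) *\<^sub>R \<eta> q + inverse (\<rho> q) *\<^sub>R dd A \<rho> q (\<eta> q) *\<^sub>R \<xi> q) \<in> vector_fields A ?M"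
    by (intro vf_add LC_vf M \<xi>M \<eta>M vf_scale[OF inv] vf_scale[OF smooth_fun_dd[OF \<rho>M M(1)]])
  moreover have "nabla_rho A LC \<rho> \<xi> \<eta> = (\<lambda>q. LC \<xi> \<eta> q + inverse (\<rho> q) *\<^sub>R dd A \<rho> q (\<xi> q) *\<^sub>R \<eta> q + inverse (\<rho> q) *\<^sub>R dd A \<rho> q (\<eta> q) *\<^sub>R \<xi> q)"
    by (simp add: nabla_rho_def fun_eq_iff divide_inverse mult.commute)
  ultimately show ?thesis by simp
qed

end

text \<open>A chart around a boundary point with extensions of all the data. The defining function \<open>\<rho>\<close> for which
  \<open>\<nabla>\<^sup>\<rho>\<close> is studied and the one in the asymptotic form, represented by \<open>r0\<close>, may differ by a
  factor \<open>f\<close>.\<close>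

locale boundary_chart = pseudo_riemannian_interior A g
  for A :: "('a::{t2_space,second_countable_topology}, 'n::finite) chart set" and g +
  fixes U :: "'a set" and \<rho> :: "'a \<Rightarrow> real" and \<xi> \<eta> :: "'a \<Rightarrow> real^'n" and V :: "'a set" and \<phi> :: "'a \<Rightarrow> real^'n" and p :: 'a
    and W :: "(real^'n) set" and r0 r1 f C :: "real^'n \<Rightarrow> real" and h :: "real^'n \<Rightarrow> real^'n^'n" and e :: "real^'n"
    and H :: "real^'n \<Rightarrow> real" and X Y :: "real^'n \<Rightarrow> real^'n" and \<beta> :: "real^'n \<Rightarrow> 'n \<Rightarrow> real" and k :: nat
  assumes ldf: "local_defining_function A U \<rho>" and \<xi>: "\<xi> \<in> vector_fields A U" and \<eta>: "\<eta> \<in> vector_fields A U"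
    and c: "(V, \<phi>) \<in> A" "p \<in> V" and pW: "\<phi> p \<in> W" and pb: "p \<in> bdry A" and inU: "\<And>q. q \<in> V \<Longrightarrow> \<phi> q \<in> W \<Longrightarrow> q \<in> U"
    and r1: "rep V \<phi> W \<rho> r1" and X: "rep V \<phi> W (comps \<phi> \<xi>) X" and Y: "rep V \<phi> W (comps \<phi> \<eta>) Y"
    and f: "Cinf_on W f" and f_nz: "\<And>x. x \<in> W \<Longrightarrow> f x \<noteq> 0" and r1_eq: "\<And>x. x \<in> W \<Longrightarrow> r1 x = f x * r0 x"
    and H: "Cinf_on W H" and H_nz: "\<And>x. x \<in> W \<Longrightarrow> H x \<noteq> 0" and r0_eq: "\<And>x. x \<in> W \<Longrightarrow> r0 x = x $ bidx * H x"
    and coords: "asymptotic_coords W (\<phi> p) r0 C h (G V \<phi>) e (W \<inter> interior_img V \<phi>)"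
    and \<beta>: "\<And>i. Cinf_on W (\<lambda>x. \<beta> x i)"
    and decay: "\<And>x i. x \<in> W \<inter> interior_img V \<phi> \<Longrightarrow>
       fd C x (axis i 1 - (fd r0 x (axis i 1) / fd r0 x e) *\<^sub>R e) = r0 x ^ k * \<beta> x i"
begin

sublocale ac: asymptotic_coords W "\<phi> p" r0 C h "G V \<phi>" e "W \<inter> interior_img V \<phi>"
  by (rule coords)

lemma XC: "Cinf_on W X" and YC: "Cinf_on W Y" and r1C: "Cinf_on W r1"
  using rep_Cinf X Y r1 by blast+

lemma fd_r0_bdry: "x \<in> W \<Longrightarrow> x $ bidx = 0 \<Longrightarrow> fd r0 x v = v $ bidx * H x"
  using fd_factor_bdry[OF H _ _ r0_eq] .

lemma fd_r1: "x \<in> W \<Longrightarrow> fd r1 x v = f x * fd r0 x v + fd f x v * r0 x"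
proof -
  assume x: "x \<in> W"
  have "(r1 has_derivative (\<lambda>v. f x * fd r0 x v + fd f x v * r0 x)) (at x)"
    by (rule has_derivative_transform_within_open[OF has_derivative_mult[OF Cinf_on_has_derivative[OF f x] Cinf_on_has_derivative[OF ac.\<rho> x]]
          Cinf_on_open[OF f] x]) (simp add: r1_eq)
  then show ?thesis by (simp add: fd_eq)
qed

text \<open>The difference between the components of \<open>\<nabla>\<^sup>\<rho>\<^bsub>\<xi>\<^esub>\<eta>\<close> and \<open>N\<close>: the derivative of the components of \<open>\<eta>\<close> and the
  effect of the factor \<open>f\<close> on the logarithmic derivative of \<open>\<rho>\<close>.\<close>

definition S :: "real^'n \<Rightarrow> real^'n" where
  "S x = fd Y x (X x) + (fd f x (X x) / f x) *\<^sub>R Y x + (fd f x (Y x) / f x) *\<^sub>R X x"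

lemma S: "Cinf_on W S"
proof -
  have "Cinf_on W (\<lambda>x. fd Y x (X x) + (fd f x (X x) / f x) *\<^sub>R Y x + (fd f x (Y x) / f x) *\<^sub>R X x)"
    by (intro Cinf_on_add Cinf_on_scaleR Cinf_on_divide Cinf_on_fd XC YC f f_nz)
  then show ?thesis by (simp add: S_def[abs_def])
qed

lemma nabla_comps:
  assumes q: "q \<in> V - bdry A" "\<phi> q \<in> W"
  shows "dd A \<phi> q (nabla_rho A LC \<rho> \<xi> \<eta> q) = ac.N (\<phi> q) (X (\<phi> q)) (Y (\<phi> q)) + S (\<phi> q)"
proof -
  let ?x = "\<phi> q"
  have qV: "q \<in> V" and qU: "q \<in> U - bdry A" using q inU by auto
  have U: "open U" using ldf by (simp add: local_defining_function_def)
  have M: "open (U - bdry A)" "U - bdry A \<subseteq> - bdry A" using U open_interior by (auto simp: Diff_eq open_Int)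
  have vfM: "\<xi> \<in> vector_fields A (U - bdry A)" "\<eta> \<in> vector_fields A (U - bdry A)"
    using vf_subset[OF \<xi> U] vf_subset[OF \<eta> U] by auto
  have Xq: "dd A \<phi> q (\<xi> q) = X ?x" and Yq: "dd A \<phi> q (\<eta> q) = Y ?x" and \<rho>q: "\<rho> q = f ?x * r0 ?x"
    using rep_eq[OF X qV q(2)] rep_eq[OF Y qV q(2)] rep_eq[OF r1 qV q(2)] r1_eq[OF q(2)] by simp_all
  have LC: "dd A \<phi> q (LC \<xi> \<eta> q) = fd Y ?x (X ?x) + christoffel (G V \<phi>) ?x (X ?x) (Y ?x)"
    using LC_comps[OF c(1) qV M qU vfM Y q(2)] by (simp add: Xq Yq)
  have nz: "f ?x \<noteq> 0" "r0 ?x \<noteq> 0" using f_nz ac.\<rho>_nz q by auto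
  have quot: "dd A \<rho> q v / \<rho> q = fd r0 ?x (dd A \<phi> q v) / r0 ?x + fd f ?x (dd A \<phi> q v) / f ?x" for v
    unfolding dd_rep[OF c(1) qV r1 q(2)] fd_r1[OF q(2)] \<rho>q using nz by (simp add: field_simps)
  note lin = chart_dd_linear[OF c(1) qV]
  show ?thesis
    unfolding nabla_rho_def linear_add[OF lin] linear_scale[OF lin] LC quot Xq Yq ac.N_def S_def
    by (simp add: scaleR_add_left)
qed

lemma N_extension_vf:
  assumes W': "\<phi> p \<in> W'" "W' \<subseteq> W" and P: "Cinf_on W' P"
    and eq: "\<And>x. x \<in> W' \<inter> (W \<inter> interior_img V \<phi>) \<Longrightarrow> P x = ac.N x (X x) (Y x)"
  shows "vf_extends_near U (nabla_rho A LC \<rho> \<xi> \<eta>) p"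
proof (intro exI conjI ballI impI)
  show "Cinf_on W' (\<lambda>x. P x + S x)"
    by (intro Cinf_on_add P Cinf_on_subset[OF S Cinf_on_open[OF P] W'(2)])
  show "P (\<phi> q) + S (\<phi> q) = dd A \<phi> q (nabla_rho A LC \<rho> \<xi> \<eta> q)" if "q \<in> V \<inter> U - bdry A" "\<phi> q \<in> W'" for q
    using nabla_comps[of q] eq[of "\<phi> q"] that W'(2) by auto
qed (use c W' in auto)

lemma scaled_extension_vf:
  assumes W': "\<phi> p \<in> W'" "W' \<subseteq> W" and P: "Cinf_on W' P"
    and eq: "\<And>x. x \<in> W' \<inter> (W \<inter> interior_img V \<phi>) \<Longrightarrow> P x = r0 x *\<^sub>R ac.N x (X x) (Y x)"
  shows "vf_extends_near U (\<lambda>q. \<rho> q *\<^sub>R nabla_rho A LC \<rho> \<xi> \<eta> q) p"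
proof (intro exI conjI ballI impI)
  note sub = Cinf_on_subset[OF _ Cinf_on_open[OF P] W'(2)]
  show "Cinf_on W' (\<lambda>x. f x *\<^sub>R P x + r1 x *\<^sub>R S x)"
    by (intro Cinf_on_add Cinf_on_scaleR P sub[OF S] sub[OF f] sub[OF r1C])
  fix q assume q: "q \<in> V \<inter> U - bdry A" "\<phi> q \<in> W'"
  then have qV: "q \<in> V" and qW: "\<phi> q \<in> W" using W'(2) by auto
  show "f (\<phi> q) *\<^sub>R P (\<phi> q) + r1 (\<phi> q) *\<^sub>R S (\<phi> q) = dd A \<phi> q (\<rho> q *\<^sub>R nabla_rho A LC \<rho> \<xi> \<eta> q)"
    using nabla_comps[of q] eq[of "\<phi> q"] q qW rep_eq[OF r1 qV qW] r1_eq[OF qW] linear_scale[OF chart_dd_linear[OF c(1) qV]]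
    by (simp add: scaleR_add_right)
qed (use c W' in auto)

lemma normal_extension:
  assumes W': "\<phi> p \<in> W'" "W' \<subseteq> W" and P: "Cinf_on W' P"
    and eq: "\<And>x. x \<in> W' \<inter> (W \<inter> interior_img V \<phi>) \<Longrightarrow> P x = r0 x *\<^sub>R ac.N x (X x) (Y x)"
    and bd: "\<And>x. x \<in> W' \<Longrightarrow> x $ bidx = 0 \<Longrightarrow> T (f x * ac.normal_part X Y P x + fd f x (P x) + fd r1 x (S x))"
  shows "fun_extends_near T U (\<lambda>q. dd A \<rho> q (nabla_rho A LC \<rho> \<xi> \<eta> q)) p"
proof (intro exI conjI ballI impI)
  note sub = Cinf_on_subset[OF _ Cinf_on_open[OF P] W'(2)]
  let ?F = "\<lambda>x. f x * ac.normal_part X Y P x + fd f x (P x) + fd r1 x (S x)"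
  show "Cinf_on W' ?F"
    by (intro Cinf_on_add Cinf_on_mult Cinf_on_fd P sub[OF S] sub[OF f] sub[OF r1C] ac.Cinf_on_normal_part[OF XC YC P W'(2)])
  show "?F (\<phi> q) = dd A \<rho> q (nabla_rho A LC \<rho> \<xi> \<eta> q)" if q: "q \<in> V \<inter> U - bdry A" "\<phi> q \<in> W'" for q
  proof -
    let ?x = "\<phi> q" and ?N = "ac.N (\<phi> q) (X (\<phi> q)) (Y (\<phi> q))"
    have qV: "q \<in> V" and qW: "?x \<in> W" and x: "?x \<in> W' \<inter> (W \<inter> interior_img V \<phi>)" using W'(2) q by auto
    have np: "ac.normal_part X Y P ?x = fd r0 ?x ?N" by (rule ac.normal_part_eq) (use x eq in auto)
    have fP: "fd f ?x (P ?x) = r0 ?x * fd f ?x ?N" using eq[OF x] linear_scale[OF fd_linear[OF f qW]] by simp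
    have "dd A \<rho> q (nabla_rho A LC \<rho> \<xi> \<eta> q) = fd r1 ?x (?N + S ?x)"
      using dd_rep[OF c(1) qV r1 qW] nabla_comps[of q] q qW by simp
    also have "\<dots> = f ?x * fd r0 ?x ?N + fd f ?x ?N * r0 ?x + fd r1 ?x (S ?x)"
      using linear_add[OF fd_linear[OF r1C qW]] fd_r1[OF qW] by simp
    finally show ?thesis unfolding np fP by simp
  qed
  show "T (?F (\<phi> q))" if "q \<in> V \<inter> U \<inter> bdry A" "\<phi> q \<in> W'" for q
    using bd[of "\<phi> q"] that bdry_iff[OF c(1)] by auto
qed (use c W' in auto)

abbreviation tangential :: "(real^'n \<Rightarrow> real^'n) \<Rightarrow> bool" where
  "tangential Z \<equiv> \<forall>x\<in>W. x $ bidx = 0 \<longrightarrow> Z x $ bidx = 0"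

lemma decay_proj: "x \<in> W \<inter> interior_img V \<phi> \<Longrightarrow> fd C x (ac.proj x (axis i 1)) = r0 x ^ k * \<beta> x i"
  using decay by (simp add: ac.proj_def)

lemma N_extension:
  assumes "k = 2 \<or> k = 1 \<and> (tangential X \<or> tangential Y)"
  obtains W' P where "\<phi> p \<in> W'" "W' \<subseteq> W" "Cinf_on W' P"
    "\<And>x. x \<in> W' \<inter> (W \<inter> interior_img V \<phi>) \<Longrightarrow> P x = ac.N x (X x) (Y x)"
proof -
  let ?t = "\<lambda>x. fd r0 x (X x) * fd r0 x (Y x)"
  have t: "Cinf_on W ?t" by (intro Cinf_on_mult Cinf_on_fd ac.\<rho> XC YC)
  \<comment> \<open>for \<open>k = 2\<close> the decay of \<open>C\<close> supplies both factors \<open>r0\<close>, for \<open>k = 1\<close> tangency supplies the second one\<close>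
  have "\<exists>W1 a. \<phi> p \<in> W1 \<and> W1 \<subseteq> W \<and> Cinf_on W1 a \<and> (\<forall>x\<in>W1. r0 x ^ k * ?t x = r0 x ^ 2 * a x)"
  proof (cases "k = 2")
    case True
    then show ?thesis using t pW by (intro exI[of _ W] exI[of _ ?t]) auto
  next
    case False
    then have k: "k = 1" and tg: "tangential X \<or> tangential Y" using assms by auto
    have zero: "?t x = 0" if "x \<in> W" "x \<bullet> axis bidx 1 = 0" for x
    proof -
      have "x $ bidx = 0" using that(2) by (simp add: inner_axis)
      then show ?thesis using tg fd_r0_bdry[OF that(1)] that(1) by auto
    qed
    have "\<phi> p \<bullet> axis bidx 1 = 0" using bdry_iff[OF c] pb by (simp add: inner_axis)
    then obtain W1 a where a: "\<phi> p \<in> W1" "W1 \<subseteq> W" "Cinf_on W1 a" "\<And>x. x \<in> W1 \<Longrightarrow> ?t x = (x \<bullet> axis bidx 1) * a x"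
      using Hadamard[OF t pW _ norm_axis_1 zero] by metis
    have "r0 x ^ k * ?t x = r0 x ^ 2 * (a x / H x)" if "x \<in> W1" for x
    proof -
      have xW: "x \<in> W" using a(2) that by auto
      have "?t x = x $ bidx * a x" using a(4)[OF that] by (simp add: inner_axis)
      also have "\<dots> = r0 x * (a x / H x)" using r0_eq[OF xW] H_nz[OF xW] by simp
      finally show ?thesis by (simp add: k power2_eq_square)
    qed
    moreover have "Cinf_on W1 (\<lambda>x. a x / H x)"
      by (intro Cinf_on_divide a(3) Cinf_on_subset[OF H Cinf_on_open[OF a(3)] a(2)]) (use H_nz a(2) in auto)
    ultimately show ?thesis using a(1,2) by (intro exI[of _ W1] exI[of _ "\<lambda>x. a x / H x"]) auto
  qed
  then obtain W1 a where a: "\<phi> p \<in> W1" "W1 \<subseteq> W" "Cinf_on W1 a" "\<And>x. x \<in> W1 \<Longrightarrow> r0 x ^ k * ?t x = r0 x ^ 2 * a x"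
    by blast
  have op: "open W1" by (rule Cinf_on_open[OF a(3)])
  interpret ac1: asymptotic_coords W1 "\<phi> p" r0 C h "G V \<phi>" e "W1 \<inter> (W \<inter> interior_img V \<phi>)"
    by (rule asymptotic_coords_restrict[OF coords op a(2,1)])
  obtain W' P where "\<phi> p \<in> W'" "W' \<subseteq> W1" "Cinf_on W' P"
    "\<And>x. x \<in> W' \<inter> (W1 \<inter> (W \<inter> interior_img V \<phi>)) \<Longrightarrow> P x = 1 *\<^sub>R ac.N x (X x) (Y x)"
  proof (rule ac1.scaled_extension)
    show "Cinf_on W1 X" "Cinf_on W1 Y" "Cinf_on W1 (\<lambda>x. 1 :: real)"
      using Cinf_on_subset[OF XC op a(2)] Cinf_on_subset[OF YC op a(2)] Cinf_on_const[OF op] by auto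
    show "Cinf_on W1 (\<lambda>x. \<beta> x i * a x)" for i
      by (intro Cinf_on_mult a(3) Cinf_on_subset[OF \<beta> op a(2)])
    fix x i assume x: "x \<in> W1 \<inter> (W \<inter> interior_img V \<phi>)"
    have "fd C x (ac.proj x (axis i 1)) * fd r0 x (X x) * fd r0 x (Y x) = \<beta> x i * (r0 x ^ k * ?t x)"
      using decay_proj[of x i] x by simp
    also have "\<dots> = r0 x ^ 2 * (\<beta> x i * a x)" using a(4)[of x] x by simp
    finally show "r0 x ^ 2 * (\<beta> x i * a x) = 1 * (fd C x (ac1.proj x (axis i 1)) * fd r0 x (X x) * fd r0 x (Y x))"
      by simp
  qed (rule that)
  then show thesis using a(2) by (intro that[of W' P]) auto
qed

text \<open>With one factor of \<open>\<rho>\<close> from the decay of \<open>C\<close>, the choice \<open>s = \<rho>\<close> supplies the second one.\<close>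

lemma rho_N_extension:
  assumes k: "k = 1"
  obtains W' P where "\<phi> p \<in> W'" "W' \<subseteq> W" "Cinf_on W' P"
    "\<And>x. x \<in> W' \<inter> (W \<inter> interior_img V \<phi>) \<Longrightarrow> P x = r0 x *\<^sub>R ac.N x (X x) (Y x)"
proof (rule ac.scaled_extension[OF XC YC ac.\<rho>])
  show "Cinf_on W (\<lambda>x. \<beta> x i * (fd r0 x (X x) * fd r0 x (Y x)))" for i
    by (intro Cinf_on_mult \<beta> Cinf_on_fd ac.\<rho> XC YC)
  show "r0 x ^ 2 * (\<beta> x i * (fd r0 x (X x) * fd r0 x (Y x))) =
      r0 x * (fd C x (ac.proj x (axis i 1)) * fd r0 x (X x) * fd r0 x (Y x))" if "x \<in> W \<inter> interior_img V \<phi>" for x i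
    using decay_proj[OF that, of i] by (simp add: k power2_eq_square)
qed (rule that)

lemma nabla_extends:
  assumes "k = 2 \<or> k = 1 \<and> (tangential X \<or> tangential Y)"
  shows "vf_extends_near U (nabla_rho A LC \<rho> \<xi> \<eta>) p"
  using N_extension[OF assms] N_extension_vf by metis

lemma rho_nabla_extends: "k = 1 \<Longrightarrow> vf_extends_near U (\<lambda>q. \<rho> q *\<^sub>R nabla_rho A LC \<rho> \<xi> \<eta> q) p"
  using rho_N_extension scaled_extension_vf by metis

lemma normal_extends: "k = 1 \<Longrightarrow> fun_extends_near (\<lambda>_. True) U (\<lambda>q. dd A \<rho> q (nabla_rho A LC \<rho> \<xi> \<eta> q)) p"
proof -
  assume "k = 1"
  then obtain W' P where "\<phi> p \<in> W'" "W' \<subseteq> W" "Cinf_on W' P"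
      "\<And>x. x \<in> W' \<inter> (W \<inter> interior_img V \<phi>) \<Longrightarrow> P x = r0 x *\<^sub>R ac.N x (X x) (Y x)"
    using rho_N_extension by metis
  then show ?thesis by (rule normal_extension) simp_all
qed

text \<open>On the boundary the normal component reduces to \<open>f\<close> times the derivative of \<open>dr0(Y)\<close> along \<open>X\<close>, which
  vanishes since \<open>dr0(Y)\<close> is zero on the boundary and \<open>X\<close> is tangential.\<close>

lemma normal_extends_zero:
  assumes k: "k = 1" and tX: "tangential X" and tY: "tangential Y"
  shows "fun_extends_near (\<lambda>y. y = 0) U (\<lambda>q. dd A \<rho> q (nabla_rho A LC \<rho> \<xi> \<eta> q)) p"
proof -
  obtain W' P where P: "\<phi> p \<in> W'" "W' \<subseteq> W" "Cinf_on W' P"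
    "\<And>x. x \<in> W' \<inter> (W \<inter> interior_img V \<phi>) \<Longrightarrow> P x = ac.N x (X x) (Y x)"
    using N_extension k tX by metis
  show ?thesis
  proof (rule normal_extension[OF P(1,2)])
    show "Cinf_on W' (\<lambda>x. r0 x *\<^sub>R P x)"
      by (intro Cinf_on_scaleR P(3) Cinf_on_subset[OF ac.\<rho> Cinf_on_open[OF P(3)] P(2)])
    show "r0 x *\<^sub>R P x = r0 x *\<^sub>R ac.N x (X x) (Y x)" if "x \<in> W' \<inter> (W \<inter> interior_img V \<phi>)" for x
      using P(4)[OF that] by simp
    fix x assume "x \<in> W'" and xb: "x $ bidx = 0"
    then have x: "x \<in> W" using P(2) by auto
    have r0x: "r0 x = 0" using r0_eq[OF x] xb by simp
    have rX: "fd r0 x (X x) = 0" and rY: "fd r0 x (Y x) = 0" using fd_r0_bdry[OF x xb] tX tY x xb by auto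
    have "fd (\<lambda>y. fd r0 y (Y y)) x (X x) = 0"
    proof (rule vanish_bdry_derivative[OF Cinf_on_fd[OF ac.\<rho> YC] x xb])
      show "fd r0 y (Y y) = 0" if "y \<in> W" "y $ bidx = 0" for y using fd_r0_bdry[OF that] tY that by simp
      show "X x $ bidx = 0" using tX x xb by simp
    qed
    then have 1: "ac.rr x (X x) (Y x) + fd r0 x (fd Y x (X x)) = 0" using fd_fd_field[OF ac.\<rho> YC x] by simp
    note lin = ac.r_lin[OF x]
    have "fd r1 x (S x) = f x * fd r0 x (fd Y x (X x))"
      using rX rY r0x by (simp add: fd_r1[OF x] S_def linear_add[OF lin] linear_scale[OF lin])
    moreover have "ac.normal_part X Y (\<lambda>x. r0 x *\<^sub>R P x) x = ac.rr x (X x) (Y x)"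
      by (rule ac.normal_part_bdry[of x X Y, OF x r0x rX rY])
    moreover have "fd f x (r0 x *\<^sub>R P x) = 0" using linear_0[OF fd_linear[OF f x]] r0x by simp
    ultimately have "f x * ac.normal_part X Y (\<lambda>x. r0 x *\<^sub>R P x) x + fd f x (r0 x *\<^sub>R P x) + fd r1 x (S x)
        = f x * (ac.rr x (X x) (Y x) + fd r0 x (fd Y x (X x)))"
      by (simp add: distrib_left)
    then show "f x * ac.normal_part X Y (\<lambda>x. r0 x *\<^sub>R P x) x + fd f x (r0 x *\<^sub>R P x) + fd r1 x (S x) = 0"
      using 1 by simp
  qed
qed

lemma tangential_rep:
  assumes "rep V \<phi> W (comps \<phi> \<zeta>) Z" "\<zeta> \<in> vector_fields_bdry A U"
  shows "tangential Z"
proof (intro ballI impI)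
  fix x assume x: "x \<in> W" "x $ bidx = 0"
  have "x \<in> \<phi> ` V" using rep_image[OF assms(1) x(1)] x(2) by (simp add: halfspace_def)
  then obtain q where q: "x = \<phi> q" "q \<in> V" by blast
  then have qb: "q \<in> U \<inter> bdry A" using inU bdry_iff[OF c(1)] x by auto
  then have "\<zeta> q \<in> tangent_bdry A q" using assms(2) by (auto simp: vector_fields_bdry_def)
  then show "Z x $ bidx = 0"
    using tangent_bdry_iff[OF c(1) q(2)] qb rep_eq[OF assms(1) q(2)] q(1) x(1) by auto
qed

end

context pseudo_riemannian_interior begin

lemma boundary_chart_exists:
  assumes ldf: "local_defining_function A U \<rho>" and \<xi>: "\<xi> \<in> vector_fields A U" and \<eta>: "\<eta> \<in> vector_fields A U"
    and p: "p \<in> U" "p \<in> bdry A"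
    and hyp: "\<exists>U \<rho> C. p \<in> U \<and> asymptotic_form A g U \<rho> C \<and> tangential_decay A U \<rho> C k"
  obtains V \<phi> W r0 r1 f C h e H X Y \<beta> where "boundary_chart A g U \<rho> \<xi> \<eta> V \<phi> p W r0 r1 f C h e H X Y \<beta> k"
proof -
  obtain U0 \<rho>0 C0 where h0: "p \<in> U0" "asymptotic_form A g U0 \<rho>0 C0" "tangential_decay A U0 \<rho>0 C0 k" using hyp by blast
  obtain V \<phi> where c: "(V, \<phi>) \<in> A" "p \<in> V" using chart_cover by blast
  have U: "open U" and sm: "smooth_fun A U \<rho>" using ldf by (auto simp: local_defining_function_def)
  obtain W1 r1 where r1: "\<phi> p \<in> W1" "rep V \<phi> W1 \<rho> r1" "\<And>q. q \<in> V \<Longrightarrow> \<phi> q \<in> W1 \<Longrightarrow> q \<in> U"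
    using smooth_fun_rep[OF sm U c(1) p(1) c(2)] by metis
  obtain W2 X where X: "\<phi> p \<in> W2" "rep V \<phi> W2 (comps \<phi> \<xi>) X" using vf_rep[OF \<xi> U c(1) p(1) c(2)] by metis
  obtain W3 Y where Y: "\<phi> p \<in> W3" "rep V \<phi> W3 (comps \<phi> \<eta>) Y" using vf_rep[OF \<eta> U c(1) p(1) c(2)] by metis
  obtain W4 H1 where H1: "\<phi> p \<in> W4" "W4 \<subseteq> W1" "Cinf_on W4 H1" "\<And>x. x \<in> W4 \<Longrightarrow> H1 x \<noteq> 0" "\<And>x. x \<in> W4 \<Longrightarrow> r1 x = x $ bidx * H1 x"
    using defining_function_factor[OF ldf c p r1(2,1,3)] by metis
  define W0 where "W0 = W2 \<inter> W3 \<inter> W4"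
  have W0: "open W0" "\<phi> p \<in> W0" using rep_open[OF X(2)] rep_open[OF Y(2)] Cinf_on_open[OF H1(3)] X(1) Y(1) H1(1) by (auto simp: W0_def)
  obtain W r0 C h e \<beta> H where W: "\<phi> p \<in> W" "W \<subseteq> W0" "rep V \<phi> W \<rho>0 r0" "\<And>q. q \<in> V \<Longrightarrow> \<phi> q \<in> W \<Longrightarrow> q \<in> U0"
    and coords: "asymptotic_coords W (\<phi> p) r0 C h (G V \<phi>) e (W \<inter> interior_img V \<phi>)"
    and \<beta>: "\<And>i. Cinf_on W (\<lambda>x. \<beta> x i)"
    and decay: "\<And>x i. x \<in> W \<inter> interior_img V \<phi> \<Longrightarrow>
       fd C x (axis i 1 - (fd r0 x (axis i 1) / fd r0 x e) *\<^sub>R e) = r0 x ^ k * \<beta> x i"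
    and H: "Cinf_on W H" "\<And>x. x \<in> W \<Longrightarrow> H x \<noteq> 0" "\<And>x. x \<in> W \<Longrightarrow> r0 x = x $ bidx * H x"
    by (rule asymptotic_coords_exist[OF h0(2,3) c h0(1) p(2) W0]) (rule that)
  have op: "open W" by (rule Cinf_on_open[OF H(1)])
  have sub: "W \<subseteq> W1" "W \<subseteq> W2" "W \<subseteq> W3" "W \<subseteq> W4" using W(2) H1(2) by (auto simp: W0_def)
  have "boundary_chart A g U \<rho> \<xi> \<eta> V \<phi> p W r0 r1 (\<lambda>x. H1 x / H x) C h e H X Y \<beta> k"
  proof (intro boundary_chart.intro boundary_chart_axioms.intro)
    show "pseudo_riemannian_interior A g" by (fact pseudo_riemannian_interior_axioms)
    show "Cinf_on W (\<lambda>x. H1 x / H x)"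
      by (intro Cinf_on_divide H(1) Cinf_on_subset[OF H1(3) op sub(4)] H(2))
    show "rep V \<phi> W \<rho> r1" "rep V \<phi> W (comps \<phi> \<xi>) X" "rep V \<phi> W (comps \<phi> \<eta>) Y"
      using rep_restrict[OF r1(2) op sub(1)] rep_restrict[OF X(2) op sub(2)] rep_restrict[OF Y(2) op sub(3)] by auto
    show "q \<in> U" if "q \<in> V" "\<phi> q \<in> W" for q using r1(3) that sub(1) by blast
    show "H1 x / H x \<noteq> 0" "r1 x = H1 x / H x * r0 x" if "x \<in> W" for x
      using H1(4,5)[of x] H(2,3)[OF that] that sub(4) by auto
  qed (fact ldf \<xi> \<eta> c W(1) p(2) H coords \<beta> decay)+
  then show thesis by (rule that)
qed

context
  fixes U \<rho> \<xi> \<eta>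
  assumes ldf: "local_defining_function A U \<rho>" and vf: "\<xi> \<in> vector_fields A U" "\<eta> \<in> vector_fields A U"
begin

lemma ldf_open: "open U" and ldf_smooth_interior: "smooth_fun A (U - bdry A) \<rho>"
  and open_minus_bdry: "open (U - bdry A)"
  using ldf open_interior smooth_fun_subset[of U \<rho>] by (auto simp: local_defining_function_def Diff_eq open_Int)

lemmas nabla_vf = nabla_rho_interior[OF ldf vf]

lemma nabla_extends_compact:
  assumes hyp: "\<forall>x\<in>bdry A. \<exists>U \<rho> C. x \<in> U \<and> asymptotic_form A g U \<rho> C \<and> tangential_decay A U \<rho> C 2"
  shows "vector_field_extends A U (nabla_rho A LC \<rho> \<xi> \<eta>)"
proof (rule vf_extends_from_bdry[OF ldf_open nabla_vf])
  fix p assume p: "p \<in> U" "p \<in> bdry A"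
  obtain V \<phi> W r0 r1 f C h e H X Y \<beta> where "boundary_chart A g U \<rho> \<xi> \<eta> V \<phi> p W r0 r1 f C h e H X Y \<beta> 2"
    using boundary_chart_exists[OF ldf vf p bspec[OF hyp p(2)]] by metis
  then interpret boundary_chart A g U \<rho> \<xi> \<eta> V \<phi> p W r0 r1 f C h e H X Y \<beta> 2 .
  show "vf_extends_near U (nabla_rho A LC \<rho> \<xi> \<eta>) p" by (rule nabla_extends) simp
qed

context
  assumes hyp: "\<forall>x\<in>bdry A. \<exists>U \<rho> C. x \<in> U \<and> asymptotic_form A g U \<rho> C \<and> tangential_decay A U \<rho> C 1"
begin

lemma nabla_extends_tangential:
  assumes t: "\<xi> \<in> vector_fields_bdry A U \<or> \<eta> \<in> vector_fields_bdry A U"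
  shows "vector_field_extends A U (nabla_rho A LC \<rho> \<xi> \<eta>)"
proof (rule vf_extends_from_bdry[OF ldf_open nabla_vf])
  fix p assume p: "p \<in> U" "p \<in> bdry A"
  obtain V \<phi> W r0 r1 f C h e H X Y \<beta> where "boundary_chart A g U \<rho> \<xi> \<eta> V \<phi> p W r0 r1 f C h e H X Y \<beta> 1"
    using boundary_chart_exists[OF ldf vf p bspec[OF hyp p(2)]] by metis
  then interpret boundary_chart A g U \<rho> \<xi> \<eta> V \<phi> p W r0 r1 f C h e H X Y \<beta> 1 .
  have "tangential X \<or> tangential Y" using t tangential_rep[OF X] tangential_rep[OF Y] by blast
  then show "vf_extends_near U (nabla_rho A LC \<rho> \<xi> \<eta>) p" using nabla_extends by simp
qed

lemma rho_nabla_extends_precompact: "vector_field_extends A U (\<lambda>p. \<rho> p *\<^sub>R nabla_rho A LC \<rho> \<xi> \<eta> p)"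
proof (rule vf_extends_from_bdry[OF ldf_open vf_scale[OF ldf_smooth_interior nabla_vf open_minus_bdry]])
  fix p assume p: "p \<in> U" "p \<in> bdry A"
  obtain V \<phi> W r0 r1 f C h e H X Y \<beta> where "boundary_chart A g U \<rho> \<xi> \<eta> V \<phi> p W r0 r1 f C h e H X Y \<beta> 1"
    using boundary_chart_exists[OF ldf vf p bspec[OF hyp p(2)]] by metis
  then interpret boundary_chart A g U \<rho> \<xi> \<eta> V \<phi> p W r0 r1 f C h e H X Y \<beta> 1 .
  show "vf_extends_near U (\<lambda>p. \<rho> p *\<^sub>R nabla_rho A LC \<rho> \<xi> \<eta> p) p" by (rule rho_nabla_extends[OF refl])
qed

lemma normal_extends_precompact: "smooth_fun_extends A U (\<lambda>p. dd A \<rho> p (nabla_rho A LC \<rho> \<xi> \<eta> p))"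
proof -
  have "\<exists>F. smooth_fun A U F \<and> (\<forall>q\<in>U - bdry A. F q = dd A \<rho> q (nabla_rho A LC \<rho> \<xi> \<eta> q)) \<and> (\<forall>q\<in>U \<inter> bdry A. True)"
  proof (rule fun_extends_from_bdry[OF ldf_open smooth_fun_dd[OF ldf_smooth_interior open_minus_bdry nabla_vf]])
    fix p assume p: "p \<in> U" "p \<in> bdry A"
    obtain V \<phi> W r0 r1 f C h e H X Y \<beta> where "boundary_chart A g U \<rho> \<xi> \<eta> V \<phi> p W r0 r1 f C h e H X Y \<beta> 1"
      using boundary_chart_exists[OF ldf vf p bspec[OF hyp p(2)]] by metis
    then interpret boundary_chart A g U \<rho> \<xi> \<eta> V \<phi> p W r0 r1 f C h e H X Y \<beta> 1 .
    show "fun_extends_near (\<lambda>_. True) U (\<lambda>q. dd A \<rho> q (nabla_rho A LC \<rho> \<xi> \<eta> q)) p" by (rule normal_extends[OF refl])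
  qed
  then show ?thesis unfolding smooth_fun_extends_def by blast
qed

lemma normal_extends_by_zero:
  assumes t: "\<xi> \<in> vector_fields_bdry A U" "\<eta> \<in> vector_fields_bdry A U"
  shows "\<exists>F. smooth_fun A U F \<and> (\<forall>p\<in>U - bdry A. F p = dd A \<rho> p (nabla_rho A LC \<rho> \<xi> \<eta> p)) \<and> (\<forall>p\<in>U \<inter> bdry A. F p = 0)"
proof (rule fun_extends_from_bdry[OF ldf_open smooth_fun_dd[OF ldf_smooth_interior open_minus_bdry nabla_vf]])
  fix p assume p: "p \<in> U" "p \<in> bdry A"
  obtain V \<phi> W r0 r1 f C h e H X Y \<beta> where "boundary_chart A g U \<rho> \<xi> \<eta> V \<phi> p W r0 r1 f C h e H X Y \<beta> 1"
    using boundary_chart_exists[OF ldf vf p bspec[OF hyp p(2)]] by metis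
  then interpret boundary_chart A g U \<rho> \<xi> \<eta> V \<phi> p W r0 r1 f C h e H X Y \<beta> 1 .
  show "fun_extends_near (\<lambda>y. y = 0) U (\<lambda>q. dd A \<rho> q (nabla_rho A LC \<rho> \<xi> \<eta> q)) p"
    by (rule normal_extends_zero[OF refl tangential_rep[OF X t(1)] tangential_rep[OF Y t(2)]])
qed

end
end

lemma projectively_precompact_LC:
  assumes "\<forall>x\<in>bdry A. \<exists>U \<rho> C. x \<in> U \<and> asymptotic_form A g U \<rho> C \<and> tangential_decay A U \<rho> C 1"
  shows "projectively_precompact A LC"
  unfolding projectively_precompact_def
  using LC_special normal_extends_precompact[OF _ _ _ assms] rho_nabla_extends_precompact[OF _ _ _ assms]
    nabla_extends_tangential[OF _ _ _ assms] by blast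

lemma totally_geodesic_LC:
  assumes "\<forall>x\<in>bdry A. \<exists>U \<rho> C. x \<in> U \<and> asymptotic_form A g U \<rho> C \<and> tangential_decay A U \<rho> C 1"
  shows "totally_geodesic_bdry A LC"
  unfolding totally_geodesic_bdry_def
proof (intro allI impI ballI)
  fix U \<rho> \<xi> \<eta>
  assume ldf: "local_defining_function A U \<rho>" and t: "\<xi> \<in> vector_fields_bdry A U" "\<eta> \<in> vector_fields_bdry A U"
  have "\<xi> \<in> vector_fields A U" "\<eta> \<in> vector_fields A U" using t by (auto simp: vector_fields_bdry_def)
  then show "\<exists>F. smooth_fun A U F \<and> (\<forall>p\<in>U - bdry A. F p = dd A \<rho> p (nabla_rho A LC \<rho> \<xi> \<eta> p)) \<and> (\<forall>p\<in>U \<inter> bdry A. F p = 0)"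
    by (rule normal_extends_by_zero[OF ldf _ _ assms t])
qed

lemma projectively_compact_LC:
  assumes "\<forall>x\<in>bdry A. \<exists>U \<rho> C. x \<in> U \<and> asymptotic_form A g U \<rho> C \<and> tangential_decay A U \<rho> C 2"
  shows "projectively_compact A LC"
  unfolding projectively_compact_def using LC_special nabla_extends_compact[OF _ _ _ assms] by blast

end

theorem theorem3p1:
  fixes A :: "('a::{t2_space,second_countable_topology}, 'n::finite) chart set"
    and g :: "'a \<Rightarrow> real^'n \<Rightarrow> real^'n \<Rightarrow> real"
  assumes "smooth_manifold_with_boundary A"
    and "pseudo_riemannian_metric A (- bdry A) g"
  shows "((\<forall>x\<in>bdry A. \<exists>U \<rho> C. x \<in> U \<and> asymptotic_form A g U \<rho> C \<and> tangential_decay A U \<rho> C 1)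
            \<longrightarrow> (\<exists>D. levi_civita A (- bdry A) g D \<and>
                     projectively_precompact A D \<and> totally_geodesic_bdry A D))
       \<and> ((\<forall>x\<in>bdry A. \<exists>U \<rho> C. x \<in> U \<and> asymptotic_form A g U \<rho> C \<and> tangential_decay A U \<rho> C 2)
            \<longrightarrow> (\<exists>D. levi_civita A (- bdry A) g D \<and> projectively_compact A D))"
proof -
  interpret pseudo_riemannian_interior A g
    by unfold_locales (fact assms)+
  show ?thesis
    using LC_levi_civita projectively_precompact_LC totally_geodesic_LC projectively_compact_LC by blast
qed

end
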